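(* Assume the weak Mertens hypothesis, i.e. $\int_1^X \big(M(x)/x\big)^2\,dx \ll \log X$ as $X\to\infty$. Then for $b\ge \pi$, $$|F(b)| \le \frac{C}{\sqrt b} + O(b^{-3}),$$ where $$C=\sum_{\gamma>0}|a(\gamma)| = \sum_{\gamma>0}\left|\frac{\Gamma\left(\tfrac14-i\tfrac{\gamma}{2}\right)}{\zeta'\left(\tfrac12+i\gamma\right)}\right|.$$ Here the implied constant is absolute (there is a constant $K$ such that $|F(b)|\le C b^{-1/2}+K b^{-3}$ for all $b\ge\pi$).
   Context: $\mu$ is the Möbius function, $M(x)=\sum_{n\le x}\mu(n)$, and for $b>0$, $$F(b)=\sum_{n=1}^\infty \frac{\mu(n)}{n}e^{-(b/n)^2}.$$ $\zeta$ is the Riemann zeta function and $\Gamma$ the Gamma function. The weak Mertens hypothesis implies the Riemann hypothesis and that all nontrivial zeros of $\zeta$ are simple; so under this hypothesis the nontrivial zeros are $\rho=\tfrac12+i\gamma$ with $\gamma$ real and $\zeta'(\rho)\neq 0$. Sums over $\gamma>0$ run over the positive ordinates of the nontrivial zeros, and $$a(\gamma)=\frac{\Gamma\left(\tfrac14-i\tfrac{\gamma}{2}\right)}{\zeta'\left(\tfrac12+i\gamma\right)}.$$ *)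

theory Defs
  imports
    "HOL-Complex_Analysis.Complex_Analysis"
    "HOL-Computational_Algebra.Squarefree"
begin

definition moebius :: "nat \<Rightarrow> int" where
  "moebius n = (if squarefree n then (-1) ^ card (prime_factors n) else 0)"

definition mertens :: "real \<Rightarrow> real" where
  "mertens x = (\<Sum>n | 1 \<le> n \<and> real n \<le> x. real_of_int (moebius n))"

definition weak_mertens_hypothesis :: bool where
  "weak_mertens_hypothesis \<longleftrightarrow>
     (\<lambda>X. integral {1..X} (\<lambda>x. (mertens x / x)\<^sup>2)) \<in> O[at_top](\<lambda>X. ln X)"

text \<open>
  The series converges only conditionally, so it is summed in the natural order of its index.
\<close>
definition moebius_gauss_sum :: "real \<Rightarrow> real" where
  "moebius_gauss_sum b =
     (\<Sum>n. real_of_int (moebius (Suc n)) / real (Suc n) * exp (- (b / real (Suc n))\<^sup>2))"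

text \<open>
  The Riemann zeta function is the analytic continuation of its Dirichlet series to the
  punctured plane. The value 0 at the pole is a convention that makes the function unique as a
  total function on the complex numbers.
\<close>
definition is_zeta :: "(complex \<Rightarrow> complex) \<Rightarrow> bool" where
  "is_zeta f \<longleftrightarrow>
     f holomorphic_on (UNIV - {1}) \<and>
     (\<forall>s. Re s > 1 \<longrightarrow> f s = (\<Sum>n. 1 / of_nat (Suc n) powr s)) \<and>
     f 1 = 0"

definition zeta :: "complex \<Rightarrow> complex" where
  "zeta = (THE f. is_zeta f)"

lemma is_zeta_unique:
  assumes "is_zeta f" "is_zeta g"
  shows "f = g"
proof
  fix s :: complex
  show "f s = g s"
  proof (cases "s = 1")
    case True
    then show ?thesis using assms by (simp add: is_zeta_def)
  next
    case False
    have fg: "f holomorphic_on (UNIV - {1})" "g holomorphic_on (UNIV - {1})"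
      using assms by (auto simp: is_zeta_def)
    have "f s - g s = 0"
    proof (rule analytic_continuation_open[where s = "{s. Re s > 1}" and s' = "UNIV - {1}"
          and f = "\<lambda>s. f s - g s" and g = "\<lambda>_. 0"])
      show "open {s. Re s > 1}" by (simp add: open_halfspace_Re_gt)
      show "{s. Re s > 1} \<noteq> {}" by (auto intro!: exI[of _ "2 :: complex"])
      show "connected (UNIV - {1 :: complex})"
        using connected_punctured_universe[of "1 :: complex"] by (simp add: Compl_eq_Diff_UNIV)
      show "(\<lambda>s. f s - g s) holomorphic_on (UNIV - {1})"
        using fg by (intro holomorphic_intros)
      show "f z - g z = 0" if "z \<in> {s. Re s > 1}" for z
        using that assms by (auto simp: is_zeta_def)
    qed (use False in \<open>auto simp: open_delete\<close>)
    then show ?thesis by simp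
  qed
qed

definition nontrivial_zeros :: "complex set" where
  "nontrivial_zeros = {s. 0 < Re s \<and> Re s < 1 \<and> zeta s = 0}"

text \<open>
  The ordinates are taken over all zeros in the critical strip, without presupposing that the
  zeros lie on the critical line or are simple.
\<close>
definition positive_ordinates :: "real set" where
  "positive_ordinates = {\<gamma>. \<gamma> > 0 \<and> (\<exists>\<rho>\<in>nontrivial_zeros. Im \<rho> = \<gamma>)}"

definition zero_coeff :: "real \<Rightarrow> complex" where
  "zero_coeff \<gamma> =
     Gamma (1 / 4 - \<i> * of_real \<gamma> / 2) / deriv zeta (1 / 2 + \<i> * of_real \<gamma>)"

end

theory Submission
  imports Defs
begin

text \<open>
  Let \<open>xi\<close> be the entire function with \<open>xi w = \<pi>\<^bsup>-w/2\<^esup> (w - 1) zeta w / \<Gamma>((3 - w)/2)\<close>, so that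
  \<open>xi (1 - w) = xi w\<close>. Integrate \<open>b\<^bsup>w-1\<^esup> \<pi>\<^bsup>-w/2\<^esup> / xi w\<close> around a rectangle with vertical sides on
  \<open>Re w = -3\<close> and \<open>Re w = 2M + 2\<close>. The residues at \<open>3, 5, ..., 2M + 1\<close> are the terms of the expansion
  \<open>F(b) = \<Sum> (-1)\<^sup>k b\<^bsup>2k\<^esup> / (k! zeta (2k + 1))\<close>, the residues at the zeros \<open>1/2 + i\<gamma>\<close> have modulus
  \<open>\<bar>a(\<gamma>)\<bar> / (2 \<surd>b)\<close>, the residue at \<open>-2\<close> is a multiple of \<open>b\<^sup>-\<^sup>3\<close>, and the left side contributes
  \<open>O(b\<^sup>-\<^sup>4)\<close>.

  The weak Mertens hypothesis enters through \<open>1 / zeta s = s \<integral> M(x) x\<^bsup>-s-1\<^esup> dx\<close>: it bounds the right-hand side by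
  \<open>O(\<bar>s\<bar> / (Re s - 1/2))\<close> for \<open>Re s > 1/2\<close>. Hence all zeros lie on the critical line, and
  \<open>1 / zeta' \<rho> = O(\<bar>\<rho>\<bar>)\<close>. Since \<open>zeta''\<close> grows polynomially, the gaps between zeros are bounded below by a
  negative power of the height. This gives convergence of \<open>\<Sum> \<bar>a(\<gamma>)\<bar>\<close>, and zero-free discs centred on the
  critical line through which the horizontal sides can be drawn; there, the maximum principle turns the
  bound by \<open>1 / \<bar>Re s - 1/2\<bar>\<close> into one that is uniform up to the critical line.
\<close>

subsection \<open>The regularised zeta function\<close>

text \<open>Up to the factor -2, \<open>xi\<close> is the completed zeta function pi^(-w/2)
  Gamma(w/2) zeta(w) divided by the symmetric product Gamma(w/2) Gamma((1-w)/2). The division keeps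
  the symmetry, and to the right of the critical line it makes 1/xi a Gamma factor times a Moebius
  series. So upper bounds for that series replace lower bounds for zeta, and the rapid decay of
  Gamma pays for every polynomial loss. Symmetry carries each estimate to the left half. The
  expansion of F(b) has no term k = 0 because the sum of mu(n)/n is 0; this too is drawn from the
  hypothesis, by way of M(N)/N tending to 0. The order of limits matters: with the integer M of the
  contour fixed, the height grows and removes the horizontal sides; only then M grows, and
  factorials remove the right side and the Taylor remainder. The zeros occur in pairs, which turns
  the halves of |a(\<gamma>)| into C. The functional equation comes from two positive kernels,
  exp(-u x) and 2 x / (x^2 + (2 pi u)^2), which are matched by the partial fractions of 1 / (exp x -
  1).\<close>

lemma holomorphic_on_suminf:
  fixes f :: "nat \<Rightarrow> complex \<Rightarrow> complex"
  assumes S: "open S" and hol: "\<And>n. f n holomorphic_on S"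
    and dom: "\<And>z. z \<in> S \<Longrightarrow> \<exists>d>0. \<exists>h. summable h \<and> (\<forall>n. \<forall>y\<in>ball z d \<inter> S. norm (f n y) \<le> h n)"
  shows "(\<lambda>z. \<Sum>n. f n z) holomorphic_on S"
proof -
  have "\<exists>g g'. \<forall>x \<in> S. ((\<lambda>n. f n x) sums g x) \<and> ((\<lambda>n. deriv (f n) x) sums g' x) \<and>
      (g has_field_derivative g' x) (at x)"
  proof (rule series_and_derivative_comparison_complex [OF S])
    show "(f n has_field_derivative deriv (f n) x) (at x)" if "x \<in> S" for n x
      using holomorphic_derivI[OF hol S that] .
    fix x assume x: "x \<in> S"
    obtain d h where d: "d > 0" "summable h" "\<forall>n. \<forall>y\<in>ball x d \<inter> S. norm (f n y) \<le> h n"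
      using dom[OF x] by blast
    have h0: "h n \<ge> 0" for n
      using d(3)[rule_format, of x n] x d(1) by (meson IntI centre_in_ball norm_ge_zero order_trans)
    show "\<exists>d h. 0 < d \<and> summable h \<and> range h \<subseteq> \<real>\<^sub>\<ge>\<^sub>0 \<and>
        (\<forall>\<^sub>F n in sequentially. \<forall>y\<in>ball x d \<inter> S. cmod(f n y) \<le> cmod (h n))"
      by (rule exI[of _ d], rule exI[of _ "\<lambda>n. complex_of_real (h n)"])
        (use d h0 in \<open>auto simp: summable_of_real\<close>)
  qed
  then obtain g g' where g: "\<And>x. x \<in> S \<Longrightarrow> (\<lambda>n. f n x) sums g x"
    "\<And>x. x \<in> S \<Longrightarrow> (g has_field_derivative g' x) (at x)" by blast
  have "g holomorphic_on S"
    using g(2) S by (auto simp: holomorphic_on_open)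
  then show ?thesis
    by (rule holomorphic_transform) (use g(1) in \<open>auto simp: sums_iff\<close>)
qed

text \<open>The mean value inequality on the segment from a to b. The condition on
  \<open>Re s\<close> makes x^(-Re s - 1) nonincreasing, so its value at the left end bounds the
  derivative.\<close>

lemma norm_powr_real_diff_le:
  fixes s :: complex and a b :: real
  assumes "0 < a" "a \<le> b" "Re s \<ge> -1"
  shows "norm (of_real b powr (-s) - of_real a powr (-s)) \<le> norm s * a powr (-Re s - 1) * (b - a)"
proof -
  have "norm (complex_of_real b powr (-s) - of_real a powr (-s))
      \<le> norm s * a powr (-Re s - 1) * norm (complex_of_real b - of_real a)"
  proof (rule field_differentiable_bound[where S = "complex_of_real ` {a..b}"])
    show "convex (complex_of_real ` {a..b})"
      by (rule convex_linear_image) (auto intro: bounded_linear.linear bounded_linear_of_real)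
    fix z assume "z \<in> complex_of_real ` {a..b}"
    then obtain x where x: "z = of_real x" "a \<le> x" "x \<le> b" by auto
    have "z \<notin> \<real>\<^sub>\<le>\<^sub>0" using x assms by auto
    then show "((\<lambda>z. z powr (-s)) has_field_derivative (-s) * z powr (-s - 1)) (at z within complex_of_real ` {a..b})"
      by (auto intro!: derivative_eq_intros)
    have "norm (z powr (- s - 1)) = x powr (-Re s - 1)"
      using x assms by (subst norm_powr_real_powr) auto
    also have "\<dots> \<le> a powr (-Re s - 1)"
      using x assms by (intro powr_mono2') auto
    finally show "norm (- s * z powr (- s - 1)) \<le> norm s * a powr (- Re s - 1)"
      by (simp add: norm_mult mult_left_mono)
  qed (use assms in auto)
  also have "norm (complex_of_real b - of_real a) = b - a"
    using assms by (simp flip: of_real_diff)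
  finally show ?thesis .
qed

text \<open>The mean value inequality for z^(1-s) with its linear part at a removed: the derivative
  is then a difference of powers z^(-s) - a^(-s), which the previous estimate controls. The power of
  a gained in this way makes \<open>zeta_reg\<close> converge for \<open>Re s\<close> > 0.\<close>

lemma norm_powr_real_second_diff_le:
  fixes s :: complex and a b :: real
  assumes "0 < a" "a \<le> b" "Re s \<ge> -1"
  shows "norm (of_real b powr (1-s) - of_real a powr (1-s) - (1 - s) * of_real a powr (-s) * (b - a))
    \<le> norm (1 - s) * (norm s * a powr (-Re s - 1) * (b - a)) * (b - a)"
proof -
  define f where "f = (\<lambda>z. z powr (1-s) - (1 - s) * complex_of_real a powr (-s) * z)"
  have "norm (f (of_real b) - f (of_real a))
      \<le> norm (1 - s) * (norm s * a powr (-Re s - 1) * (b - a)) * norm (complex_of_real b - of_real a)"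
  proof (rule field_differentiable_bound[where S = "complex_of_real ` {a..b}"])
    show "convex (complex_of_real ` {a..b})"
      by (rule convex_linear_image) (auto intro: bounded_linear.linear bounded_linear_of_real)
    fix z assume "z \<in> complex_of_real ` {a..b}"
    then obtain x where x: "z = of_real x" "a \<le> x" "x \<le> b" by auto
    have "z \<notin> \<real>\<^sub>\<le>\<^sub>0" using x assms by auto
    then show "(f has_field_derivative (1-s) * (z powr (-s) - of_real a powr (-s))) (at z within complex_of_real ` {a..b})"
      unfolding f_def by (auto intro!: derivative_eq_intros simp: algebra_simps)
    have "norm (of_real x powr (-s) - of_real a powr (-s)) \<le> norm s * a powr (-Re s - 1) * (x - a)"
      using x assms by (intro norm_powr_real_diff_le) auto
    also have "\<dots> \<le> norm s * a powr (-Re s - 1) * (b - a)"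
      using x by (intro mult_left_mono) auto
    finally show "norm ((1-s) * (z powr (-s) - of_real a powr (-s))) \<le> norm (1 - s) * (norm s * a powr (- Re s - 1) * (b - a))"
      unfolding x norm_mult by (intro mult_left_mono) auto
  qed (use assms in auto)
  also have "norm (complex_of_real b - of_real a) = b - a"
    using assms by (simp flip: of_real_diff)
  finally show ?thesis by (simp add: f_def algebra_simps)
qed

section \<open>Sums of n^(-1-d) with explicit dependence on d\<close>

lemma powr_Suc_telescope_ge:
  fixes d :: real assumes "d > 0"
  shows "d * real (Suc (Suc n)) powr (-1 - d) \<le> real (Suc n) powr (-d) - real (Suc (Suc n)) powr (-d)"
proof -
  have "\<exists>z. z > real (Suc n) \<and> z < real (Suc (Suc n)) \<and>
     real (Suc (Suc n)) powr (-d) - real (Suc n) powr (-d) =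
       (real (Suc (Suc n)) - real (Suc n)) * (-d * z powr (-d-1))"
    by (rule MVT2) (auto intro!: derivative_eq_intros)
  then obtain z where z: "z > real (Suc n)" "z < real (Suc (Suc n))"
     "real (Suc (Suc n)) powr (-d) - real (Suc n) powr (-d) = - (d * z powr (-d-1))" by auto
  have "real (Suc (Suc n)) powr (-1 - d) \<le> z powr (-1 - d)"
    using z assms by (intro powr_mono2') auto
  then show ?thesis using z(3) assms mult_left_mono[of _ _ d] by (smt (verit, best) minus_diff_commute)
qed

text \<open>Comparison with the telescoping differences of n^(-d) / d. The explicit 1/d matters: it
  becomes the factor 1 / (Re s - 1/2) in the bound for the reciprocal of zeta.\<close>

lemma powr_Suc_sums_bound:
  fixes d :: real assumes "d > 0"
  shows "summable (\<lambda>n. real (Suc n) powr (-1 - d))" "(\<Sum>n. real (Suc n) powr (-1 - d)) \<le> 1 + 1 / d"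
proof -
  have "(\<lambda>n. real (Suc n) powr (-d)) \<longlonglongrightarrow> 0"
    using assms tendsto_neg_powr[OF _ filterlim_compose[OF filterlim_real_sequentially filterlim_Suc], of "-d"] by simp
  from telescope_sums'[OF this]
  have s: "(\<lambda>n. (real (Suc n) powr (-d) - real (Suc (Suc n)) powr (-d)) / d) sums (1 / d)"
    by (intro sums_divide) simp
  have le: "real (Suc (Suc n)) powr (-1 - d) \<le> (real (Suc n) powr (-d) - real (Suc (Suc n)) powr (-d)) / d" for n
    using powr_Suc_telescope_ge[OF assms, of n] assms by (simp add: field_simps)
  have s2: "summable (\<lambda>n. real (Suc (Suc n)) powr (-1 - d))"
    by (rule summable_comparison_test'[OF sums_summable[OF s], of 0]) (use le in auto)
  then show s1: "summable (\<lambda>n. real (Suc n) powr (-1 - d))"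
    by (subst (asm) summable_Suc_iff)
  have "(\<Sum>n. real (Suc (Suc n)) powr (-1 - d)) \<le> 1 / d"
    using suminf_le[OF le s2 sums_summable[OF s]] s by (simp add: sums_iff)
  then show "(\<Sum>n. real (Suc n) powr (-1 - d)) \<le> 1 + 1 / d"
    using suminf_split_head[OF s1] by simp
qed

text \<open>\<open>zeta_reg s\<close> is \<open>(s - 1) * zeta s\<close> for \<open>Re s > 0\<close>, written as a series that also converges
  to the left of the line \<open>Re s = 1\<close>.\<close>

definition zeta_reg_term :: "nat \<Rightarrow> complex \<Rightarrow> complex" where
  "zeta_reg_term n s = of_nat (Suc (Suc n)) powr (1-s) - of_nat (Suc n) powr (1-s)
     - (1 - s) * of_nat (Suc n) powr (-s)"

definition zeta_reg :: "complex \<Rightarrow> complex" where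
  "zeta_reg s = 1 + (\<Sum>n. zeta_reg_term n s)"

lemma norm_zeta_reg_term_le:
  assumes "Re s \<ge> -1"
  shows "norm (zeta_reg_term n s) \<le> norm (1 - s) * norm s * real (Suc n) powr (-1 - Re s)"
  using norm_powr_real_second_diff_le[of "real (Suc n)" "real (Suc (Suc n))" s] assms
  unfolding of_real_of_nat_eq zeta_reg_term_def by (simp add: minus_diff_commute)

lemma summable_zeta_reg_term:
  assumes "Re s > 0" shows "summable (\<lambda>n. zeta_reg_term n s)"
proof (rule summable_norm_cancel, rule summable_comparison_test')
  show "summable (\<lambda>n. norm (1 - s) * norm s * real (Suc n) powr (-1 - Re s))"
    using powr_Suc_sums_bound[OF assms] by (intro summable_mult)
qed (use norm_zeta_reg_term_le[of s] assms in auto)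

text \<open>Cauchy's estimate will turn this quadratic growth into a polynomial bound for the second
  derivative near a zero.\<close>

lemma norm_zeta_reg_le:
  assumes "Re s > 0" shows "norm (zeta_reg s) \<le> 1 + norm (1 - s) * norm s * (1 + 1 / Re s)"
proof -
  have sm: "summable (\<lambda>n. norm (1 - s) * norm s * real (Suc n) powr (-1 - Re s))"
    using powr_Suc_sums_bound[OF assms] by (intro summable_mult)
  have "norm (\<Sum>n. zeta_reg_term n s) \<le> (\<Sum>n. norm (1 - s) * norm s * real (Suc n) powr (-1 - Re s))"
    using norm_zeta_reg_term_le[of s] assms by (intro norm_suminf_le sm) auto
  also have "\<dots> = norm (1 - s) * norm s * (\<Sum>n. real (Suc n) powr (-1 - Re s))"
    using powr_Suc_sums_bound[OF assms] by (intro suminf_mult)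
  also have "\<dots> \<le> norm (1 - s) * norm s * (1 + 1 / Re s)"
    using powr_Suc_sums_bound[OF assms] by (intro mult_left_mono) auto
  finally show ?thesis unfolding zeta_reg_def
    by (smt (verit, best) norm_triangle_ineq norm_one)
qed

lemma zeta_reg_holomorphic: "zeta_reg holomorphic_on {s. Re s > 0}"
  unfolding zeta_reg_def
proof (intro holomorphic_intros holomorphic_on_suminf)
  show op: "open {s. Re s > 0}" by (rule open_halfspace_Re_gt)
  show "zeta_reg_term n holomorphic_on {s. Re s > 0}" for n
    unfolding zeta_reg_term_def by (intro holomorphic_intros)
  fix z :: complex assume "z \<in> {s. Re s > 0}"
  define d where "d = Re z / 2"
  define R where "R = norm z + d"
  have d: "d > 0" using \<open>z \<in> _\<close> by (auto simp: d_def)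
  have "norm (zeta_reg_term n y) \<le> (1 + R) * R * real (Suc n) powr (-1 - d)" if "y \<in> ball z d" for n y
  proof -
    have nd: "norm (y - z) < d" using that by (simp add: dist_norm norm_minus_commute)
    have re: "Re y \<ge> d" using nd abs_Re_le_cmod[of "y - z"] by (auto simp: d_def)
    have ny: "norm y \<le> R" using nd norm_triangle_ineq[of z "y - z"] by (simp add: R_def)
    have n1: "norm (1 - y) \<le> 1 + R" using ny norm_triangle_ineq4[of 1 y] by simp
    have "norm (zeta_reg_term n y) \<le> norm (1 - y) * norm y * real (Suc n) powr (-1 - Re y)"
      using re d by (intro norm_zeta_reg_term_le) auto
    also have "\<dots> \<le> (1 + R) * R * real (Suc n) powr (-1 - d)"
      using re ny n1 d by (intro mult_mono powr_mono) (auto simp: R_def intro!: mult_nonneg_nonneg add_nonneg_nonneg)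
    finally show ?thesis .
  qed
  then show "\<exists>d>0. \<exists>h. summable h \<and> (\<forall>n. \<forall>y\<in>ball z d \<inter> {s. Re s > 0}. norm (zeta_reg_term n y) \<le> h n)"
    using d powr_Suc_sums_bound[OF d]
    by (intro exI[of _ d] conjI exI[of _ "\<lambda>n. (1 + R) * R * real (Suc n) powr (-1 - d)"] summable_mult) auto
qed

lemma zeta_reg_1 [simp]: "zeta_reg 1 = 1"
proof -
  have "zeta_reg_term n 1 = 0" for n
    unfolding zeta_reg_term_def by (simp del: of_nat_Suc)
  then show ?thesis by (simp add: zeta_reg_def)
qed

lemma zeta_reg_cnj: assumes "Re s > 0" shows "zeta_reg (cnj s) = cnj (zeta_reg s)"
proof -
  have *: "cnj (of_nat n powr s) = of_nat n powr (cnj s)" if "n > 0" for n s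
    using that by (subst cnj_powr) auto
  have "zeta_reg_term n (cnj s) = cnj (zeta_reg_term n s)" for n
    unfolding zeta_reg_term_def complex_cnj_diff complex_cnj_mult *[OF zero_less_Suc] by simp
  moreover have "(\<lambda>n. cnj (zeta_reg_term n s)) sums cnj (\<Sum>n. zeta_reg_term n s)"
    using summable_zeta_reg_term[OF assms] by (simp add: sums_cnj summable_sums)
  ultimately show ?thesis by (simp add: zeta_reg_def sums_iff)
qed

lemma norm_of_nat_Suc_powr: "norm (of_nat (Suc n) powr s :: complex) = real (Suc n) powr Re s"
  by (subst norm_powr_real_powr) auto

lemma summable_norm_zeta_series:
  fixes s :: complex
  assumes "Re s > 1" shows "summable (\<lambda>n. norm (of_nat (Suc n) powr (-s) :: complex))"
  unfolding norm_of_nat_Suc_powr using powr_Suc_sums_bound[of "Re s - 1"] assms by simp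

text \<open>In this half-plane the two parts of \<open>zeta_reg_term\<close> converge separately.
  The differences of n^(1-s) telescope to -1 and cancel the leading 1 of \<open>zeta_reg\<close>;
  what remains is the Dirichlet series.\<close>

lemma zeta_reg_gt_1:
  assumes "Re s > 1"
  shows "zeta_reg s = (s - 1) * (\<Sum>n. of_nat (Suc n) powr (-s))"
proof -
  have "(\<lambda>n. norm (of_nat (Suc n) powr (1-s) :: complex)) \<longlonglongrightarrow> 0"
    unfolding norm_of_nat_Suc_powr
    using assms tendsto_neg_powr[OF _ filterlim_compose[OF filterlim_real_sequentially filterlim_Suc], of "1 - Re s"] by simp
  from telescope_sums[OF tendsto_norm_zero_cancel[OF this]]
  have 1: "(\<lambda>n. of_nat (Suc (Suc n)) powr (1-s) - of_nat (Suc n) powr (1-s)) sums (-1 :: complex)" by simp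
  have 2: "(\<lambda>n. (s - 1) * of_nat (Suc n) powr (-s)) sums ((s - 1) * (\<Sum>n. of_nat (Suc n) powr (-s)))"
    using summable_norm_cancel[OF summable_norm_zeta_series[OF assms]] by (intro sums_mult summable_sums)
  have "(\<lambda>n. zeta_reg_term n s) sums (-1 + ((s - 1) * (\<Sum>n. of_nat (Suc n) powr (-s))))"
    using sums_add[OF 1 2] unfolding zeta_reg_term_def by (simp add: algebra_simps)
  then show ?thesis by (simp add: zeta_reg_def sums_iff)
qed

subsection \<open>The Dirichlet series of the Moebius function\<close>

lemma moebius_1 [simp]: "moebius (Suc 0) = 1"
  by (simp add: moebius_def)

lemma abs_moebius_le: "\<bar>moebius n\<bar> \<le> 1"
  by (simp add: moebius_def power_abs)

lemma moebius_prime_mult: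
  assumes "prime p" "\<not> p dvd d" "d > 0"
  shows "moebius (p * d) = - moebius d"
proof -
  have cop: "coprime p d" using assms by (simp add: prime_imp_coprime)
  have "squarefree (p * d) \<longleftrightarrow> squarefree d"
    using squarefree_mult_coprime[OF cop squarefree_prime[OF assms(1)]] squarefree_multD(2) by blast
  moreover have "prime_factors (p * d) = insert p (prime_factors d)"
    using assms by (subst prime_factors_product) (auto simp: prime_prime_factors)
  moreover have "p \<notin> prime_factors d" using assms by auto
  ultimately show ?thesis by (simp add: moebius_def)
qed

text \<open>Fix a prime p dividing n. The divisors d not divisible by p pair off with the divisors p
  * d, with opposite values; every remaining divisor is divisible by p^2 and contributes 0.\<close>

lemma sum_moebius_divisors:
  assumes "n > 0" shows "(\<Sum>d | d dvd n. moebius d) = (if n = 1 then 1 else 0)"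
proof (cases "n = 1")
  case False
  then obtain p where p: "prime p" "p dvd n" using prime_factor_nat by blast
  define A where "A = {d. d dvd n \<and> \<not> p dvd d}"
  have fin: "finite {d. d dvd n}" using assms by simp
  have finA: "finite A" using fin by (auto simp: A_def elim: finite_subset[rotated])
  have A0: "d > 0" if "d \<in> A" for d using that assms by (auto simp: A_def intro!: Nat.gr0I)
  have sub: "A \<union> (*) p ` A \<subseteq> {d. d dvd n}"
    using p by (auto simp: A_def intro!: divides_mult prime_imp_coprime)
  have "(\<Sum>d | d dvd n. moebius d) = (\<Sum>d\<in>A \<union> (*) p ` A. moebius d)"
  proof (rule sum.mono_neutral_right[OF fin sub], rule ballI)
    fix e assume e: "e \<in> {d. d dvd n} - (A \<union> (*) p ` A)"
    then have "p dvd e" by (auto simp: A_def)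
    then obtain d where d: "e = p * d" by auto
    have "d dvd n" using e d by (auto dest: dvd_mult_right)
    then have "p dvd d" using e d by (auto simp: A_def)
    then have "p ^ 2 dvd e" using d by (simp add: power2_eq_square)
    then have "\<not> squarefree e" using p(1) squarefreeD[of e p] by auto
    then show "moebius e = 0" by (simp add: moebius_def)
  qed
  also have "\<dots> = (\<Sum>d\<in>A. moebius d) + (\<Sum>d\<in>(*) p ` A. moebius d)"
    by (rule sum.union_disjoint) (use finA in \<open>auto simp: A_def\<close>)
  also have "(\<Sum>d\<in>(*) p ` A. moebius d) = (\<Sum>d\<in>A. moebius (p * d))"
    using p by (subst sum.reindex) (auto simp: inj_on_def prime_gt_0_nat)
  also have "\<dots> = (\<Sum>d\<in>A. - moebius d)"
    using p A0 by (intro sum.cong refl moebius_prime_mult) (auto simp: A_def)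
  finally show ?thesis using False by (simp add: sum_negf)
qed simp

text \<open>Both series converge absolutely, so their product is a sum over pairs (d, m), which is
  regrouped by n = d * m. The inner sum over the divisors of n is 1 for n = 1 and 0
  otherwise.\<close>

lemma moebius_dirichlet_series:
  fixes s :: complex
  assumes s: "Re s > 1"
  shows "(\<Sum>n. of_int (moebius (Suc n)) * of_nat (Suc n) powr (-s)) * (\<Sum>n. of_nat (Suc n) powr (-s)) = 1"
    (is "?D * ?Z = 1")
proof -
  define h where "h = (\<lambda>n. of_nat n powr (-s) :: complex)"
  define f where "f = (\<lambda>(d, m). of_int (moebius d) * h d * h m)"
  define I where "I = {0::nat<..}"
  have bij: "bij_betw Suc UNIV I"
    unfolding I_def by (rule bij_betwI[where g = "\<lambda>n. n - 1"]) auto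
  have sh: "summable (\<lambda>n. norm (h (Suc n)))"
    using summable_norm_zeta_series[OF s] by (simp add: h_def del: of_nat_Suc)
  have smu: "summable (\<lambda>n. norm (of_int (moebius (Suc n)) * h (Suc n)))"
  proof (rule summable_comparison_test'[OF sh, of 0])
    fix n :: nat
    show "norm (norm (of_int (moebius (Suc n)) * h (Suc n))) \<le> norm (h (Suc n))"
      using mult_right_mono[of "real_of_int \<bar>moebius (Suc n)\<bar>" 1 "norm (h (Suc n))"] abs_moebius_le[of "Suc n"]
      by (simp add: norm_mult del: of_int_abs)
  qed
  have Zs: "(h has_sum ?Z) I"
    using norm_summable_imp_has_sum[OF sh summable_sums[OF summable_norm_cancel[OF sh]]]
    by (subst has_sum_reindex_bij_betw[OF bij, symmetric]) (simp add: h_def del: of_nat_Suc)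
  have Ds: "((\<lambda>n. of_int (moebius n) * h n) has_sum ?D) I"
    using norm_summable_imp_has_sum[OF smu summable_sums[OF summable_norm_cancel[OF smu]]]
    by (subst has_sum_reindex_bij_betw[OF bij, symmetric]) (simp add: h_def del: of_nat_Suc)
  have Za: "(\<lambda>n. norm (h n)) summable_on I"
    by (subst summable_on_reindex_bij_betw[OF bij, symmetric])
      (use sh in \<open>auto intro!: summable_nonneg_imp_summable_on\<close>)
  have Da: "(\<lambda>n. norm (of_int (moebius n) * h n)) summable_on I"
    by (subst summable_on_reindex_bij_betw[OF bij, symmetric])
      (use smu in \<open>auto intro!: summable_nonneg_imp_summable_on\<close>)
  have fsum: "f summable_on (I \<times> I)"
  proof (rule abs_summable_summable)
    have norm_norm_id: "norm (norm z) = norm z" for z :: complex by simp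
    have eq: "(\<Sum>\<^sub>\<infinity>y\<in>I. norm (f (x, y))) = norm (of_int (moebius x) * h x) * (\<Sum>\<^sub>\<infinity>y\<in>I. norm (h y))" for x
      by (simp add: f_def norm_mult infsum_cmult_right' mult.assoc)
    have 2: "(\<lambda>x. norm (\<Sum>\<^sub>\<infinity>y\<in>I. norm (f (x, y)))) summable_on I"
      unfolding eq norm_mult[where 'a=real] norm_norm_id by (rule summable_on_cmult_left[OF Da])
    have 1: "(\<lambda>y. norm (f (x, y))) summable_on I" for x
      unfolding f_def prod.case norm_mult[of "_ * _"] by (rule summable_on_cmult_right[OF Za])
    show "(\<lambda>p. norm (f p)) summable_on (I \<times> I)"
      using 1 2 by (intro Infinite_Sum.abs_summable_on_Sigma_iff[THEN iffD2]) auto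
  qed
  have "(f has_sum (?D * ?Z)) (I \<times> I)"
  proof (rule has_sum_SigmaI[OF _ _ fsum])
    show "((\<lambda>y. f (x, y)) has_sum (of_int (moebius x) * h x * ?Z)) I" for x
      unfolding f_def prod.case by (intro has_sum_cmult_right Zs)
    show "((\<lambda>x. of_int (moebius x) * h x * ?Z) has_sum ?D * ?Z) I"
      by (intro has_sum_cmult_left Ds)
  qed
  moreover have "bij_betw (\<lambda>(n, d). (d, n div d)) (SIGMA n:I. {d. d dvd n}) (I \<times> I)"
    by (rule bij_betwI[where g = "\<lambda>(d, m). (d * m, d)"]) (auto simp: I_def dvd_pos_nat dvd_imp_le elim!: dvdE)
  ultimately have "((\<lambda>(n, d). f (d, n div d)) has_sum (?D * ?Z)) (SIGMA n:I. {d. d dvd n})"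
    by (subst (asm) has_sum_reindex_bij_betw[symmetric]) (auto simp: case_prod_unfold)
  then have "((\<lambda>n. if n = 1 then 1 else 0) has_sum (?D * ?Z)) I"
  proof (rule has_sum_SigmaD)
    fix n assume n: "n \<in> I"
    have "(\<Sum>d | d dvd n. f (d, n div d)) = (\<Sum>d | d dvd n. of_int (moebius d) * h n)"
    proof (rule sum.cong[OF refl])
      fix d assume "d \<in> {d. d dvd n}"
      then obtain m where m: "n = d * m" by auto
      with n have "d > 0" "m > 0" by (auto simp: I_def)
      then have "h n = h d * h m"
        using powr_times_real[of "complex_of_nat d" "of_nat m" "-s"] by (simp add: h_def m)
      then show "f (d, n div d) = of_int (moebius d) * h n" using m \<open>d > 0\<close> by (simp add: f_def)
    qed
    also have "\<dots> = of_int (\<Sum>d | d dvd n. moebius d) * h n" by (simp add: sum_distrib_right)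
    also have "\<dots> = (if n = 1 then 1 else 0)"
      using n by (subst sum_moebius_divisors) (auto simp: I_def h_def)
    finally have "(\<Sum>d | d dvd n. f (d, n div d)) = (if n = 1 then 1 else 0)" .
    then show "((\<lambda>y. case (n, y) of (n, d) \<Rightarrow> f (d, n div d)) has_sum (if n = 1 then 1 else 0)) {d. d dvd n}"
      using n by (intro has_sum_finiteI) (auto simp: I_def)
  qed
  moreover have "((\<lambda>n. if n = 1 then 1 else 0 :: complex) has_sum 1) I"
  proof -
    have "((\<lambda>n. if n = 1 then 1 else 0 :: complex) has_sum 1) {1::nat}"
      by (intro has_sum_finiteI) auto
    then show ?thesis
      by (rule has_sum_cong_neutral[THEN iffD1, rotated -1]) (auto simp: I_def)
  qed
  ultimately show ?thesis using has_sum_unique by blast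
qed

subsection \<open>Consequences of the weak Mertens hypothesis\<close>

definition mertens_nat :: "nat \<Rightarrow> real" where
  "mertens_nat N = (\<Sum>n<N. real_of_int (moebius (Suc n)))"

lemma mertens_nat_0 [simp]: "mertens_nat 0 = 0"
  by (simp add: mertens_nat_def)

lemma mertens_nat_Suc: "mertens_nat (Suc N) = mertens_nat N + moebius (Suc N)"
  by (simp add: mertens_nat_def)

lemma mertens_eq_mertens_nat:
  assumes "real N \<le> x" "x < real (Suc N)"
  shows "mertens x = mertens_nat N"
proof -
  have "{n. 1 \<le> n \<and> real n \<le> x} = Suc ` {..<N}"
  proof (intro equalityI subsetI)
    fix n assume n: "n \<in> {n. 1 \<le> n \<and> real n \<le> x}"
    then have "real n < real (Suc N)" using assms by auto
    then have "n \<le> N" by simp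
    then show "n \<in> Suc ` {..<N}" using n by (intro image_eqI[of _ _ "n - 1"]) auto
  qed (use assms in auto)
  then show ?thesis
    by (simp add: mertens_def mertens_nat_def sum.reindex)
qed

section \<open>The hypothesis as a bound for sums over integers\<close>

lemma abs_mertens_nat_diff: "\<bar>mertens_nat (n + k) - mertens_nat n\<bar> \<le> real k"
proof (induction k)
  case (Suc k)
  have "\<bar>real_of_int (moebius (Suc (n + k)))\<bar> \<le> 1"
    using abs_moebius_le[of "Suc (n + k)"] by linarith
  then show ?case using Suc by (simp add: mertens_nat_Suc)
qed simp

lemma has_integral_mertens_sq:
  "((\<lambda>x. (mertens x / x)\<^sup>2) has_integral
     (\<Sum>n<N. (mertens_nat (Suc n))\<^sup>2 / (real (Suc n) * real (Suc (Suc n))))) {1..real (Suc N)}"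
proof (induction N)
  case 0
  show ?case using has_integral_refl(1)[of "\<lambda>x. (mertens x / x)\<^sup>2" "1::real"] by simp
next
  case (Suc N)
  let ?c = "mertens_nat (Suc N)"
  have "((\<lambda>x. ?c\<^sup>2 * (1 / x\<^sup>2)) has_integral ?c\<^sup>2 * (-1 / real (Suc (Suc N)) - (-1 / real (Suc N)))) {real (Suc N)..real (Suc (Suc N))}"
    by (intro has_integral_mult_right fundamental_theorem_of_calculus)
      (auto intro!: derivative_eq_intros simp flip: has_real_derivative_iff_has_vector_derivative simp: power2_eq_square)
  \<comment> \<open>The right endpoint is left out because \<open>mertens\<close> already takes its
    next value there.\<close>
  then have "((\<lambda>x. (mertens x / x)\<^sup>2) has_integral ?c\<^sup>2 * (-1 / real (Suc (Suc N)) - (-1 / real (Suc N)))) {real (Suc N)..real (Suc (Suc N))}"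
    by (rule has_integral_spike_finite[of "{real (Suc (Suc N))}", rotated 2])
      (auto simp: mertens_eq_mertens_nat[of "Suc N"] power_divide)
  moreover have "-1 / real (Suc (Suc N)) - (-1 / real (Suc N)) = 1 / (real (Suc N) * real (Suc (Suc N)))"
    by (simp add: field_simps)
  ultimately have "((\<lambda>x. (mertens x / x)\<^sup>2) has_integral ?c\<^sup>2 / (real (Suc N) * real (Suc (Suc N)))) {real (Suc N)..real (Suc (Suc N))}"
    by simp
  from has_integral_combine[OF _ _ Suc this] show ?case by simp
qed

text \<open>The hypothesis speaks only of large X, and ln X vanishes at X = 1. Harmonic numbers are
  at least 1 from N = 1 on, so a larger constant covers the finitely many small N; as partial sums
  of 1/n they also suit a termwise comparison with weights. The factor 2 comes from n (n + 1) \<le>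
  2 n^2.\<close>

lemma weak_mertens_harm_bound:
  assumes weak_mertens_hypothesis
  obtains A where "A > 0" "\<And>N. (\<Sum>n<N. (mertens_nat (Suc n) / real (Suc n))\<^sup>2) \<le> A * harm N"
proof -
  define S where "S = (\<lambda>N. \<Sum>n<N. (mertens_nat (Suc n) / real (Suc n))\<^sup>2)"
  have S_mono: "S m \<le> S n" if "m \<le> n" for m n
    unfolding S_def using that by (intro sum_mono2) auto
  obtain c where c: "c > 0" "eventually (\<lambda>X. norm (integral {1..X} (\<lambda>x. (mertens x / x)\<^sup>2)) \<le> c * norm (ln X)) at_top"
    using assms unfolding weak_mertens_hypothesis_def by (elim landau_o.bigE)
  then obtain X0 where X0: "\<And>X. X \<ge> X0 \<Longrightarrow> norm (integral {1..X} (\<lambda>x. (mertens x / x)\<^sup>2)) \<le> c * norm (ln X)"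
    by (auto simp: eventually_at_top_linorder)
  define N0 where "N0 = nat \<lceil>X0\<rceil>"
  have big: "S N \<le> 2 * c * harm N" if "N \<ge> N0" for N
  proof -
    have "S N \<le> 2 * (\<Sum>n<N. (mertens_nat (Suc n))\<^sup>2 / (real (Suc n) * real (Suc (Suc n))))"
      unfolding S_def sum_distrib_left
    proof (rule sum_mono)
      fix n
      have "(mertens_nat (Suc n))\<^sup>2 * (1 / (real (Suc n))\<^sup>2) \<le> (mertens_nat (Suc n))\<^sup>2 * (2 / (real (Suc n) * real (Suc (Suc n))))"
      proof (rule mult_left_mono)
        define x where "x = real (Suc n)"
        have x: "x \<ge> 1" by (simp add: x_def)
        then have "x * (x + 1) \<le> 2 * x\<^sup>2" using mult_right_mono[of 1 x x] by (simp add: power2_eq_square algebra_simps)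
        then have "1 / x\<^sup>2 \<le> 2 / (x * (x + 1))" using x by (simp add: divide_simps)
        then show "1 / (real (Suc n))\<^sup>2 \<le> 2 / (real (Suc n) * real (Suc (Suc n)))" by (simp add: x_def add_ac)
      qed simp
      then show "(mertens_nat (Suc n) / real (Suc n))\<^sup>2 \<le> 2 * ((mertens_nat (Suc n))\<^sup>2 / (real (Suc n) * real (Suc (Suc n))))"
        by (simp add: power_divide mult.commute)
    qed
    also have "\<dots> = 2 * integral {1..real (Suc N)} (\<lambda>x. (mertens x / x)\<^sup>2)"
      using has_integral_mertens_sq[of N] by (simp add: integral_unique)
    also have "\<dots> \<le> 2 * (c * norm (ln (real (Suc N))))"
      using X0[of "real (Suc N)"] that unfolding N0_def by simp
    also have "norm (ln (real (Suc N))) \<le> harm N"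
      using ln_le_harm[of N] by (simp add: add.commute)
    finally show ?thesis using c by simp
  qed
  have "S N \<le> (2 * c + S N0) * harm N" for N
  proof (cases "N \<ge> N0")
    case True
    have "0 \<le> S N0" by (auto simp: S_def intro!: sum_nonneg)
    then have "0 \<le> S N0 * harm N" by (simp add: harm_nonneg)
    then show ?thesis using big[OF True] by (simp add: distrib_right)
  next
    case False
    show ?thesis
    proof (cases "N = 0")
      case False
      have "S N \<le> S N0 * 1" using \<open>\<not> N \<ge> N0\<close> by (simp add: S_mono)
      also have "\<dots> \<le> (2 * c + S N0) * harm N"
        using harm_mono[of 1 N, where 'a=real] False c
        by (intro mult_mono) (auto simp: harm_expand S_def intro!: sum_nonneg add_nonneg_nonneg)
      finally show ?thesis .
    qed (simp add: S_def harm_def)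
  qed
  moreover have "2 * c + S N0 > 0" using c by (auto simp: S_def intro!: add_pos_nonneg sum_nonneg)
  ultimately show ?thesis using that unfolding S_def by blast
qed

text \<open>Summation by parts: with E N the nonnegative excess of the partial sums, E N * w N never
  exceeds the weighted excess, because w does not increase.\<close>

lemma sum_mult_mono_antimono:
  fixes c d w :: "nat \<Rightarrow> real"
  assumes "\<And>N. (\<Sum>n<N. c n) \<le> (\<Sum>n<N. d n)" "\<And>n. w n \<ge> 0" "\<And>n. w (Suc n) \<le> w n"
  shows "(\<Sum>n<N. c n * w n) \<le> (\<Sum>n<N. d n * w n)"
proof -
  define E where "E = (\<lambda>N. (\<Sum>n<N. d n - c n))"
  have E0: "E N \<ge> 0" for N using assms(1)[of N] by (simp add: E_def sum_subtractf)
  have "E N * w N \<le> (\<Sum>n<N. (d n - c n) * w n)"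
  proof (induction N)
    case (Suc N)
    have "E (Suc N) * w (Suc N) \<le> E (Suc N) * w N" by (intro mult_left_mono assms E0)
    also have "\<dots> = E N * w N + (d N - c N) * w N" by (simp add: E_def algebra_simps)
    finally show ?case using Suc by simp
  qed (simp add: E_def)
  moreover have "E N * w N \<ge> 0" using E0 assms(2) by simp
  ultimately show ?thesis by (simp add: algebra_simps sum_subtractf)
qed

text \<open>The series arises from \<open>\<Sum> \<mu>(n) n\<^sup>-\<^sup>s\<close> by summation by parts.\<close>

definition mertens_series_term :: "nat \<Rightarrow> complex \<Rightarrow> complex" where
  "mertens_series_term n s = of_real (mertens_nat (Suc n)) * (of_nat (Suc n) powr (-s) - of_nat (Suc (Suc n)) powr (-s))"

definition mertens_series :: "complex \<Rightarrow> complex" where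
  "mertens_series s = (\<Sum>n. mertens_series_term n s)"

lemma norm_mertens_series_term_le:
  assumes "Re s \<ge> -1"
  shows "norm (mertens_series_term n s) \<le> norm s * (\<bar>mertens_nat (Suc n)\<bar> * real (Suc n) powr (-Re s - 1))"
proof -
  have "norm (of_nat (Suc n) powr (-s) - of_nat (Suc (Suc n)) powr (-s)) \<le> norm s * real (Suc n) powr (-Re s - 1)"
    using norm_powr_real_diff_le[of "real (Suc n)" "real (Suc (Suc n))" s] assms
    unfolding of_real_of_nat_eq by (simp add: norm_minus_commute)
  then have "\<bar>mertens_nat (Suc n)\<bar> * norm (of_nat (Suc n) powr (-s) - of_nat (Suc (Suc n)) powr (-s)) \<le>
      \<bar>mertens_nat (Suc n)\<bar> * (norm s * real (Suc n) powr (-Re s - 1))"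
    by (rule mult_left_mono) auto
  then show ?thesis unfolding mertens_series_term_def norm_mult norm_of_real by (simp only: mult_ac)
qed

lemma moebius_sum_by_parts:
  "(\<Sum>n<N. of_int (moebius (Suc n)) * of_nat (Suc n) powr (-s)) =
   (\<Sum>n<N. mertens_series_term n s) + of_real (mertens_nat N) * of_nat (Suc N) powr (-s)"
  by (induction N) (simp_all add: mertens_series_term_def mertens_nat_Suc algebra_simps del: of_nat_Suc)

section \<open>Convergence of the Moebius series to the right of the critical line\<close>

locale mertens_bound =
  fixes A :: real
  assumes A_pos: "A > 0"
    and sum_mertens_sq_le: "\<And>N. (\<Sum>n<N. (mertens_nat (Suc n) / real (Suc n))\<^sup>2) \<le> A * harm N"
begin

text \<open>This constant arises from u * v \<le> (u^2 + v^2) / 2, where the squares of u contribute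
  A and those of v contribute 1.\<close>

definition K :: real where "K = (A + 1) / 2"

lemma K_pos: "K > 0" using A_pos by (simp add: K_def)

text \<open>The hypothesis controls squares of M(n)/n, while the series involves first powers. Each
  summand is split as u * v with u = |M(n)|/n * n^(-d/2) and v = n^(-1/2-d/2). The sum of u^2 is
  compared with A times the sum of n^(-1-d) by the decreasing weights n^(-d); the sum of v^2 is the
  sum of n^(-1-d) itself.\<close>

lemma mertens_abs_sums_bound:
  fixes d :: real assumes d: "d > 0"
  shows "summable (\<lambda>n. \<bar>mertens_nat (Suc n)\<bar> * real (Suc n) powr (-(1/2 + d) - 1))"
    "(\<Sum>n. \<bar>mertens_nat (Suc n)\<bar> * real (Suc n) powr (-(1/2 + d) - 1)) \<le> K * (1 + 1 / d)"
proof -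
  let ?f = "\<lambda>n. \<bar>mertens_nat (Suc n)\<bar> * real (Suc n) powr (-(1/2 + d) - 1)"
  have le: "?f n \<le> ((mertens_nat (Suc n) / real (Suc n))\<^sup>2 * real (Suc n) powr (-d) + real (Suc n) powr (-1 - d)) / 2" for n
  proof -
    let ?x = "real (Suc n)"
    define u where "u = \<bar>mertens_nat (Suc n)\<bar> / ?x * ?x powr (-d/2)"
    define v where "v = ?x powr (-1/2 - d/2)"
    have "u * v = \<bar>mertens_nat (Suc n)\<bar> * (?x powr (-1) * ?x powr (-d/2) * ?x powr (-1/2 - d/2))"
      by (simp add: u_def v_def powr_minus field_simps)
    also have "?x powr (-1) * ?x powr (-d/2) * ?x powr (-1/2 - d/2) = ?x powr (-(1/2 + d) - 1)"
    proof -
      have "(-1::real) + -d/2 + (-1/2 - d/2) = -(1/2 + d) - 1" by (simp add: field_simps)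
      then show ?thesis unfolding powr_add[symmetric] by (simp only:)
    qed
    finally have "u * v = ?f n" .
    moreover have "u\<^sup>2 = (mertens_nat (Suc n) / ?x)\<^sup>2 * ?x powr (-d)"
      unfolding u_def power_mult_distrib power_divide power2_abs
      by (simp add: power2_eq_square flip: powr_add)
    moreover have "v\<^sup>2 = ?x powr (-1 - d)"
    proof -
      have "-1/2 - d/2 + (-1/2 - d/2) = -1 - d" by simp
      then show ?thesis unfolding v_def power2_eq_square powr_add[symmetric] by (simp only:)
    qed
    moreover have "u * v \<le> (u\<^sup>2 + v\<^sup>2) / 2" using sum_squares_bound[of u v] by simp
    ultimately show ?thesis by simp
  qed
  have part: "(\<Sum>n<N. ?f n) \<le> K * (1 + 1 / d)" for N
  proof -
    have "(\<Sum>n<N. (mertens_nat (Suc n) / real (Suc n))\<^sup>2 * real (Suc n) powr (-d)) \<le> (\<Sum>n<N. A * inverse (real (Suc n)) * real (Suc n) powr (-d))"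
    proof (rule sum_mult_mono_antimono)
      show "(\<Sum>n<N. (mertens_nat (Suc n) / real (Suc n))\<^sup>2) \<le> (\<Sum>n<N. A * inverse (real (Suc n)))" for N
        using sum_mertens_sq_le[of N] by (simp add: harm_altdef sum_distrib_left)
    qed (use d in \<open>auto intro!: powr_mono2'\<close>)
    also have "\<dots> = A * (\<Sum>n<N. real (Suc n) powr (-1 - d))"
      unfolding sum_distrib_left by (intro sum.cong) (auto simp: powr_diff powr_minus field_simps)
    finally have "(\<Sum>n<N. ?f n) \<le> K * (\<Sum>n<N. real (Suc n) powr (-1 - d))"
      using sum_mono[of "{..<N}" ?f, OF le] by (simp add: K_def sum.distrib flip: sum_divide_distrib) (simp add: algebra_simps)
    also have "(\<Sum>n<N. real (Suc n) powr (-1 - d)) \<le> (\<Sum>n. real (Suc n) powr (-1 - d))"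
      by (intro sum_le_suminf powr_Suc_sums_bound d) auto
    also have "\<dots> \<le> 1 + 1 / d" by (intro powr_Suc_sums_bound d)
    finally show ?thesis using K_pos by simp
  qed
  show s: "summable ?f"
    by (rule bounded_imp_summable[where B = "K * (1 + 1/d)"]) (use part[of "Suc _"] in \<open>auto simp: lessThan_Suc_atMost\<close>)
  show "suminf ?f \<le> K * (1 + 1 / d)"
    using suminf_le_const[OF s part] .
qed

lemma summable_mertens_series:
  assumes "Re s > 1/2" shows "summable (\<lambda>n. mertens_series_term n s)"
proof (rule summable_norm_cancel, rule summable_comparison_test')
  show "summable (\<lambda>n. norm s * (\<bar>mertens_nat (Suc n)\<bar> * real (Suc n) powr (-Re s - 1)))"
    using mertens_abs_sums_bound(1)[of "Re s - 1/2"] assms by (intro summable_mult) simp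
qed (use norm_mertens_series_term_le[of s] assms in auto)

lemma norm_mertens_series_le:
  assumes "Re s > 1/2" shows "norm (mertens_series s) \<le> K * norm s * (1 + 1 / (Re s - 1/2))"
proof -
  have sm0: "summable (\<lambda>n. \<bar>mertens_nat (Suc n)\<bar> * real (Suc n) powr (-Re s - 1))"
    using mertens_abs_sums_bound(1)[of "Re s - 1/2"] assms by simp
  have "norm (mertens_series s) \<le> (\<Sum>n. norm s * (\<bar>mertens_nat (Suc n)\<bar> * real (Suc n) powr (-Re s - 1)))"
    unfolding mertens_series_def
    using norm_mertens_series_term_le[of s] assms by (intro norm_suminf_le summable_mult sm0) auto
  also have "\<dots> = norm s * (\<Sum>n. \<bar>mertens_nat (Suc n)\<bar> * real (Suc n) powr (-Re s - 1))"
    by (intro suminf_mult sm0)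
  also have "\<dots> \<le> norm s * (K * (1 + 1 / (Re s - 1/2)))"
    using mertens_abs_sums_bound(2)[of "Re s - 1/2"] assms by (intro mult_left_mono) auto
  finally show ?thesis by (simp add: mult_ac)
qed

lemma mertens_series_holomorphic: "mertens_series holomorphic_on {s. Re s > 1/2}"
  unfolding mertens_series_def
proof (intro holomorphic_intros holomorphic_on_suminf)
  show op: "open {s. Re s > 1/2}" by (rule open_halfspace_Re_gt)
  show "mertens_series_term n holomorphic_on {s. Re s > 1/2}" for n
    unfolding mertens_series_term_def by (intro holomorphic_intros)
  fix z :: complex assume "z \<in> {s. Re s > 1/2}"
  define d where "d = (Re z - 1/2) / 2"
  define R where "R = norm z + d"
  have d: "d > 0" using \<open>z \<in> _\<close> by (auto simp: d_def)
  have "norm (mertens_series_term n y) \<le> R * (\<bar>mertens_nat (Suc n)\<bar> * real (Suc n) powr (-(1/2 + d) - 1))" if "y \<in> ball z d" for n y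
  proof -
    have nd: "norm (y - z) < d" using that by (simp add: dist_norm norm_minus_commute)
    have re: "Re y \<ge> 1/2 + d" using nd abs_Re_le_cmod[of "y - z"] unfolding d_def by (simp add: field_simps)
    have ny: "norm y \<le> R" using nd norm_triangle_ineq[of z "y - z"] by (simp add: R_def)
    have "norm (mertens_series_term n y) \<le> norm y * (\<bar>mertens_nat (Suc n)\<bar> * real (Suc n) powr (-Re y - 1))"
      using re d by (intro norm_mertens_series_term_le) auto
    also have "\<dots> \<le> R * (\<bar>mertens_nat (Suc n)\<bar> * real (Suc n) powr (-(1/2 + d) - 1))"
      using re ny d by (intro mult_mono powr_mono) (auto simp: R_def)
    finally show ?thesis .
  qed
  then show "\<exists>d>0. \<exists>h. summable h \<and> (\<forall>n. \<forall>y\<in>ball z d \<inter> {s. Re s > 1/2}. norm (mertens_series_term n y) \<le> h n)"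
    using d mertens_abs_sums_bound(1)[OF d]
    by (intro exI[of _ d] conjI exI[of _ "\<lambda>n. R * (\<bar>mertens_nat (Suc n)\<bar> * real (Suc n) powr (-(1/2 + d) - 1))"] summable_mult) auto
qed

text \<open>M changes by at most 1 per step. So if |M(N)| = m, then |M| is at least m/2 at the last
  k \<ge> m/2 integers up to N, and the sum of squares is at least (m/2) (m/(2N))^2. Hence (m/N)^3
  is at most 8 A \<open>harm N\<close> / N, which tends to 0.\<close>

lemma mertens_nat_over_tendsto_0: "(\<lambda>N. mertens_nat N / real N) \<longlonglongrightarrow> 0"
proof -
  have bound: "(\<bar>mertens_nat N\<bar> / real N) ^ 3 \<le> 8 * A * (harm N / real N)" if N: "N > 0" for N
  proof -
    define m where "m = \<bar>mertens_nat N\<bar>"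
    define k where "k = nat \<lceil>m / 2\<rceil>"
    have m0: "m \<ge> 0" by (simp add: m_def)
    have mN: "m \<le> real N" using abs_mertens_nat_diff[of 0 N] by (simp add: m_def)
    have k: "real k \<ge> m / 2" "real k < m / 2 + 1" using m0 unfolding k_def by linarith+
    have "k \<le> N" using mN N unfolding k_def by linarith
    have "(m/2) * ((m / 2) / real N)\<^sup>2 \<le> real k * ((m / 2) / real N)\<^sup>2"
      using k by (intro mult_right_mono) auto
    also have "\<dots> = (\<Sum>n\<in>{N-k..<N}. ((m / 2) / real N)\<^sup>2)"
      using \<open>k \<le> N\<close> by simp
    also have "\<dots> \<le> (\<Sum>n\<in>{N-k..<N}. (mertens_nat (Suc n) / real (Suc n))\<^sup>2)"
    proof (rule sum_mono)
      fix n assume n: "n \<in> {N-k..<N}"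
      define j where "j = N - Suc n"
      have j: "N = Suc n + j" using n by (auto simp: j_def)
      have "real j < m / 2" using n k(2) \<open>k \<le> N\<close> unfolding j_def by (auto simp: of_nat_diff)
      then have "\<bar>mertens_nat (Suc n)\<bar> \<ge> m / 2"
        using abs_mertens_nat_diff[of "Suc n" j] j unfolding m_def by auto
      then have "(m / 2) / real N \<le> \<bar>mertens_nat (Suc n)\<bar> / real (Suc n)"
        using j m0 by (intro frac_le) auto
      then have "((m / 2) / real N)\<^sup>2 \<le> (\<bar>mertens_nat (Suc n)\<bar> / real (Suc n))\<^sup>2"
        using m0 by (intro power_mono) auto
      then show "((m / 2) / real N)\<^sup>2 \<le> (mertens_nat (Suc n) / real (Suc n))\<^sup>2"
        by (simp add: power_divide)
    qed
    also have "\<dots> \<le> (\<Sum>n<N. (mertens_nat (Suc n) / real (Suc n))\<^sup>2)"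
      by (intro sum_mono2) auto
    also have "\<dots> \<le> A * harm N" by (rule sum_mertens_sq_le)
    finally have "(m/2) * ((m / 2) / real N)\<^sup>2 * 8 / real N \<le> A * harm N * 8 / real N"
      by (intro divide_right_mono mult_right_mono) auto
    then show ?thesis unfolding m_def[symmetric]
      by (simp add: power2_eq_square power3_eq_cube field_simps)
  qed
  have "(\<lambda>N. (harm N - ln (real N)) * (1 / real N) + ln (real N) / real N) \<longlonglongrightarrow> euler_mascheroni * 0 + 0"
    by (intro tendsto_intros lim_1_over_n lim_ln_over_n euler_mascheroni_LIMSEQ)
  then have h0: "(\<lambda>N. harm N / real N :: real) \<longlonglongrightarrow> 0"
    by (simp add: diff_divide_distrib)
  have "(\<lambda>N. (\<bar>mertens_nat N\<bar> / real N) ^ 3) \<longlonglongrightarrow> 0"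
  proof (rule tendsto_sandwich[where f = "\<lambda>_. 0" and h = "\<lambda>N. 8 * A * (harm N / real N)"])
    show "(\<lambda>N. 8 * A * (harm N / real N)) \<longlonglongrightarrow> 0" using tendsto_mult_right_zero[OF h0, of "8 * A"] by simp
    show "\<forall>\<^sub>F N in sequentially. (\<bar>mertens_nat N\<bar> / real N) ^ 3 \<le> 8 * A * (harm N / real N)"
      using eventually_gt_at_top[of 0] by eventually_elim (rule bound)
  qed auto
  from tendsto_real_root[OF this, of 3]
  have "(\<lambda>N. \<bar>mertens_nat N\<bar> / real N) \<longlonglongrightarrow> 0"
    by (simp add: real_root_power_cancel)
  then have "(\<lambda>N. \<bar>mertens_nat N / real N\<bar>) \<longlonglongrightarrow> 0" by (simp only: abs_divide abs_of_nat)
  then show ?thesis by (rule tendsto_rabs_zero_cancel)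
qed

text \<open>Summation by parts leaves the boundary term M(N) (N+1)^(-s), which vanishes in the limit
  because M(N)/N tends to 0. The line Re s = 1 is included for the sake of s = 1, where the series
  is the sum of mu(n)/n.\<close>

lemma moebius_sums_mertens_series:
  assumes "Re s \<ge> 1"
  shows "(\<lambda>n. of_int (moebius (Suc n)) * of_nat (Suc n) powr (-s)) sums mertens_series s"
proof -
  have "(\<lambda>N. of_real (mertens_nat N) * of_nat (Suc N) powr (-s)) \<longlonglongrightarrow> (0 :: complex)"
  proof (rule tendsto_norm_zero_cancel, rule tendsto_sandwich[where f = "\<lambda>_. 0" and h = "\<lambda>N. \<bar>mertens_nat N\<bar> / real N"])
    show "(\<lambda>N. \<bar>mertens_nat N\<bar> / real N) \<longlonglongrightarrow> 0"
      using tendsto_rabs_zero[OF mertens_nat_over_tendsto_0] by (simp only: abs_divide abs_of_nat)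
    show "\<forall>\<^sub>F N in sequentially. norm (of_real (mertens_nat N) * of_nat (Suc N) powr (-s) :: complex) \<le> \<bar>mertens_nat N\<bar> / real N"
      using eventually_gt_at_top[of 0]
    proof eventually_elim
      case (elim N)
      have "real (Suc N) powr (- Re s) \<le> real (Suc N) powr (-1)"
        using assms by (intro powr_mono) auto
      also have "\<dots> = 1 / real (Suc N)" by (simp add: powr_minus field_simps)
      also have "\<dots> \<le> 1 / real N" using elim by (intro frac_le) auto
      finally have "\<bar>mertens_nat N\<bar> * real (Suc N) powr (- Re s) \<le> \<bar>mertens_nat N\<bar> * (1 / real N)" by (rule mult_left_mono) auto
      then show ?case unfolding norm_mult norm_of_nat_Suc_powr by simp
    qed
  qed auto
  moreover have "(\<lambda>N. \<Sum>n<N. mertens_series_term n s) \<longlonglongrightarrow> mertens_series s"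
    using summable_sums[OF summable_mertens_series[of s]] assms by (simp add: sums_def mertens_series_def)
  ultimately have "(\<lambda>N. \<Sum>n<N. of_int (moebius (Suc n)) * of_nat (Suc n) powr (-s)) \<longlonglongrightarrow> mertens_series s + 0"
    unfolding moebius_sum_by_parts by (intro tendsto_add)
  then show ?thesis by (simp add: sums_def)
qed

text \<open>For Re s > 1 this is the product of the two Dirichlet series, and both factors are
  holomorphic further to the left. The multiplied form says something at s = 1 as well: the sum of
  mu(n)/n is 0.\<close>

lemma mertens_series_mult_zeta_reg:
  assumes "Re s > 1/2" shows "mertens_series s * zeta_reg s = s - 1"
proof (rule analytic_continuation_open[where s = "{s. Re s > 1}" and s' = "{s. Re s > 1/2}"
    and f = "\<lambda>s. mertens_series s * zeta_reg s" and g = "\<lambda>s. s - 1"])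
  show "(\<lambda>s. mertens_series s * zeta_reg s) holomorphic_on {s. Re s > 1/2}"
    by (intro holomorphic_on_mult mertens_series_holomorphic holomorphic_on_subset[OF zeta_reg_holomorphic]) auto
  show "mertens_series z * zeta_reg z = z - 1" if "z \<in> {s. Re s > 1}" for z
  proof -
    have z: "Re z > 1" using that by simp
    have "mertens_series z = (\<Sum>n. of_int (moebius (Suc n)) * of_nat (Suc n) powr (-z))"
      using moebius_sums_mertens_series[of z] z by (simp add: sums_iff)
    then show ?thesis
      using moebius_dirichlet_series[OF z] by (simp add: zeta_reg_gt_1[OF z] mult.left_commute)
  qed
  show "open {s. Re s > 1/2}" "open {s. Re s > 1}" by (rule open_halfspace_Re_gt)+
  show "connected {s. Re s > 1/2}" by (intro convex_connected convex_halfspace_Re_gt)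
  have "2 \<in> {s. Re s > 1}" by simp
  then show "{s. Re s > 1} \<noteq> {}" by blast
  show "(\<lambda>s. s - 1) holomorphic_on {s. Re s > 1/2}" by (intro holomorphic_intros)
  show "{s. Re s > 1} \<subseteq> {s. Re s > 1/2}" by auto
  show "s \<in> {s. Re s > 1/2}" using assms by simp
qed

lemma mertens_series_1: "mertens_series 1 = 0"
  using mertens_series_mult_zeta_reg[of 1] by simp

text \<open>By the product formula a zero would force s = 1, but the value there is 1.\<close>

lemma zeta_reg_nonzero: "Re s > 1/2 \<Longrightarrow> zeta_reg s \<noteq> 0"
  using mertens_series_mult_zeta_reg[of s] zeta_reg_1 by (metis mult_zero_right right_minus_eq zero_neq_one)

text \<open>The general bound grows with \<open>norm s\<close>. On the distant right side of the
  contour an absolute constant is wanted, so that the quadratic decay of the Gamma factor stays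
  integrable.\<close>

lemma norm_mertens_series_le_2:
  assumes "Re s \<ge> 2" shows "norm (mertens_series s) \<le> 2"
proof -
  have s1: "(\<lambda>n. of_int (moebius (Suc n)) * of_nat (Suc n) powr (-s)) sums mertens_series s"
    using assms by (intro moebius_sums_mertens_series) linarith
  have sm: "summable (\<lambda>n. real (Suc n) powr (-1 - 1))" "(\<Sum>n. real (Suc n) powr (-1 - 1)) \<le> 1 + 1/1"
    using powr_Suc_sums_bound[OF zero_less_one] by blast+
  have "norm (\<Sum>n. of_int (moebius (Suc n)) * of_nat (Suc n) powr (-s) :: complex) \<le> (\<Sum>n. real (Suc n) powr (-1 - 1))"
  proof (rule norm_suminf_le[OF _ sm(1)])
    fix n
    have "\<bar>real_of_int (moebius (Suc n))\<bar> \<le> 1" using abs_moebius_le[of "Suc n"] by linarith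
    moreover have "real (Suc n) powr (- Re s) \<le> real (Suc n) powr (-1-1)" using assms by (intro powr_mono) auto
    ultimately have "\<bar>real_of_int (moebius (Suc n))\<bar> * real (Suc n) powr (- Re s) \<le> 1 * real (Suc n) powr (-1 - 1)"
      by (intro mult_mono) auto
    then show "norm (of_int (moebius (Suc n)) * of_nat (Suc n) powr (-s) :: complex) \<le> real (Suc n) powr (-1 - 1)"
      unfolding norm_mult norm_of_nat_Suc_powr by simp
  qed
  then show ?thesis using s1 sm(2) by (simp add: sums_iff)
qed

text \<open>Approaching a zero horizontally from the right, \<open>norm (zeta_reg s)\<close> is at least a multiple of
  the distance, by the growth bound for its reciprocal.\<close>

lemma norm_deriv_zeta_reg_ge:
  assumes "Re \<rho> = 1/2" "zeta_reg \<rho> = 0"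
  shows "norm (deriv zeta_reg \<rho>) \<ge> 1 / K"
proof -
  define h where "h = (\<lambda>n. complex_of_real (inverse (real (Suc n))))"
  have h0: "h \<longlonglongrightarrow> 0" unfolding h_def using tendsto_of_real[OF LIMSEQ_inverse_real_of_nat, where 'a=complex] by (simp only: of_real_0)
  have hn: "h n \<noteq> 0" for n by (simp add: h_def del: of_nat_Suc)
  have "(zeta_reg has_field_derivative deriv zeta_reg \<rho>) (at \<rho>)"
    by (rule holomorphic_derivI[OF zeta_reg_holomorphic open_halfspace_Re_gt]) (use assms in auto)
  then have "((\<lambda>t. (zeta_reg (\<rho> + t) - zeta_reg \<rho>) / t) \<longlongrightarrow> deriv zeta_reg \<rho>) (at 0)"
    by (simp add: DERIV_def)
  then have "(\<lambda>n. (zeta_reg (\<rho> + h n) - zeta_reg \<rho>) / h n) \<longlonglongrightarrow> deriv zeta_reg \<rho>"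
    by (rule filterlim_compose[where f = h]) (use h0 hn in \<open>simp add: filterlim_at\<close>)
  then have l1: "(\<lambda>n. norm (zeta_reg (\<rho> + h n) / h n)) \<longlonglongrightarrow> norm (deriv zeta_reg \<rho>)"
    using assms by (intro tendsto_norm) simp
  \<comment> \<open>Points of the critical line are equally far from 0 and from 1, so the two norms
    cancel in the limit and exactly 1/K remains.\<close>
  have n\<rho>: "norm (\<rho> - 1) = norm \<rho>" "\<rho> \<noteq> 0"
  proof -
    have "Re (\<rho> - 1) = -(1/2)" using assms by simp
    then show "norm (\<rho> - 1) = norm \<rho>" unfolding cmod_def assms(1) by simp
  qed (use assms in auto)
  have "(\<lambda>n. norm (\<rho> + h n - 1) / (K * norm (\<rho> + h n) * (norm (h n) + 1))) \<longlonglongrightarrow> norm (\<rho> + 0 - 1) / (K * norm (\<rho> + 0) * (norm (0 :: complex) + 1))"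
    using n\<rho> K_pos by (intro tendsto_intros h0) auto
  then have l2: "(\<lambda>n. norm (\<rho> + h n - 1) / (K * norm (\<rho> + h n) * (norm (h n) + 1))) \<longlonglongrightarrow> 1 / K"
    using n\<rho> by simp
  have "norm (\<rho> + h n - 1) / (K * norm (\<rho> + h n) * (norm (h n) + 1)) \<le> norm (zeta_reg (\<rho> + h n) / h n)" for n
  proof -
    let ?s = "\<rho> + h n"
    define x where "x = inverse (real (Suc n))"
    have hx: "h n = of_real x" "x > 0" by (auto simp: h_def x_def)
    have re: "Re ?s - 1/2 = x" using assms hx by simp
    have "norm (?s - 1) = norm (mertens_series ?s) * norm (zeta_reg ?s)"
      using re hx(2) by (subst mertens_series_mult_zeta_reg[symmetric]) (auto simp: norm_mult)
    also have "\<dots> \<le> (K * norm ?s * (1 + 1 / x)) * norm (zeta_reg ?s)"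
      using norm_mertens_series_le[of ?s] re hx(2) by (intro mult_right_mono) auto
    finally have "norm (?s - 1) \<le> (K * norm ?s * (x + 1)) * (norm (zeta_reg ?s) / x)"
      using hx(2) by (simp add: field_simps)
    moreover have "Re ?s > 0" using re hx(2) by linarith
    then have "?s \<noteq> 0" by (metis less_irrefl zero_complex.sel(1))
    then have "K * norm ?s * (x + 1) > 0" using K_pos hx(2) by (intro mult_pos_pos) auto
    moreover have "norm (h n) = x" using hx by simp
    ultimately show ?thesis by (simp add: norm_divide pos_divide_le_eq mult.commute)
  qed
  then show ?thesis by (intro LIMSEQ_le[OF l2 l1]) auto
qed

end

subsection \<open>The functional equation on the real axis\<close>

text \<open>The logarithmic derivative of the reflection formula, obtained by differentiating 1 /
  (Gamma(z) Gamma(1-z)) = sin(pi z) / pi.\<close>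

lemma Digamma_reflection_complex:
  fixes z :: complex
  assumes "z \<notin> \<int>"
  shows "(Digamma (1 - z) - Digamma z) * sin (of_real pi * z) = of_real pi * cos (of_real pi * z)"
proof -
  have z: "z \<notin> \<int>\<^sub>\<le>\<^sub>0" "1 - z \<notin> \<int>\<^sub>\<le>\<^sub>0"
    using assms by (auto elim!: nonpos_Ints_cases)
      (metis Ints_1 Ints_diff Ints_of_int diff_diff_eq2 diff_add_cancel add_diff_cancel_left' minus_diff_eq)
  have "((\<lambda>z. rGamma z * rGamma (1 - z)) has_field_derivative
          (- rGamma z * Digamma z) * rGamma (1 - z) + (- rGamma (1 - z) * Digamma (1 - z) * (-1)) * rGamma z) (at z)"
  proof (rule DERIV_mult)
    show "(rGamma has_field_derivative - rGamma z * Digamma z) (at z)"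
      by (rule has_field_derivative_rGamma_no_nonpos_int[OF z(1)])
    show "((\<lambda>z. rGamma (1 - z)) has_field_derivative - rGamma (1 - z) * Digamma (1 - z) * (-1)) (at z)"
      by (rule DERIV_chain2[where f = rGamma and g = "\<lambda>z. 1 - z"],
          rule has_field_derivative_rGamma_no_nonpos_int[OF z(2)]) (auto intro!: derivative_eq_intros)
  qed
  moreover have "((\<lambda>z. rGamma z * rGamma (1 - z)) has_field_derivative cos (of_real pi * z)) (at z)"
    unfolding rGamma_reflection_complex by (auto intro!: derivative_eq_intros)
  ultimately have "(- rGamma z * Digamma z) * rGamma (1 - z) + (- rGamma (1 - z) * Digamma (1 - z) * (-1)) * rGamma z = cos (of_real pi * z)"
    by (rule DERIV_unique)
  then have "(Digamma (1 - z) - Digamma z) * (rGamma z * rGamma (1 - z)) = cos (of_real pi * z)"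
    by (simp add: algebra_simps)
  then show ?thesis unfolding rGamma_reflection_complex by (simp add: field_simps)
qed

text \<open>Subtracting the series of the two Digamma values pairs 1/(z+k) with 1/(k+1-z). Shifting
  the pairing by one step gives the partial fractions of the cotangent; the boundary term 1/(z+N)
  tends to 0.\<close>

lemma Digamma_diff_sums:
  fixes z :: complex
  assumes z: "z \<notin> \<int>"
  shows "(\<lambda>n. 2 * z / (z\<^sup>2 - of_nat (Suc n) ^ 2)) sums (Digamma (1 - z) - Digamma z - 1 / z)"
proof -
  have z0: "z \<noteq> 0" "1 - z \<noteq> 0" using z by auto
  have "(\<lambda>k. (inverse (of_nat (Suc k)) - inverse (1 - z + of_nat k)) - (inverse (of_nat (Suc k)) - inverse (z + of_nat k)))
     sums ((Digamma (1 - z) + euler_mascheroni) - (Digamma z + euler_mascheroni))"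
    using summable_Digamma[OF z0(1)] summable_Digamma[OF z0(2)]
    by (intro sums_diff) (auto simp: Digamma_def summable_sums)
  then have "(\<lambda>k. inverse (z + of_nat k) - inverse (1 - z + of_nat k)) sums (Digamma (1 - z) - Digamma z)"
    by simp
  then have l1: "(\<lambda>N. \<Sum>k<N. inverse (z + of_nat k) - inverse (1 - z + of_nat k)) \<longlonglongrightarrow> Digamma (1 - z) - Digamma z"
    by (simp add: sums_def)
  have l2: "(\<lambda>N. inverse (z + of_nat N)) \<longlonglongrightarrow> 0"
    by (rule filterlim_compose[OF tendsto_inverse_0 tendsto_add_filterlim_at_infinity[OF tendsto_const tendsto_of_nat]])
  have ne: "z + of_nat n \<noteq> 0" "1 - z + of_nat n \<noteq> 0" for n
  proof -
    show "z + of_nat n \<noteq> 0"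
    proof
      assume "z + of_nat n = 0"
      then have "z = - of_nat n" by (simp add: eq_neg_iff_add_eq_0)
      then show False using z by auto
    qed
    show "1 - z + of_nat n \<noteq> 0"
    proof
      assume "1 - z + of_nat n = 0"
      then have "z = 1 + of_nat n" by (simp add: algebra_simps)
      then show False using z by auto
    qed
  qed
  have "(\<Sum>n<N. 2 * z / (z\<^sup>2 - of_nat (Suc n) ^ 2)) =
    (\<Sum>k<N. inverse (z + of_nat k) - inverse (1 - z + of_nat k)) + inverse (z + of_nat N) - 1 / z" for N
  proof (induction N)
    case 0
    show ?case by (simp add: inverse_eq_divide)
  next
    case (Suc N)
    define m where "m = (of_nat (Suc N) :: complex)"
    have m: "z + m \<noteq> 0" "m - z \<noteq> 0" using ne[of "Suc N"] ne[of N] by (auto simp: m_def algebra_simps)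
    have sq: "z\<^sup>2 - m\<^sup>2 = - ((m - z) * (z + m))" by (simp add: power2_eq_square algebra_simps)
    have "2 * z / (z\<^sup>2 - m\<^sup>2) = inverse (z + m) - inverse (m - z)"
      unfolding sq using m by (simp add: divide_simps)
    moreover have "1 - z + of_nat N = m - z" by (simp add: m_def)
    ultimately show ?case using Suc by (simp add: m_def[symmetric])
  qed
  moreover have "(\<lambda>N. (\<Sum>k<N. inverse (z + of_nat k) - inverse (1 - z + of_nat k)) + inverse (z + of_nat N) - 1 / z)
     \<longlonglongrightarrow> (Digamma (1 - z) - Digamma z) + 0 - 1 / z"
    by (intro tendsto_intros l1 l2)
  ultimately show ?thesis by (simp add: sums_def)
qed

text \<open>The partial fractions of the cotangent at z = i x / (2 pi), where sine and cosine become
  exponentials of x/2.\<close>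

lemma inverse_exp_minus_1_sums:
  fixes x :: real
  assumes x: "x > 0"
  shows "(\<lambda>n. 2 * x / (x\<^sup>2 + (2 * pi * real (Suc n))\<^sup>2)) sums (1 / (exp x - 1) - 1 / x + 1 / 2)"
proof -
  define z where "z = \<i> * of_real (x / (2 * pi))"
  have "Im z \<noteq> 0" using x by (simp add: z_def)
  then have z: "z \<notin> \<int>" using complex_is_Int_iff by blast
  have pz: "of_real pi * z = \<i> * of_real (x / 2)" by (simp add: z_def)
  define E where "E = exp (complex_of_real (x / 2))"
  have E: "exp (\<i> * (\<i> * complex_of_real (x / 2))) = inverse E" "exp (- (\<i> * (\<i> * complex_of_real (x / 2)))) = E" "E \<noteq> 0"
    unfolding E_def mult.assoc[symmetric] by (simp_all add: exp_minus)
  have cosE: "cos (of_real pi * z) = (inverse E + E) / 2"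
    unfolding pz cos_exp_eq E(1,2) ..
  have sinE: "sin (of_real pi * z) = (inverse E - E) / (2 * \<i>)"
    unfolding pz sin_exp_eq E(1,2) ..
  have E2: "E * E = of_real (exp x)"
    unfolding E_def by (simp flip: exp_add exp_of_real)
  have "exp x \<noteq> 1" using x by simp
  then have E1: "E * E - 1 \<noteq> 0" unfolding E2 by (metis of_real_1 of_real_eq_iff right_minus_eq)
  have D: "Digamma (1 - z) - Digamma z = - \<i> * pi * (E * E + 1) / (E * E - 1)"
  proof -
    define d where "d = Digamma (1 - z) - Digamma z"
    have "inverse E - E = (1 - E * E) / E" "inverse E + E = (1 + E * E) / E"
      using E(3) by (simp_all add: divide_simps)
    then have h: "d * ((1 - E * E) / E / (2 * \<i>)) = pi * ((1 + E * E) / E / 2)"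
      using Digamma_reflection_complex[OF z] unfolding cosE sinE d_def by simp
    have q: "(1 - E * E) / E / (2 * \<i>) * (2 * \<i> * E) = 1 - E * E"
    proof -
      have "Y / (2 * \<i>) * (2 * \<i>) = Y" for Y :: complex
        by (rule nonzero_eq_divide_eq[THEN iffD1, OF _ refl]) simp
      then show ?thesis unfolding mult.assoc[symmetric, of _ "2 * \<i>" E] using E(3) by simp
    qed
    have r: "(1 + E * E) / E / 2 * (2 * \<i> * E) = \<i> * (E * E + 1)" using E(3) by (simp add: add.commute)
    have "d * (E * E - 1) = - (d * (1 - E * E))" by (simp add: algebra_simps)
    also have "d * (1 - E * E) = (d * ((1 - E * E) / E / (2 * \<i>))) * (2 * \<i> * E)"
      by (simp only: mult.assoc[of d] q)
    also have "\<dots> = pi * (\<i> * (E * E + 1))"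
      unfolding h by (simp only: mult.assoc[of "complex_of_real pi"] r)
    also have "- (pi * (\<i> * (E * E + 1))) = - \<i> * pi * (E * E + 1)" by simp
    finally show ?thesis unfolding d_def by (rule eq_divide_imp[OF E1])
  qed
  have "(\<lambda>n. (\<i> / (2 * pi)) * (2 * z / (z\<^sup>2 - of_nat (Suc n) ^ 2))) sums ((\<i> / (2 * pi)) * (Digamma (1 - z) - Digamma z - 1 / z))"
    by (intro sums_mult Digamma_diff_sums z)
  also have "(\<i> / (2 * pi)) * (Digamma (1 - z) - Digamma z - 1 / z) = of_real (1 / (exp x - 1) - 1 / x + 1 / 2)"
  proof -
    define e where "e = exp x"
    have e: "e - 1 \<noteq> 0" using x by (simp add: e_def)
    have "(\<i> / (2 * pi)) * (Digamma (1 - z) - Digamma z - 1 / z) = of_real (((e + 1) / (e - 1)) / 2 - 1 / x)"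
    proof -
      have 1: "1 / z = - \<i> * of_real (2 * pi / x)"
        using x by (simp add: z_def complex_eq_iff Re_divide Im_divide power2_eq_square)
      have 2: "Digamma (1 - z) - Digamma z = - \<i> * of_real (pi * ((e + 1) / (e - 1)))"
        unfolding D E2 e_def[symmetric] by (simp add: mult.assoc)
      have 3: "(\<i> / (2 * pi)) = \<i> * of_real (1 / (2 * pi))" by simp
      have 4: "(\<i> * of_real A) * (- \<i> * of_real B - (- \<i> * of_real C)) = of_real (A * (B - C))" for A B C
        by (simp add: complex_eq_iff algebra_simps)
      have 5: "1 / (2 * pi) * (pi * ((e + 1) / (e - 1)) - 2 * pi / x) = (e + 1) / (e - 1) / 2 - 1 / x"
        by (simp add: right_diff_distrib)
      show ?thesis unfolding 1 2 3 4 5 ..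
    qed
    also have "((e + 1) / (e - 1)) / 2 - 1 / x = 1 / (e - 1) - 1 / x + 1 / 2"
      using e by (simp add: field_simps)
    finally show ?thesis unfolding e_def .
  qed
  also have "(\<lambda>n. (\<i> / (2 * pi)) * (2 * z / (z\<^sup>2 - of_nat (Suc n) ^ 2))) = (\<lambda>n. of_real (2 * x / (x\<^sup>2 + (2 * pi * real (Suc n))\<^sup>2)))"
  proof
    fix n
    define m where "m = real (Suc n)"
    have pos: "x\<^sup>2 + (2 * pi * m)\<^sup>2 > 0" using x by (intro add_pos_nonneg) auto
    have 1: "z\<^sup>2 - (of_real m)\<^sup>2 = of_real (- (x\<^sup>2 + (2 * pi * m)\<^sup>2) / (2 * pi)\<^sup>2)"
      by (simp add: z_def power_mult_distrib power_divide field_simps)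
    have 2: "\<i> / (2 * pi) * (2 * z) = of_real (- 2 * x / (2 * pi)\<^sup>2)"
      by (simp add: z_def power2_eq_square)
    have "(\<i> / (2 * pi)) * (2 * z / (z\<^sup>2 - of_nat (Suc n) ^ 2)) = (\<i> / (2 * pi) * (2 * z)) / (z\<^sup>2 - (of_real m)\<^sup>2)"
      by (simp add: m_def)
    also have "\<dots> = of_real ((- 2 * x / (2 * pi)\<^sup>2) / (- (x\<^sup>2 + (2 * pi * m)\<^sup>2) / (2 * pi)\<^sup>2))"
      unfolding 1 2 of_real_divide ..
    also have "(- 2 * x / (2 * pi)\<^sup>2) / (- (x\<^sup>2 + (2 * pi * m)\<^sup>2) / (2 * pi)\<^sup>2) = 2 * x / (x\<^sup>2 + (2 * pi * m)\<^sup>2)"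
    proof -
      have *: "(- 2 * x / p) / (- Q / p) = 2 * x / Q" if "Q > 0" "p > 0" for Q p :: real
        using that by (simp add: field_simps)
      show ?thesis by (rule *[OF pos]) simp
    qed
    finally show "(\<i> / (2 * pi)) * (2 * z / (z\<^sup>2 - of_nat (Suc n) ^ 2)) = of_real (2 * x / (x\<^sup>2 + (2 * pi * real (Suc n))\<^sup>2))"
      by (simp add: m_def)
  qed
  finally show ?thesis unfolding sums_of_real_iff .
qed

section \<open>Sum against integral for powers and for positive kernels\<close>

lemma nn_integral_Ioc:
  fixes f :: "real \<Rightarrow> real"
  assumes "(f has_integral I) {a..b}" "\<And>x. x \<in> {a..b} \<Longrightarrow> f x \<ge> 0"
  shows "(\<integral>\<^sup>+x. ennreal (f x) * indicator {a<..b} x \<partial>lborel) = ennreal I"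
proof -
  have "(\<integral>\<^sup>+x. ennreal (f x) * indicator {a<..b} x \<partial>lborel) = (\<integral>\<^sup>+x. ennreal (f x) * indicator {a..b} x \<partial>lborel)"
    by (intro nn_integral_cong_AE eventually_mono[OF AE_lborel_singleton[of a]]) (auto simp: indicator_def)
  also have "\<dots> = ennreal I" using nn_integral_has_integral_lebesgue'[OF assms(2,1)] by simp
  finally show ?thesis .
qed

text \<open>For n = 0 and s > 0 the integrand is unbounded at 0, so the antiderivative is
  differentiated only in the interior and is merely continuous at the endpoints.\<close>

lemma has_integral_powr_unit_interval:
  fixes s :: real
  assumes "s < 1"
  shows "((\<lambda>u. u powr (-s)) has_integral
      (real (Suc n) powr (1 - s) / (1 - s) - real n powr (1 - s) / (1 - s))) {real n..real (Suc n)}"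
proof (rule fundamental_theorem_of_calculus_interior)
  show "continuous_on {real n..real (Suc n)} (\<lambda>u. u powr (1 - s) / (1 - s))"
    by (intro continuous_on_divide continuous_on_powr' continuous_on_id continuous_on_const) (use assms in auto)
  fix u assume "u \<in> {real n<..<real (Suc n)}"
  then have "u > 0" by (auto intro: le_less_trans[of 0 "real n"])
  then show "((\<lambda>u. u powr (1 - s) / (1 - s)) has_vector_derivative u powr (-s)) (at u)"
    using assms by (auto intro!: derivative_eq_intros simp flip: has_real_derivative_iff_has_vector_derivative)
qed simp

text \<open>For 0 < s < 1 this is the integral of u^(-s) over [n, n + 1] minus the value at the
  right end. Over all n these gaps add up to -zeta s.\<close>

abbreviation zeta_gap :: "real \<Rightarrow> nat \<Rightarrow> real" where
  "zeta_gap s n \<equiv> real (Suc n) powr (1 - s) / (1 - s) - real n powr (1 - s) / (1 - s) - real (Suc n) powr (-s)"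

text \<open>\<open>zeta_reg_term\<close> compares an integral with the value at the left end of the
  next interval, \<open>zeta_gap\<close> with the right end of the present one. After scaling by 1 -
  s the two differ by a second difference of n^(1-s), whose telescoping sum -1 cancels the leading 1
  of \<open>zeta_reg\<close>.\<close>

lemma zeta_reg_real_sums:
  fixes s :: real
  assumes s: "0 < s" "s < 1"
  shows "(\<lambda>n. zeta_gap s n)
    sums (Re (zeta_reg s) / (1 - s))"
proof -
  have t: "Re (zeta_reg_term n (of_real s)) = real (Suc (Suc n)) powr (1 - s) - real (Suc n) powr (1 - s) - (1 - s) * real (Suc n) powr (-s)" for n
  proof -
    have pw: "of_nat (Suc m) powr (complex_of_real y) = of_real (real (Suc m) powr y)" for m y
      using powr_of_real[of "real (Suc m)" y] unfolding of_real_of_nat_eq by simp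
    have "zeta_reg_term n (of_real s) = of_real (real (Suc (Suc n)) powr (1 - s) - real (Suc n) powr (1 - s) - (1 - s) * real (Suc n) powr (-s))"
      unfolding zeta_reg_term_def of_real_diff of_real_mult pw[symmetric]
      by (simp only: of_real_diff of_real_minus of_real_1)
    then show ?thesis by simp
  qed
  have "(\<lambda>n. zeta_reg_term n (of_real s)) sums (zeta_reg s - 1)"
    using summable_sums[OF summable_zeta_reg_term[of "of_real s"]] s by (simp add: zeta_reg_def)
  then have "(\<lambda>n. Re (zeta_reg_term n (of_real s))) sums Re (zeta_reg s - 1)"
    by (rule sums_Re)
  then have 1: "(\<lambda>n. real (Suc (Suc n)) powr (1 - s) - real (Suc n) powr (1 - s) - (1 - s) * real (Suc n) powr (-s)) sums (Re (zeta_reg s) - 1)"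
    unfolding t by simp
  define f where "f = (\<lambda>n. real (Suc n) powr (1 - s) - real n powr (1 - s))"
  have "f \<longlonglongrightarrow> 0"
  proof (rule Lim_null_comparison)
    show "(\<lambda>n. \<bar>1 - s\<bar> * real n powr (-s)) \<longlonglongrightarrow> 0"
      using tendsto_neg_powr[OF _ filterlim_real_sequentially, of "-s"] s by (intro tendsto_mult_right_zero) auto
    show "\<forall>\<^sub>F n in sequentially. norm (f n) \<le> \<bar>1 - s\<bar> * real n powr (-s)"
      using eventually_gt_at_top[of 0]
    proof eventually_elim
      case (elim n)
      have "norm (complex_of_real (real (Suc n)) powr (-of_real (s - 1)) - of_real (real n) powr (-of_real (s - 1))) \<le> norm (complex_of_real (s - 1)) * real n powr (-Re (of_real (s - 1)) - 1) * (real (Suc n) - real n)"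
        using elim s by (intro norm_powr_real_diff_le) auto
      moreover have "complex_of_real (real (Suc n)) powr (-of_real (s - 1)) - of_real (real n) powr (-of_real (s - 1)) = of_real (f n)"
        by (simp add: f_def powr_of_real[symmetric])
      ultimately show ?case by (simp add: norm_of_real abs_minus_commute del: of_real_diff)
    qed
  qed
  from telescope_sums[OF this] have 2: "(\<lambda>n. f (Suc n) - f n) sums - 1"
    using s by (simp add: f_def)
  have "(\<lambda>n. ((real (Suc (Suc n)) powr (1 - s) - real (Suc n) powr (1 - s) - (1 - s) * real (Suc n) powr (-s)) - (f (Suc n) - f n)) / (1 - s)) sums ((Re (zeta_reg s) - 1 - (-1)) / (1 - s))"
    by (intro sums_divide sums_diff 1 2)
  moreover have "((real (Suc (Suc n)) powr (1 - s) - real (Suc n) powr (1 - s) - (1 - s) * real (Suc n) powr (-s)) - (f (Suc n) - f n)) / (1 - s)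
    = zeta_gap s n" for n
    using s unfolding f_def by (simp add: divide_simps)
  ultimately show ?thesis by simp
qed

text \<open>The value at u = 0 is overwritten because \<open>0 powr (-s)\<close> is 0 by convention,
  which would make the integrand negative there when n = 0.\<close>

lemma has_integral_zeta_gap:
  fixes s :: real
  assumes "s < 1"
  shows "((\<lambda>u. if u = 0 then 0 else u powr (-s) - real (Suc n) powr (-s)) has_integral zeta_gap s n) {real n..real (Suc n)}"
proof -
  have "((\<lambda>u. u powr (-s) - real (Suc n) powr (-s)) has_integral zeta_gap s n) {real n..real (Suc n)}"
    using has_integral_diff[OF has_integral_powr_unit_interval[OF assms, of n] has_integral_const_real[of "real (Suc n) powr (-s)" "real n" "real (Suc n)"]]
    by simp
  from has_integral_spike_finite[OF _ _ this, of "{0}"] show ?thesis by auto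
qed

lemma zeta_gap_nonneg:
  fixes s :: real
  assumes "0 < s" "s < 1"
  shows "0 \<le> zeta_gap s n"
  by (rule has_integral_nonneg[OF has_integral_zeta_gap]) (use assms in \<open>auto intro!: powr_mono2'\<close>)

text \<open>Applied to two kernels with the same difference \<open>A\<close> between the integral of \<open>w x\<close> over the
  positive reals and its sum over the positive integers, this gives the functional equation.\<close>

lemma nn_integral_kernel_zeta_reg:
  fixes w W :: "real \<Rightarrow> real \<Rightarrow> real" and A :: "real \<Rightarrow> real"
  assumes s: "0 < s" "s < 1" and K: "K \<ge> 0"
    and meas: "case_prod w \<in> borel_measurable (lborel \<Otimes>\<^sub>M lborel)"
    and anti: "\<And>x u v. x > 0 \<Longrightarrow> 0 \<le> u \<Longrightarrow> u \<le> v \<Longrightarrow> w x v \<le> w x u"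
    and nonneg: "\<And>x u. x > 0 \<Longrightarrow> 0 \<le> u \<Longrightarrow> 0 \<le> w x u"
    and int_x: "\<And>u. u > 0 \<Longrightarrow> (\<integral>\<^sup>+x\<in>{0<..}. ennreal (w x u) \<partial>lborel) = ennreal (K * u powr (-s))"
    and int_u: "\<And>x n. x > 0 \<Longrightarrow> (w x has_integral (W x (real (Suc n)) - W x (real n))) {real n..real (Suc n)}"
    and sums: "\<And>x. x > 0 \<Longrightarrow> (\<lambda>n. W x (real (Suc n)) - W x (real n) - w x (real (Suc n))) sums A x"
  shows "(\<integral>\<^sup>+x\<in>{0<..}. ennreal (A x) \<partial>lborel) = ennreal (K * (Re (zeta_reg s) / (1 - s)))"
proof -
  have wm[measurable]: "(\<lambda>p. w (f p) (g p)) \<in> borel_measurable M"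
    if [measurable]: "f \<in> borel_measurable M" "g \<in> borel_measurable M" for f g and M :: "'z measure"
  proof -
    have "(\<lambda>p. (f p, g p)) \<in> measurable M (lborel \<Otimes>\<^sub>M lborel)" by measurable
    from measurable_compose[OF this meas] show ?thesis by simp
  qed
  let ?d = "\<lambda>x n. W x (real (Suc n)) - W x (real n) - w x (real (Suc n))"
  \<comment> \<open>The difference is formed cell by cell before integrating: in u the separate
    parts lead to the integral of u^(-s) and the sum of n^(-s), both divergent, whereas the
    differences are nonnegative and allow every exchange of sum and integral.\<close>
  define F where "F = (\<lambda>n x u. ennreal (w x u - w x (real (Suc n))) * indicator {real n<..real (Suc n)} u * indicator {0<..} x)"
  have Fm[measurable]: "(\<lambda>p. F n (f p) (g p)) \<in> borel_measurable M"
    if [measurable]: "f \<in> borel_measurable M" "g \<in> borel_measurable M" for n f g and M :: "'z measure"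
    unfolding F_def by measurable
  have Fu: "(\<integral>\<^sup>+u. F n x u \<partial>lborel) = ennreal (?d x n)" if x: "x > 0" for n x
  proof -
    have "((\<lambda>u. w x u - w x (real (Suc n))) has_integral ?d x n) {real n..real (Suc n)}"
      using has_integral_diff[OF int_u[OF x, of n] has_integral_const_real[of "w x (real (Suc n))" "real n" "real (Suc n)"]] by simp
    from nn_integral_Ioc[OF this] show ?thesis
      unfolding F_def using x anti by simp
  qed
  have Fu_nonneg: "?d x n \<ge> 0" if x: "x > 0" for n x
  proof -
    have "((\<lambda>u. w x u - w x (real (Suc n))) has_integral ?d x n) {real n..real (Suc n)}"
      using has_integral_diff[OF int_u[OF x, of n] has_integral_const_real[of "w x (real (Suc n))" "real n" "real (Suc n)"]] by simp
    then show ?thesis by (rule has_integral_nonneg) (use x anti in auto)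
  qed
  have Fx: "(\<integral>\<^sup>+x. F n x u \<partial>lborel) = ennreal (K * (u powr (-s) - real (Suc n) powr (-s))) * indicator {real n<..real (Suc n)} u" for n u
  proof (cases "u \<in> {real n<..real (Suc n)}")
    case True
    then have u: "u > 0" by (auto intro: le_less_trans[of 0 "real n"])
    have "(\<integral>\<^sup>+x. F n x u \<partial>lborel) = (\<integral>\<^sup>+x. ennreal (w x u) * indicator {0<..} x - ennreal (w x (real (Suc n))) * indicator {0<..} x \<partial>lborel)"
      using True u nonneg by (intro nn_integral_cong) (auto simp: F_def indicator_def ennreal_minus)
    also have "\<dots> = (\<integral>\<^sup>+x\<in>{0<..}. ennreal (w x u) \<partial>lborel) - (\<integral>\<^sup>+x\<in>{0<..}. ennreal (w x (real (Suc n))) \<partial>lborel)"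
    proof (rule nn_integral_diff)
      show "(\<integral>\<^sup>+x\<in>{0<..}. ennreal (w x (real (Suc n))) \<partial>lborel) \<noteq> \<infinity>"
        by (subst int_x) auto
      show "AE x in lborel. ennreal (w x (real (Suc n))) * indicator {0<..} x \<le> ennreal (w x u) * indicator {0<..} x"
        using True u anti by (intro AE_I2) (auto simp: indicator_def intro!: ennreal_leI)
    qed measurable
    also have "\<dots> = ennreal (K * u powr (-s)) - ennreal (K * real (Suc n) powr (-s))"
      using u by (simp add: int_x del: of_nat_Suc)
    also have "\<dots> = ennreal (K * (u powr (-s) - real (Suc n) powr (-s)))"
      using K by (simp add: ennreal_minus algebra_simps)
    finally show ?thesis using True by simp
  qed (simp add: F_def)
  have "(\<integral>\<^sup>+x\<in>{0<..}. ennreal (A x) \<partial>lborel) = (\<integral>\<^sup>+x. (\<Sum>n. \<integral>\<^sup>+u. F n x u \<partial>lborel) \<partial>lborel)"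
  proof (rule nn_integral_cong)
    fix x :: real
    show "ennreal (A x) * indicator {0<..} x = (\<Sum>n. \<integral>\<^sup>+u. F n x u \<partial>lborel)"
    proof (cases "x > 0")
      case True
      have "(\<Sum>n. \<integral>\<^sup>+u. F n x u \<partial>lborel) = ennreal (A x)"
        unfolding Fu[OF True] using Fu_nonneg[OF True] sums[OF True] by (rule suminf_ennreal_eq)
      then show ?thesis using True by simp
    qed (simp add: F_def)
  qed
  also have "\<dots> = (\<Sum>n. \<integral>\<^sup>+x. \<integral>\<^sup>+u. F n x u \<partial>lborel \<partial>lborel)"
    by (rule nn_integral_suminf) measurable
  also have "\<dots> = (\<Sum>n. \<integral>\<^sup>+u. \<integral>\<^sup>+x. F n x u \<partial>lborel \<partial>lborel)"
  proof (rule suminf_cong)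
    fix n show "(\<integral>\<^sup>+x. \<integral>\<^sup>+u. F n x u \<partial>lborel \<partial>lborel) = (\<integral>\<^sup>+u. \<integral>\<^sup>+x. F n x u \<partial>lborel \<partial>lborel)"
      by (rule lborel_pair.Fubini'[symmetric]) (simp add: case_prod_unfold)
  qed
  also have "\<dots> = (\<Sum>n. ennreal (K * zeta_gap s n))"
  proof (rule suminf_cong)
    fix n
    have hi: "((\<lambda>u. K * (if u = 0 then 0 else u powr (-s) - real (Suc n) powr (-s))) has_integral K * zeta_gap s n) {real n..real (Suc n)}"
      by (intro has_integral_mult_right has_integral_zeta_gap s)
    have "(\<integral>\<^sup>+u. \<integral>\<^sup>+x. F n x u \<partial>lborel \<partial>lborel) = (\<integral>\<^sup>+u. ennreal (K * (if u = 0 then 0 else u powr (-s) - real (Suc n) powr (-s))) * indicator {real n<..real (Suc n)} u \<partial>lborel)"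
      unfolding Fx by (intro nn_integral_cong) (auto simp: indicator_def)
    also have "\<dots> = ennreal (K * zeta_gap s n)"
      using s K by (intro nn_integral_Ioc[OF hi]) (auto intro!: mult_nonneg_nonneg powr_mono2')
    finally show "(\<integral>\<^sup>+u. \<integral>\<^sup>+x. F n x u \<partial>lborel \<partial>lborel) = ennreal (K * zeta_gap s n)" .
  qed
  also have "\<dots> = ennreal (K * (Re (zeta_reg s) / (1 - s)))"
  proof (rule suminf_ennreal_eq)
    show "(\<lambda>n. K * zeta_gap s n) sums (K * (Re (zeta_reg s) / (1 - s)))"
      by (intro sums_mult zeta_reg_real_sums s)
    fix n
    show "K * zeta_gap s n \<ge> 0"
      by (intro mult_nonneg_nonneg K zeta_gap_nonneg s)
  qed
  finally show ?thesis .
qed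

text \<open>The substitution t = x^2 / (x^2 + c^2) leads to a Beta integral with parameters (1+s)/2
  and (1-s)/2. They add up to 1, so the Beta value is just the product of the two Gamma
  values.\<close>

lemma nn_integral_powr_over_quadratic:
  fixes s c :: real
  assumes s: "0 < s" "s < 1" and c: "c > 0"
  shows "(\<integral>\<^sup>+x\<in>{0<..}. ennreal (2 * x powr s / (x\<^sup>2 + c\<^sup>2)) \<partial>lborel) =
    ennreal (c powr (s - 1) * (Gamma ((1 + s) / 2) * Gamma ((1 - s) / 2)))"
proof -
  define a b where "a = (1 + s) / 2" and "b = (1 - s) / 2"
  have ab: "a > 0" "b > 0" "a + b = 1" using s by (auto simp: a_def b_def field_simps)
  define f where "f = (\<lambda>t::real. t powr (a - 1) * (1 - t) powr (b - 1))"
  define g where "g = (\<lambda>x::real. x\<^sup>2 / (x\<^sup>2 + c\<^sup>2))"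
  define g' where "g' = (\<lambda>x::real. 2 * x * c\<^sup>2 / (x\<^sup>2 + c\<^sup>2)\<^sup>2)"
  have pos: "x\<^sup>2 + c\<^sup>2 > 0" for x using c by (intro add_nonneg_pos) auto
  have hf: "(f has_integral (Gamma a * Gamma b)) {0<..<1}"
    using has_integral_Beta_real[OF ab(1,2)] ab(3) unfolding f_def by (simp add: has_integral_Icc_iff_Ioo Beta_def)
  have af: "f absolutely_integrable_on {0<..<1}"
    using hf by (intro nonnegative_absolutely_integrable_1) (auto simp: f_def)
  have img: "g ` {0<..} = {0<..<1}"
  proof (intro equalityI subsetI)
    fix y assume "y \<in> g ` {0<..}"
    then obtain x where "y = g x" "x > 0" by auto
    then show "y \<in> {0<..<1}" using pos[of x] c by (auto simp: g_def)
  next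
    fix y :: real assume y: "y \<in> {0<..<1}"
    define x where "x = c * sqrt (y / (1 - y))"
    have "x > 0" using y c by (simp add: x_def)
    moreover have "x\<^sup>2 = c\<^sup>2 * (y / (1 - y))" using y by (simp add: x_def power_mult_distrib)
    then have "g x = y" unfolding g_def using y c by (simp add: field_simps)
    ultimately show "y \<in> g ` {0<..}" by (metis greaterThan_iff imageI)
  qed
  have inj: "inj_on g {0<..}"
  proof (rule inj_onI)
    fix x y assume xy: "x \<in> {0<..}" "y \<in> {0<..}" "g x = g y"
    then have "x\<^sup>2 * (y\<^sup>2 + c\<^sup>2) = y\<^sup>2 * (x\<^sup>2 + c\<^sup>2)"
      using pos[of x] pos[of y] by (simp add: g_def frac_eq_eq)
    then have "x\<^sup>2 = y\<^sup>2" using c by (simp add: algebra_simps)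
    then show "x = y" using xy by (simp add: power2_eq_iff)
  qed
  have "(\<lambda>x. \<bar>g' x\<bar> * f (g x)) absolutely_integrable_on {0<..} \<and>
           integral {0<..} (\<lambda>x. \<bar>g' x\<bar> * f (g x)) = Gamma a * Gamma b"
  proof (subst has_absolute_integral_change_of_variables_1'[where g = g])
    show "(g has_field_derivative g' x) (at x within {0<..})" if "x \<in> {0<..}" for x
      unfolding g_def g'_def using pos[of x]
      by (auto intro!: derivative_eq_intros simp: power2_eq_square field_simps)
  qed (use hf af inj img in \<open>auto simp: integral_unique\<close>)
  then have "((\<lambda>x. \<bar>g' x\<bar> * f (g x)) has_integral (Gamma a * Gamma b)) {0<..}"
    using absolutely_integrable_on_def has_integral_iff by blast
  then have "((\<lambda>x. c powr (s - 1) * (\<bar>g' x\<bar> * f (g x))) has_integral (c powr (s - 1) * (Gamma a * Gamma b))) {0<..}"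
    by (rule has_integral_mult_right)
  then have "((\<lambda>x. 2 * x powr s / (x\<^sup>2 + c\<^sup>2)) has_integral (c powr (s - 1) * (Gamma a * Gamma b))) {0<..}"
  proof (rule has_integral_eq[rotated])
    fix x :: real assume "x \<in> {0<..}"
    then have x: "x > 0" by simp
    define q where "q = x\<^sup>2 + c\<^sup>2"
    have q: "q > 0" using pos by (simp add: q_def)
    have e0: "g x = x\<^sup>2 / q" by (simp add: g_def q_def)
    have "1 - x\<^sup>2 / q = (q - x\<^sup>2) / q" using q by (simp add: diff_divide_distrib)
    then have e1: "g x = x\<^sup>2 / q" "1 - g x = c\<^sup>2 / q" unfolding e0 by (simp_all add: q_def)
    have px: "(x\<^sup>2) powr (a - 1) = x powr (s - 1)" "(c\<^sup>2) powr (b - 1) = c powr (-1 - s)"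
    proof -
      have "(x\<^sup>2) powr (a - 1) = x powr (2 * (a - 1))" using x by (simp add: powr_powr flip: powr_numeral)
      also have "2 * (a - 1) = s - 1" by (simp add: a_def field_simps)
      finally show "(x\<^sup>2) powr (a - 1) = x powr (s - 1)" .
      have "(c\<^sup>2) powr (b - 1) = c powr (2 * (b - 1))" using c by (simp add: powr_powr flip: powr_numeral)
      also have "2 * (b - 1) = - 1 - s" by (simp add: b_def field_simps)
      finally show "(c\<^sup>2) powr (b - 1) = c powr (-1 - s)" .
    qed
    have "f (g x) = x powr (s - 1) * c powr (-1 - s) * (1 / (q powr (a - 1) * q powr (b - 1)))"
      unfolding f_def e1(2) unfolding e1(1) using q x c by (simp add: powr_divide px)
    also have "q powr (a - 1) * q powr (b - 1) = q powr (-1)"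

    proof -
      have "a - 1 + (b - 1) = -1" using ab(3) by simp
      then show ?thesis unfolding powr_add[symmetric] by (simp only:)
    qed
    also have "\<dots> = 1 / q" using q by (simp add: powr_minus field_simps)
    finally have ff: "f (g x) = x powr (s - 1) * c powr (-1 - s) * q" by simp
    have "\<bar>g' x\<bar> = 2 * x * c\<^sup>2 / q\<^sup>2" using x by (simp add: g'_def q_def)
    then have "c powr (s - 1) * (\<bar>g' x\<bar> * f (g x)) = 2 * (x * x powr (s - 1)) * (c powr (s - 1) * (c\<^sup>2 * c powr (-1 - s))) / q"
      unfolding ff using q by (simp add: power2_eq_square)
    also have "x * x powr (s - 1) = x powr s" using x by (simp add: powr_mult_base)
    also have "c powr (s - 1) * (c\<^sup>2 * c powr (-1 - s)) = 1"
      using c by (simp flip: powr_add powr_numeral)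
    finally show "c powr (s - 1) * (\<bar>g' x\<bar> * f (g x)) = 2 * x powr s / (x\<^sup>2 + c\<^sup>2)" by (simp add: q_def)
  qed
  then show ?thesis unfolding a_def b_def
    by (intro nn_integral_has_integral_lebesgue') (auto intro!: divide_nonneg_pos pos)
qed

text \<open>Both sides equal the integral of A x = x^(s-1) (1/x - 1/(exp x - 1)). The kernel x^(s-1)
  exp(-u x) integrates in x to Gamma(s) u^(-s) and yields the left side; the kernel 2 x^s / (x^2 +
  (2 pi u)^2) integrates to a multiple of u^(s-1) and yields the right side.\<close>

lemma zeta_reg_functional_equation_real:
  fixes s :: real
  assumes s: "0 < s" "s < 1"
  shows "Gamma s * (Re (zeta_reg s) / (1 - s)) =
    (2 * pi) powr (s - 1) * (Gamma ((1 + s) / 2) * Gamma ((1 - s) / 2)) * (Re (zeta_reg (1 - s)) / s)"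
proof -
  define \<kappa> where "\<kappa> = (2 * pi) powr (s - 1) * (Gamma ((1 + s) / 2) * Gamma ((1 - s) / 2))"
  define A where "A = (\<lambda>x. x powr (s - 1) * (1 / x - 1 / (exp x - 1)))"
  have zr_nonneg: "Re (zeta_reg t) / (1 - t) \<ge> 0" if "0 < t" "t < 1" for t :: real
    using sums_le[OF zeta_gap_nonneg[OF that] sums_zero zeta_reg_real_sums[OF that]] .
  have "(\<integral>\<^sup>+x\<in>{0<..}. ennreal (A x) \<partial>lborel) = ennreal (Gamma s * (Re (zeta_reg s) / (1 - s)))"
  proof (rule nn_integral_kernel_zeta_reg[where w = "\<lambda>x u. x powr (s - 1) * exp (- u * x)"
        and W = "\<lambda>x u. - (x powr (s - 1) / x * exp (- u * x))"])
    show "(\<integral>\<^sup>+x\<in>{0<..}. ennreal (x powr (s - 1) * exp (- u * x)) \<partial>lborel) = ennreal (Gamma s * u powr (-s))" if u: "u > 0" for u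
    proof -
      define h where "h = (\<lambda>t::real. ennreal (indicator {0..} t * t powr (s - 1) / exp t))"
      have [measurable]: "h \<in> borel_measurable borel" unfolding h_def by measurable
      have "ennreal (Gamma s) = (\<integral>\<^sup>+t. h t \<partial>lborel)"
        unfolding h_def by (rule Gamma_conv_nn_integral_real[OF s(1)])
      also have "\<dots> = ennreal u * (\<integral>\<^sup>+x. h (u * x) \<partial>lborel)"
        using u by (subst nn_integral_real_affine[where c = u and t = 0]) auto
      also have "(\<integral>\<^sup>+x. h (u * x) \<partial>lborel) = (\<integral>\<^sup>+x. ennreal (u powr (s - 1)) * (ennreal (x powr (s - 1) * exp (- u * x)) * indicator {0<..} x) \<partial>lborel)"
        using u by (intro nn_integral_cong_AE eventually_mono[OF AE_lborel_singleton[of 0]])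
          (auto simp: h_def indicator_def powr_mult exp_minus field_simps zero_le_mult_iff simp flip: ennreal_mult')
      also have "\<dots> = ennreal (u powr (s - 1)) * (\<integral>\<^sup>+x\<in>{0<..}. ennreal (x powr (s - 1) * exp (- u * x)) \<partial>lborel)"
        by (rule nn_integral_cmult) measurable
      finally have "ennreal (Gamma s) = ennreal (u powr s) * (\<integral>\<^sup>+x\<in>{0<..}. ennreal (x powr (s - 1) * exp (- u * x)) \<partial>lborel)"
        using u by (simp add: mult.assoc[symmetric] powr_mult_base flip: ennreal_mult')
      then have "ennreal (u powr (-s)) * ennreal (Gamma s) = ennreal (u powr (-s) * u powr s) * (\<integral>\<^sup>+x\<in>{0<..}. ennreal (x powr (s - 1) * exp (- u * x)) \<partial>lborel)"
        by (simp add: ennreal_mult' mult.assoc)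
      also have "u powr (-s) * u powr s = 1" using u by (simp flip: powr_add)
      finally show ?thesis using s by (simp add: mult.commute flip: ennreal_mult')
    qed
    show "((\<lambda>u. x powr (s - 1) * exp (- u * x)) has_integral
         (- (x powr (s - 1) / x * exp (- real (Suc n) * x)) - - (x powr (s - 1) / x * exp (- real n * x)))) {real n..real (Suc n)}" if x: "x > 0" for x n
      by (rule fundamental_theorem_of_calculus)
        (use x in \<open>auto intro!: derivative_eq_intros simp flip: has_real_derivative_iff_has_vector_derivative\<close>)
    show "(\<lambda>n. - (x powr (s - 1) / x * exp (- real (Suc n) * x)) - - (x powr (s - 1) / x * exp (- real n * x)) - x powr (s - 1) * exp (- real (Suc n) * x)) sums A x" if x: "x > 0" for x
    proof -
      have lt: "exp (-x) < 1" using x by simp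
      have pw: "exp (- real n * x) = exp (-x) ^ n" for n by (simp add: exp_of_nat_mult[symmetric] mult.commute)
      have "(\<lambda>n. exp (- x) ^ n) sums (1 / (1 - exp (-x)))" using lt by (intro geometric_sums) simp
      from sums_mult[OF this, of "x powr (s - 1) * ((1 - exp (-x)) / x - exp (-x))"]
      have "(\<lambda>n. x powr (s - 1) * ((1 - exp (-x)) / x - exp (-x)) * exp (- x) ^ n) sums (x powr (s - 1) * ((1 - exp (-x)) / x - exp (-x)) * (1 / (1 - exp (-x))))" .
      also have "x powr (s - 1) * ((1 - exp (-x)) / x - exp (-x)) * (1 / (1 - exp (-x))) = A x"
      proof -
        have "exp x > 1" using x by simp
        then have "1 - exp (-x) = (exp x - 1) / exp x" by (simp add: exp_minus field_simps)
        then have "exp (-x) * (1 / (1 - exp (-x))) = 1 / (exp x - 1)" by (simp add: exp_minus)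
        moreover have "(1 - exp (-x)) / x * (1 / (1 - exp (-x))) = 1 / x" using lt by simp
        ultimately show ?thesis unfolding A_def mult.assoc left_diff_distrib by simp
      qed
      also have "(\<lambda>n. x powr (s - 1) * ((1 - exp (-x)) / x - exp (-x)) * exp (- x) ^ n) = (\<lambda>n. - (x powr (s - 1) / x * exp (- real (Suc n) * x)) - - (x powr (s - 1) / x * exp (- real n * x)) - x powr (s - 1) * exp (- real (Suc n) * x))"
        unfolding pw by (simp add: fun_eq_iff algebra_simps diff_divide_distrib)
      finally show ?thesis .
    qed
  qed (use s in \<open>auto intro!: mult_left_mono\<close>)
  moreover have "(\<integral>\<^sup>+x\<in>{0<..}. ennreal (A x) \<partial>lborel) =
      ennreal (\<kappa> * (Re (zeta_reg (of_real (1 - s))) / (1 - (1 - s))))"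
  proof (rule nn_integral_kernel_zeta_reg[where w = "\<lambda>x u. 2 * x powr s / (x\<^sup>2 + (2 * pi * u)\<^sup>2)"
        and W = "\<lambda>x u. x powr (s - 1) / pi * arctan (2 * pi * u / x)"])
    show "(\<integral>\<^sup>+x\<in>{0<..}. ennreal (2 * x powr s / (x\<^sup>2 + (2 * pi * u)\<^sup>2)) \<partial>lborel) = ennreal (\<kappa> * u powr (-(1 - s)))" if u: "u > 0" for u
      unfolding \<kappa>_def using nn_integral_powr_over_quadratic[OF s, of "2 * pi * u"] u by (simp add: powr_mult mult_ac)
    show "2 * x powr s / (x\<^sup>2 + (2 * pi * v)\<^sup>2) \<le> 2 * x powr s / (x\<^sup>2 + (2 * pi * u)\<^sup>2)" if "x > 0" "0 \<le> u" "u \<le> v" for x u v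
      using that by (intro divide_left_mono add_left_mono power_mono mult_pos_pos add_pos_nonneg) auto
    show "((\<lambda>u. 2 * x powr s / (x\<^sup>2 + (2 * pi * u)\<^sup>2)) has_integral
         (x powr (s - 1) / pi * arctan (2 * pi * real (Suc n) / x) - x powr (s - 1) / pi * arctan (2 * pi * real n / x))) {real n..real (Suc n)}" if x: "x > 0" for x n
    proof (rule fundamental_theorem_of_calculus)
      fix u :: real
      have q: "x\<^sup>2 + (2 * pi * u)\<^sup>2 > 0" using x by (intro add_pos_nonneg) auto
      have "((\<lambda>u. x powr (s - 1) / pi * arctan (2 * pi * u / x)) has_field_derivative x powr (s - 1) / pi * (2 * pi / x * inverse (1 + (2 * pi * u / x)\<^sup>2))) (at u within {real n..real (Suc n)})"
        using x by (auto intro!: derivative_eq_intros)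
      also have "x powr (s - 1) / pi * (2 * pi / x * inverse (1 + (2 * pi * u / x)\<^sup>2)) = 2 * x powr s / (x\<^sup>2 + (2 * pi * u)\<^sup>2)"
      proof -
        have "1 + (2 * pi * u / x)\<^sup>2 = (x\<^sup>2 + (2 * pi * u)\<^sup>2) / x\<^sup>2" using x by (simp add: power_divide add_divide_distrib)
        then have "x powr (s - 1) / pi * (2 * pi / x * inverse (1 + (2 * pi * u / x)\<^sup>2)) = 2 * (x * x powr (s - 1)) / (x\<^sup>2 + (2 * pi * u)\<^sup>2)"
          using x by (simp add: power2_eq_square)
        then show ?thesis using x by (simp add: powr_mult_base)
      qed
      finally show "((\<lambda>u. x powr (s - 1) / pi * arctan (2 * pi * u / x)) has_vector_derivative 2 * x powr s / (x\<^sup>2 + (2 * pi * u)\<^sup>2)) (at u within {real n..real (Suc n)})"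
        by (simp add: has_real_derivative_iff_has_vector_derivative)
    qed simp
    \<comment> \<open>The integral over u is x^(s-1)/2 by the limit of arctan, the sum is given by
      the partial fractions of 1/(exp x - 1). The two halves cancel, which leaves the same
      \<open>A x\<close> as for the exponential kernel.\<close>
    show "(\<lambda>n. x powr (s - 1) / pi * arctan (2 * pi * real (Suc n) / x) - x powr (s - 1) / pi * arctan (2 * pi * real n / x) - 2 * x powr s / (x\<^sup>2 + (2 * pi * real (Suc n))\<^sup>2)) sums A x" if x: "x > 0" for x
    proof -
      have "filterlim (\<lambda>n. 2 * pi / x * real n) at_top sequentially"
        using x by (intro filterlim_tendsto_pos_mult_at_top[OF tendsto_const] filterlim_real_sequentially) auto
      then have "(\<lambda>n. arctan (2 * pi / x * real n)) \<longlonglongrightarrow> pi / 2"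
        by (rule filterlim_compose[OF tendsto_arctan_at_top])
      then have "(\<lambda>n. x powr (s - 1) / pi * arctan (2 * pi * real n / x)) \<longlonglongrightarrow> x powr (s - 1) / pi * (pi / 2)"
        by (intro tendsto_mult_left) simp
      from telescope_sums[OF this]
      have 1: "(\<lambda>n. x powr (s - 1) / pi * arctan (2 * pi * real (Suc n) / x) - x powr (s - 1) / pi * arctan (2 * pi * real n / x)) sums (x powr (s - 1) / 2)"
        by simp
      have "(\<lambda>n. x powr (s - 1) * (2 * x / (x\<^sup>2 + (2 * pi * real (Suc n))\<^sup>2))) sums (x powr (s - 1) * (1 / (exp x - 1) - 1 / x + 1 / 2))"
        by (intro sums_mult inverse_exp_minus_1_sums x)
      moreover have "x powr (s - 1) * (2 * x / q) = 2 * x powr s / q" for q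
        using x by (simp add: powr_mult_base[symmetric, of x "s - 1", simplified] mult_ac)
      ultimately have 2: "(\<lambda>n. 2 * x powr s / (x\<^sup>2 + (2 * pi * real (Suc n))\<^sup>2)) sums (x powr (s - 1) * (1 / (exp x - 1) - 1 / x + 1 / 2))"
        by (simp only:)
      have "x powr (s - 1) / 2 - x powr (s - 1) * (1 / (exp x - 1) - 1 / x + 1 / 2) = A x"
        by (simp add: A_def algebra_simps)
      with sums_diff[OF 1 2] show ?thesis by simp
    qed
    show "\<kappa> \<ge> 0"
      unfolding \<kappa>_def using s by (intro mult_nonneg_nonneg) (auto intro!: less_imp_le[OF Gamma_real_pos])
  qed (use s in auto)
  ultimately have eq: "ennreal (Gamma s * (Re (zeta_reg s) / (1 - s))) = ennreal (\<kappa> * (Re (zeta_reg (of_real (1 - s))) / (1 - (1 - s))))"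
    by simp
  have "Gamma s * (Re (zeta_reg s) / (1 - s)) = \<kappa> * (Re (zeta_reg (of_real (1 - s))) / (1 - (1 - s)))"
  proof (rule ennreal_inj[THEN iffD1, OF _ _ eq])
    show "0 \<le> Gamma s * (Re (zeta_reg s) / (1 - s))"
      using s by (intro mult_nonneg_nonneg zr_nonneg less_imp_le[OF Gamma_real_pos]) auto
    show "0 \<le> \<kappa> * (Re (zeta_reg (of_real (1 - s))) / (1 - (1 - s)))"
      unfolding \<kappa>_def using s by (intro mult_nonneg_nonneg zr_nonneg less_imp_le[OF Gamma_real_pos]) auto
  qed
  then show ?thesis by (simp add: \<kappa>_def)
qed

subsection \<open>The symmetric zeta function and decay of Gamma\<close>

lemma Re_pos_not_nonpos_Ints: "Re z > 0 \<Longrightarrow> z \<notin> \<int>\<^sub>\<le>\<^sub>0"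
  by (auto elim!: nonpos_Ints_cases)

lemma half_integer_not_nonpos_Ints:
  assumes "Re z = 1/2 - real n" shows "z \<notin> \<int>\<^sub>\<le>\<^sub>0"
proof
  assume "z \<in> \<int>\<^sub>\<le>\<^sub>0"
  then obtain k where "z = of_int k" by (elim nonpos_Ints_cases)
  then have "real_of_int (2 * (k + int n)) = of_int 1" using assms by simp
  then have "2 * (k + int n) = 1" by (simp only: of_int_eq_iff)
  then show False by presburger
qed

lemma rGamma_three_halves_minus:
  fixes w :: complex
  shows "rGamma ((1 - w) / 2) = (1 - w) / 2 * rGamma ((3 - w) / 2)"
proof -
  have "(1 - w) / 2 + 1 = (3 - w) / 2" by (simp add: field_simps)
  with rGamma_plus1[of "(1 - w) / 2"] show ?thesis by simp
qed

text \<open>This is -2 pi^(-w/2) zeta(w) / Gamma((1-w)/2), written so that the pole of zeta at 1 and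
  the zero of the reciprocal Gamma factor there have already cancelled.\<close>

definition xi_half :: "complex \<Rightarrow> complex" where
  "xi_half w = of_real pi powr (- w / 2) * zeta_reg w * rGamma ((3 - w) / 2)"

lemma xi_half_holomorphic: "xi_half holomorphic_on {w. Re w > 0}"
  unfolding xi_half_def by (intro holomorphic_intros zeta_reg_holomorphic) auto

lemma Gamma_duplication_real:
  fixes s :: real assumes "s > 0"
  shows "Gamma (s / 2) * Gamma ((1 + s) / 2) = 2 powr (1 - s) * sqrt pi * Gamma s"
proof -
  have "complex_of_real (s/2) \<notin> \<int>\<^sub>\<le>\<^sub>0" "complex_of_real (s/2) + 1/2 \<notin> \<int>\<^sub>\<le>\<^sub>0"
    using assms by (auto elim!: nonpos_Ints_cases simp: complex_eq_iff)
  from Gamma_legendre_duplication[OF this]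
  have "Gamma (complex_of_real (s/2)) * Gamma (complex_of_real ((1 + s)/2)) = exp (of_real ((1 - s) * ln 2)) * of_real (sqrt pi) * Gamma (complex_of_real s)"
    by (simp add: add_divide_distrib add.commute)
  then have "complex_of_real (Gamma (s / 2) * Gamma ((1 + s) / 2)) = of_real (exp ((1 - s) * ln 2) * sqrt pi * Gamma s)"
    unfolding Gamma_complex_of_real exp_of_real by (simp only: of_real_mult)
  then show ?thesis unfolding of_real_eq_iff by (simp add: powr_def)
qed

text \<open>Duplication expresses Gamma s through Gamma(s/2) and Gamma((1+s)/2). The latter also
  occurs on the other side of the functional equation, and cancelling it leaves the same expression
  in s and in 1 - s.\<close>

lemma xi_half_symmetric_real:
  fixes s :: real
  assumes s: "0 < s" "s < 1"
  shows "xi_half (of_real s) = xi_half (1 - of_real s)"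
proof -
  have xi: "xi_half (of_real t) = of_real (pi powr (-t / 2) * Re (zeta_reg t) / ((1 - t) / 2 * Gamma ((1 - t) / 2)))"
    if t: "0 < t" "t < 1" for t :: real
  proof -
    have "cnj (zeta_reg (of_real t)) = zeta_reg (of_real t)" using t by (subst zeta_reg_cnj[symmetric]) auto
    then have z: "zeta_reg (of_real t) = of_real (Re (zeta_reg t))" by (simp add: complex_eq_iff)
    have p: "of_real pi powr (- complex_of_real t / 2) = of_real (pi powr (-t / 2))"
      using powr_of_real[of pi "-t/2"] by simp
    have "rGamma ((1 - t) / 2) = (1 - t) / 2 * rGamma ((3 - t) / 2)"
    proof -
      have "(1 - t) / 2 + 1 = (3 - t) / 2" by (simp add: field_simps)
      with rGamma_plus1[of "(1 - t) / 2"] show ?thesis by simp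
    qed
    then have "rGamma ((3 - t) / 2) = 1 / ((1 - t) / 2 * Gamma ((1 - t) / 2))"
      using t by (simp add: Gamma_def field_simps)
    moreover have "rGamma ((3 - complex_of_real t) / 2) = of_real (rGamma ((3 - t) / 2))"
      by (simp flip: rGamma_complex_of_real)
    ultimately have r: "rGamma ((3 - complex_of_real t) / 2) = of_real (1 / ((1 - t) / 2 * Gamma ((1 - t) / 2)))" by simp
    show ?thesis unfolding xi_half_def r p by (subst z) simp
  qed
  define z z' where "z = Re (zeta_reg s)" and "z' = Re (zeta_reg (1 - s))"
  define G1 G2 G3 where "G1 = Gamma ((1 - s) / 2)" and "G2 = Gamma (s / 2)" and "G3 = Gamma ((1 + s) / 2)"
  have pos: "G1 > 0" "G2 > 0" "G3 > 0" using s by (auto simp: G1_def G2_def G3_def)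
  have fe: "Gamma s * z * s = (2 * pi) powr (s - 1) * G3 * G1 * z' * (1 - s)"
    using zeta_reg_functional_equation_real[OF s] s by (simp add: z_def z'_def G1_def G3_def field_simps)
  have "G3 * (G2 * z * s) = 2 powr (1 - s) * sqrt pi * (Gamma s * z * s)"
  proof -
    have "G2 * G3 = 2 powr (1 - s) * sqrt pi * Gamma s"
      using Gamma_duplication_real[OF s(1)] by (simp add: G2_def G3_def)
    moreover have "G3 * (G2 * z * s) = G2 * G3 * (z * s)" by (simp add: mult_ac)
    ultimately show ?thesis by (simp only: mult.assoc)
  qed
  also have "\<dots> = G3 * ((2 powr (1 - s) * sqrt pi * (2 * pi) powr (s - 1)) * (G1 * z' * (1 - s)))"
    unfolding fe by simp
  finally have "G2 * z * s = (2 powr (1 - s) * sqrt pi * (2 * pi) powr (s - 1)) * (G1 * z' * (1 - s))"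
    using pos by simp
  also have "2 powr (1 - s) * sqrt pi * (2 * pi) powr (s - 1) = pi powr (s - 1/2)"
  proof -
    have "2 powr (1 - s) * sqrt pi * (2 * pi) powr (s - 1) = (2 powr (1 - s) * 2 powr (s - 1)) * (pi powr (1/2) * pi powr (s - 1))"
      by (simp add: powr_mult powr_half_sqrt)
    also have "\<dots> = pi powr (s - 1/2)" by (simp flip: powr_add)
    finally show ?thesis .
  qed
  finally have "pi powr (-s/2) * (G2 * z * s) = pi powr (-s/2) * (pi powr (s - 1/2) * (G1 * z' * (1 - s)))" by simp
  also have "\<dots> = pi powr (-(1 - s)/2) * (G1 * z' * (1 - s))"
  proof -
    have "-s/2 + (s - 1/2) = -(1-s)/2" by (simp add: field_simps)
    then show ?thesis by (simp only: mult.assoc[symmetric] powr_add[symmetric])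
  qed
  finally have "pi powr (-s / 2) * z / ((1 - s) / 2 * G1) = pi powr (-(1 - s) / 2) * z' / (s / 2 * G2)"
    using pos s by (simp add: frac_eq_eq mult_ac)
  then show ?thesis using xi[OF s] xi[of "1 - s"] s by (simp add: z_def z'_def G1_def G2_def)
qed

lemma xi_half_symmetric:
  assumes w: "0 < Re w" "Re w < 1"
  shows "xi_half w = xi_half (1 - w)"
proof -
  define S where "S = {w. 0 < Re w} \<inter> {w. Re w < 1}"
  have "xi_half w - xi_half (1 - w) = 0"
  proof (rule analytic_continuation[where f = "\<lambda>w. xi_half w - xi_half (1 - w)" and w = w and S = S and U = "complex_of_real ` {0<..<1}" and \<xi> = "1/2"])
    show "open S" unfolding S_def by (intro open_Int open_halfspace_Re_gt open_halfspace_Re_lt)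
    show "connected S" unfolding S_def by (intro convex_connected convex_Int convex_halfspace_Re_gt convex_halfspace_Re_lt)
    show "(\<lambda>w. xi_half w - xi_half (1 - w)) holomorphic_on S"
    proof (rule holomorphic_on_diff)
      show "xi_half holomorphic_on S" by (rule holomorphic_on_subset[OF xi_half_holomorphic]) (auto simp: S_def)
      have "(xi_half \<circ> (\<lambda>w. 1 - w)) holomorphic_on S"
        by (rule holomorphic_on_compose_gen[OF _ xi_half_holomorphic]) (auto simp: S_def intro!: holomorphic_intros)
      then show "(\<lambda>w. xi_half (1 - w)) holomorphic_on S" by (simp add: o_def)
    qed
    show "(1/2 :: complex) islimpt complex_of_real ` {0<..<1}"
      unfolding islimpt_approachable
    proof (intro allI impI)
      fix e :: real assume e: "e > 0"
      define t where "t = 1/2 + min (e/2) (1/4)"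
      have t: "t \<in> {0<..<1}" "t \<noteq> 1/2" "dist t (1/2) < e" using e by (auto simp: t_def dist_real_def min_def)
      have "dist (complex_of_real t) (1/2) = dist t (1/2)"
        using dist_of_real[of t "1/2", where 'a = complex] by simp
      moreover have "complex_of_real t \<noteq> 1/2" using t(2) by (auto simp: complex_eq_iff)
      ultimately show "\<exists>x'\<in>complex_of_real ` {0<..<1}. x' \<noteq> 1 / 2 \<and> dist x' (1 / 2) < e" using t by auto
    qed
    show "xi_half z - xi_half (1 - z) = 0" if "z \<in> complex_of_real ` {0<..<1}" for z
      using that xi_half_symmetric_real by auto
  qed (use w in \<open>auto simp: S_def\<close>)
  then show ?thesis by simp
qed

text \<open>The formula is available only for positive real part; the rest of the plane is filled in
  by reflection. In the strip where both definitions make sense they agree, so the gluing is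
  holomorphic.\<close>

definition xi :: "complex \<Rightarrow> complex" where
  "xi w = (if w \<in> {w. 0 < Re w} then xi_half w else xi_half (1 - w))"

lemma xi_holomorphic: "xi holomorphic_on A"
proof -
  have "xi holomorphic_on ({w. 0 < Re w} \<union> {w. Re w < 1})"
    unfolding xi_def
  proof (rule holomorphic_on_If_Un)
    show "xi_half holomorphic_on {w. 0 < Re w}" by (rule xi_half_holomorphic)
    have "(xi_half \<circ> (\<lambda>w. 1 - w)) holomorphic_on {w. Re w < 1}"
      by (rule holomorphic_on_compose_gen[OF _ xi_half_holomorphic]) (auto intro!: holomorphic_intros)
    then show "(\<lambda>w. xi_half (1 - w)) holomorphic_on {w. Re w < 1}" by (simp add: o_def)
  qed (auto simp: open_halfspace_Re_gt open_halfspace_Re_lt intro: xi_half_symmetric)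
  then show ?thesis by (rule holomorphic_on_subset) auto
qed

lemma xi_symmetric: "xi (1 - w) = xi w"
  using xi_half_symmetric[of w] by (cases "Re w \<le> 0 \<or> Re w \<ge> 1") (auto simp: xi_def)

lemma xi_eq: "Re w > 0 \<Longrightarrow> xi w = of_real pi powr (- w / 2) * zeta_reg w * rGamma ((3 - w) / 2)"
  by (simp add: xi_def xi_half_def)

lemma xi_cnj: "xi (cnj w) = cnj (xi w)"
proof -
  have *: "xi_half (cnj w) = cnj (xi_half w)" if "Re w > 0" for w
  proof -
    have "cnj (of_real pi powr (- w / 2)) = of_real pi powr (- cnj w / 2)"
      by (subst cnj_powr) auto
    then show ?thesis using that by (simp add: xi_half_def zeta_reg_cnj cnj_rGamma)
  qed
  show ?thesis using *[of w] *[of "1 - w"] by (auto simp: xi_def)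
qed

section \<open>Existence of the continuation and identification of \<open>zeta\<close>\<close>

lemma pi_powr_holomorphic: "(\<lambda>s. of_real pi powr (s / 2) :: complex) holomorphic_on A"
  by (intro holomorphic_intros) auto

text \<open>\<open>zeta\<close> is a definite description, so a witness is needed before anything
  can be said about it. For Re s < 1 the witness solves the defining equation of \<open>xi\<close>
  for zeta, which is possible because Gamma((3-s)/2) has no pole there.\<close>

lemma is_zeta_exists: "\<exists>f. is_zeta f \<and> (\<forall>s. Re s > 0 \<longrightarrow> s \<noteq> 1 \<longrightarrow> f s = zeta_reg s / (s - 1))"
proof -
  define A where "A = {s. Re s > 0} - {1 :: complex}"
  define B where "B = {s :: complex. Re s < 1}"
  define f1 where "f1 = (\<lambda>s. zeta_reg s / (s - 1))"
  define f2 where "f2 = (\<lambda>s. xi s * (of_real pi powr (s / 2) * Gamma ((3 - s) / 2)) / (s - 1))"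
  define f where "f = (\<lambda>s. if s = 1 then 0 else if s \<in> A then f1 s else f2 s)"
  have nz: "(3 - s) / 2 \<notin> \<int>\<^sub>\<le>\<^sub>0" if "s \<in> B" for s
    using that by (intro Re_pos_not_nonpos_Ints) (auto simp: B_def)
  have "(\<lambda>s. if s \<in> A then f1 s else f2 s) holomorphic_on (A \<union> B)"
  proof (rule holomorphic_on_If_Un)
    show "open A" unfolding A_def by (intro open_delete open_halfspace_Re_gt)
    show "open B" unfolding B_def by (rule open_halfspace_Re_lt)
    show "f1 holomorphic_on A" unfolding f1_def
      by (intro holomorphic_intros holomorphic_on_subset[OF zeta_reg_holomorphic]) (auto simp: A_def)
    show "f2 holomorphic_on B" unfolding f2_def
      using nz by (intro holomorphic_intros holomorphic_Gamma' xi_holomorphic pi_powr_holomorphic) (auto simp: B_def)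
    fix z assume z: "z \<in> A" "z \<in> B"
    have "rGamma ((3 - z) / 2) * Gamma ((3 - z) / 2) = 1"
      using nz[OF z(2)] by (simp add: Gamma_def rGamma_eq_zero_iff)
    moreover have "of_real pi powr (- z / 2) * of_real pi powr (z / 2) = (1 :: complex)"
      by (simp flip: powr_add)
    ultimately have "xi z * (of_real pi powr (z / 2) * Gamma ((3 - z) / 2)) = zeta_reg z"
      using z(1) xi_eq[of z] by (simp add: A_def mult_ac)
    then show "f1 z = f2 z" by (simp add: f1_def f2_def)
  qed
  moreover have "A \<union> B = UNIV - {1}" by (auto simp: A_def B_def)
  ultimately have "(\<lambda>s. if s \<in> A then f1 s else f2 s) holomorphic_on (UNIV - {1})" by simp
  then have "f holomorphic_on (UNIV - {1})"
    by (rule holomorphic_transform) (auto simp: f_def)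
  moreover have "f s = (\<Sum>n. 1 / of_nat (Suc n) powr s)" if "Re s > 1" for s
  proof -
    have "s \<noteq> 1" "s \<in> A" using that by (auto simp: A_def)
    then have "f s = (\<Sum>n. of_nat (Suc n) powr (-s))" using zeta_reg_gt_1[OF that] by (simp add: f_def f1_def)
    then show ?thesis by (simp add: powr_minus inverse_eq_divide)
  qed
  moreover have "f 1 = 0" by (simp add: f_def)
  moreover have "f s = zeta_reg s / (s - 1)" if "Re s > 0" "s \<noteq> 1" for s
    using that by (simp add: f_def A_def f1_def)
  ultimately show ?thesis unfolding is_zeta_def by blast
qed

lemma zeta_eq:
  assumes "Re s > 0" "s \<noteq> 1" shows "zeta s = zeta_reg s / (s - 1)"
proof -
  obtain f where f: "is_zeta f" "\<And>s. Re s > 0 \<Longrightarrow> s \<noteq> 1 \<Longrightarrow> f s = zeta_reg s / (s - 1)"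
    using is_zeta_exists by blast
  have "zeta = f" unfolding zeta_def by (rule the_equality) (use f(1) is_zeta_unique in auto)
  then show ?thesis using f(2) assms by simp
qed

text \<open>In the product formula of Gauss the power of n has the same norm for z and for Re z, and
  each factor |z + i| of the denominator is at least Re z + i.\<close>

lemma norm_Gamma_le:
  fixes z :: complex
  assumes "Re z > 0" shows "norm (Gamma z) \<le> Gamma (Re z)"
proof (rule LIMSEQ_le)
  show "(\<lambda>n. norm (Gamma_series z n)) \<longlonglongrightarrow> norm (Gamma z)"
    by (intro tendsto_norm Gamma_series_LIMSEQ)
  show "Gamma_series (Re z) \<longlonglongrightarrow> Gamma (Re z)" by (rule Gamma_series_LIMSEQ)
  have "norm (Gamma_series z n) \<le> Gamma_series (Re z) n" for n
  proof -
    have "pochhammer (Re z) m \<le> norm (pochhammer z m)" for m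
      unfolding pochhammer_prod prod_norm[symmetric]
      using assms by (intro prod_mono) (auto intro: order_trans[OF _ complex_Re_le_cmod])
    moreover have "pochhammer (Re z) (n + 1) > 0" using assms by (intro pochhammer_pos)
    ultimately show ?thesis
      unfolding Gamma_series_def norm_divide norm_mult
      by (intro frac_le mult_mono) auto
  qed
  then show "\<exists>N. \<forall>n\<ge>N. norm (Gamma_series z n) \<le> Gamma_series (Re z) n" by blast
qed

text \<open>The recurrence replaces Stirling's formula: moving u to the right by N steps costs N
  factors of norm at least |Im u| and ends in a strip where Gamma is bounded by its values on a
  compact real interval.\<close>

lemma Gamma_strip_decay:
  fixes a b :: real
  shows "\<exists>C>0. \<forall>u::complex. a \<le> Re u \<longrightarrow> Re u \<le> b \<longrightarrow> \<bar>Im u\<bar> \<ge> 1/2 \<longrightarrow> norm (Gamma u) * \<bar>Im u\<bar> ^ M \<le> C"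
proof -
  \<comment> \<open>N supplies M factors and also moves the real part to at least 1. The surplus N -
    M factors are absorbed by 2 |Im u| \<ge> 1.\<close>
  define N where "N = M + nat \<lceil>1 - a\<rceil>"
  have aN: "a + real N \<ge> 1" unfolding N_def by linarith
  have "compact (Gamma ` {a + real N..b + real N})"
    using aN by (intro compact_continuous_image continuous_on_Gamma) (auto elim!: nonpos_Ints_cases)
  then have "bounded (Gamma ` {a + real N..b + real N})" by (rule compact_imp_bounded)
  then obtain B where "\<forall>x\<in>{a + real N..b + real N}. \<bar>Gamma x\<bar> \<le> B"
    unfolding bounded_iff by auto
  then have B: "\<And>x. x \<in> {a + real N..b + real N} \<Longrightarrow> \<bar>Gamma x\<bar> \<le> B" by blast
  define C where "C = 2 ^ (N - M) * \<bar>B\<bar> + 1"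
  have "norm (Gamma u) * \<bar>Im u\<bar> ^ M \<le> C" if u: "a \<le> Re u" "Re u \<le> b" "\<bar>Im u\<bar> \<ge> 1/2" for u :: complex
  proof -
    have nu: "u \<notin> \<int>\<^sub>\<le>\<^sub>0" using u(3) by (auto elim!: nonpos_Ints_cases)
    have "Gamma u \<noteq> 0" using nu by (simp add: Gamma_eq_zero_iff)
    then have poch: "pochhammer u N * Gamma u = Gamma (u + of_nat N)"
      using pochhammer_Gamma[OF nu, of N] by simp
    have le: "\<bar>Im u\<bar> ^ N \<le> norm (pochhammer u N)"
    proof -
      have "(\<Prod>i = 0..<N. \<bar>Im u\<bar>) \<le> (\<Prod>i = 0..<N. norm (u + of_nat i))"
        by (intro prod_mono) (auto intro: order_trans[OF _ abs_Im_le_cmod])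
      then show ?thesis unfolding pochhammer_prod prod_norm by simp
    qed
    have "norm (Gamma u) * \<bar>Im u\<bar> ^ N \<le> norm (Gamma u) * norm (pochhammer u N)"
      by (intro mult_left_mono le) auto
    also have "\<dots> = norm (Gamma (u + of_nat N))"
      unfolding poch[symmetric] norm_mult by simp
    also have "\<dots> \<le> Gamma (Re (u + of_nat N))" using aN u by (intro norm_Gamma_le) auto
    also have "\<dots> \<le> \<bar>B\<bar>" using B[of "Re (u + of_nat N)"] u by auto
    finally have 1: "norm (Gamma u) * \<bar>Im u\<bar> ^ N \<le> \<bar>B\<bar>" .
    have "1 \<le> (2 * \<bar>Im u\<bar>) ^ (N - M)" using u(3) by (intro one_le_power) auto
    then have "norm (Gamma u) * \<bar>Im u\<bar> ^ M * 1 \<le> norm (Gamma u) * \<bar>Im u\<bar> ^ M * (2 * \<bar>Im u\<bar>) ^ (N - M)"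
      by (intro mult_left_mono) auto
    also have "\<dots> = 2 ^ (N - M) * (norm (Gamma u) * (\<bar>Im u\<bar> ^ M * \<bar>Im u\<bar> ^ (N - M)))"
      by (simp add: power_mult_distrib)
    also have "\<bar>Im u\<bar> ^ M * \<bar>Im u\<bar> ^ (N - M) = \<bar>Im u\<bar> ^ N"
      by (simp add: N_def flip: power_add)
    also have "2 ^ (N - M) * (norm (Gamma u) * \<bar>Im u\<bar> ^ N) \<le> 2 ^ (N - M) * \<bar>B\<bar>"
      by (intro mult_left_mono 1) auto
    finally show ?thesis by (simp add: C_def)
  qed
  moreover have "C > 0" by (auto simp: C_def intro!: add_nonneg_pos)
  ultimately show ?thesis by blast
qed

lemma Gamma_three_halves_le_1: "Gamma (3/2 :: real) \<le> 1"
proof -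
  have "Gamma (1/2 + 1 :: real) = 1/2 * Gamma (1/2)" by (rule Gamma_plus1) (auto elim!: nonpos_Ints_cases)
  also have "\<dots> = sqrt pi / 2" by (simp add: Gamma_one_half_real)
  also have "sqrt pi \<le> sqrt 4" using pi_less_4 by (intro real_sqrt_le_mono) auto
  finally show ?thesis by simp
qed

text \<open>N + 2 steps lead to real part 3/2. The factors with real parts -1/2 and 1/2 multiply to
  norm 1/4 + y^2, the others to at least N!. The factorial gives decay in the position of the line,
  the quadratic factor integrability along it.\<close>

lemma norm_Gamma_vertical_le:
  fixes y :: real
  shows "norm (Gamma (1/2 - of_nat (Suc N) + \<i> * of_real y)) \<le> 1 / (fact N * (1/4 + y\<^sup>2))"
proof -
  define u where "u = (\<lambda>N. 1/2 - of_nat (Suc N) + \<i> * complex_of_real y)"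
  have poch: "norm (pochhammer (u N) (Suc (Suc N))) \<ge> fact N * (1/4 + y\<^sup>2)"
  proof (induction N)
    case 0
    have "norm (pochhammer (u 0) (Suc (Suc 0))) = norm (- of_real (1/4 + y\<^sup>2) :: complex)"
      by (intro arg_cong[where f = norm]) (simp add: u_def pochhammer_rec complex_eq_iff power2_eq_square)
    also have "\<dots> = 1/4 + y\<^sup>2" unfolding norm_minus_cancel norm_of_real by simp
    finally show ?case by simp
  next
    case (Suc N)
    have "u (Suc N) + 1 = u N" by (simp add: u_def)
    then have "pochhammer (u (Suc N)) (Suc (Suc (Suc N))) = u (Suc N) * pochhammer (u N) (Suc (Suc N))"
      by (simp add: pochhammer_rec)
    moreover have "norm (u (Suc N)) \<ge> real (Suc N)"
      using abs_Re_le_cmod[of "u (Suc N)"] by (simp add: u_def)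
    ultimately show ?case
      using mult_mono[OF _ Suc, of "real (Suc N)" "norm (u (Suc N))"] by (simp add: norm_mult mult_ac)
  qed
  have nu: "u N \<notin> \<int>\<^sub>\<le>\<^sub>0"
    by (rule half_integer_not_nonpos_Ints[where n = "Suc N"]) (simp add: u_def)
  have "Gamma (u N) \<noteq> 0" using nu by (simp add: Gamma_eq_zero_iff)
  then have "pochhammer (u N) (Suc (Suc N)) * Gamma (u N) = Gamma (u N + of_nat (Suc (Suc N)))"
    using pochhammer_Gamma[OF nu, of "Suc (Suc N)"] by simp
  then have "norm (pochhammer (u N) (Suc (Suc N))) * norm (Gamma (u N)) = norm (Gamma (u N + of_nat (Suc (Suc N))))"
    by (simp flip: norm_mult)
  also have "\<dots> \<le> Gamma (Re (u N + of_nat (Suc (Suc N))))" by (rule norm_Gamma_le) (simp add: u_def)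
  also have "Re (u N + of_nat (Suc (Suc N))) = 3/2" by (simp add: u_def)
  also have "Gamma (3/2 :: real) \<le> 1" by (rule Gamma_three_halves_le_1)
  finally have "norm (pochhammer (u N) (Suc (Suc N))) * norm (Gamma (u N)) \<le> 1" .
  moreover have "fact N * (1/4 + y\<^sup>2) * norm (Gamma (u N)) \<le> norm (pochhammer (u N) (Suc (Suc N))) * norm (Gamma (u N))"
    by (intro mult_right_mono poch) auto
  moreover have "fact N * (1/4 + y\<^sup>2) > 0" by (intro mult_pos_pos add_pos_nonneg) auto
  ultimately show ?thesis unfolding u_def by (simp add: pos_le_divide_eq mult.commute)
qed

subsection \<open>Bounds for the reciprocal of xi\<close>

abbreviation critical_zero :: "real \<Rightarrow> bool" where
  "critical_zero \<gamma> \<equiv> zeta_reg (1/2 + \<i> * of_real \<gamma>) = 0"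

lemma conj_zeta_reg_critical:
  "zeta_reg (1/2 + \<i> * of_real (- \<gamma>)) = cnj (zeta_reg (1/2 + \<i> * of_real \<gamma>))"
  by (subst zeta_reg_cnj[symmetric]) auto

lemma xi_zero_iff:
  assumes "0 < Re w" "Re w < 3" shows "xi w = 0 \<longleftrightarrow> zeta_reg w = 0"
proof -
  have "(3 - w) / 2 \<notin> \<int>\<^sub>\<le>\<^sub>0"
    using assms by (intro Re_pos_not_nonpos_Ints) auto
  then show ?thesis using assms by (simp add: xi_eq rGamma_eq_zero_iff)
qed

context mertens_bound
begin

lemma xi_mult_mertens_series:
  assumes "Re w > 1/2"
  shows "xi w * mertens_series w = - 2 * of_real pi powr (- w / 2) * rGamma ((1 - w) / 2)"
proof -
  have "xi w * mertens_series w = of_real pi powr (- w / 2) * (mertens_series w * zeta_reg w) * rGamma ((3 - w) / 2)"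
    using assms by (simp add: xi_eq mult_ac)
  also have "\<dots> = - 2 * of_real pi powr (- w / 2) * ((1 - w) / 2 * rGamma ((3 - w) / 2))"
    unfolding mertens_series_mult_zeta_reg[OF assms] by (simp add: field_simps)
  finally show ?thesis unfolding rGamma_three_halves_minus .
qed

text \<open>Here upper bounds for the Moebius series become upper bounds for 1/xi. The excluded
  points are the poles 1, 3, 5, ... of the Gamma factor.\<close>

lemma inverse_xi_eq:
  assumes "Re w > 1/2" "(1 - w) / 2 \<notin> \<int>\<^sub>\<le>\<^sub>0"
  shows "xi w \<noteq> 0" "inverse (xi w) = - (1/2) * of_real pi powr (w / 2) * Gamma ((1 - w) / 2) * mertens_series w"
proof -
  have r: "rGamma ((1 - w) / 2) * Gamma ((1 - w) / 2) = 1"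
    using assms by (simp add: Gamma_def rGamma_eq_zero_iff)
  have p: "of_real pi powr (- w / 2) * of_real pi powr (w / 2) = (1 :: complex)"
    by (simp flip: powr_add)
  have "xi w * (- (1/2) * of_real pi powr (w / 2) * Gamma ((1 - w) / 2) * mertens_series w) =
    - (1/2) * of_real pi powr (w / 2) * Gamma ((1 - w) / 2) * (xi w * mertens_series w)" by (simp add: mult_ac)
  also have "\<dots> = (of_real pi powr (- w / 2) * of_real pi powr (w / 2)) * (rGamma ((1 - w) / 2) * Gamma ((1 - w) / 2))"
    unfolding xi_mult_mertens_series[OF assms(1)] by simp
  also have "\<dots> = 1" unfolding r p by simp
  finally have 1: "xi w * (- (1/2) * of_real pi powr (w / 2) * Gamma ((1 - w) / 2) * mertens_series w) = 1" .
  show "xi w \<noteq> 0" using 1 by auto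
  show "inverse (xi w) = - (1/2) * of_real pi powr (w / 2) * Gamma ((1 - w) / 2) * mertens_series w"
    using 1 by (rule inverse_unique)
qed

text \<open>To the right of the line there are no zeros; a zero to the left is reflected to the
  right through the symmetry of \<open>xi\<close>, whose other factors do not vanish in the
  strip.\<close>

lemma zeta_reg_zero_critical:
  assumes "0 < Re w" "Re w < 1" "zeta_reg w = 0" shows "Re w = 1/2"
proof (rule ccontr)
  assume "Re w \<noteq> 1/2"
  then consider "Re w > 1/2" | "Re (1 - w) > 1/2" by force
  then show False
  proof cases
    case 1
    then show False using zeta_reg_nonzero assms by auto
  next
    case 2
    have "xi (1 - w) = 0" using assms by (simp add: xi_symmetric xi_zero_iff)
    then have "zeta_reg (1 - w) = 0" using assms by (subst (asm) xi_zero_iff) auto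
    then show False using zeta_reg_nonzero[OF 2] by simp
  qed
qed

text \<open>M is arbitrary because Gamma decays faster than any power. The decay is invoked with
  exponent M + 1: the extra power absorbs the linear growth of the Moebius series. The left half
  follows by symmetry.\<close>

lemma inverse_xi_strip_bound:
  fixes R :: real
  assumes R: "R \<ge> 1"
  shows "\<exists>C>0. \<forall>w. \<bar>Re w - 1/2\<bar> \<le> R \<longrightarrow> Re w \<noteq> 1/2 \<longrightarrow> \<bar>Im w\<bar> \<ge> 1 \<longrightarrow>
    xi w \<noteq> 0 \<and> norm (inverse (xi w)) * \<bar>Im w\<bar> ^ M \<le> C / \<bar>Re w - 1/2\<bar>"
proof -
  obtain C1 where C1: "C1 > 0" "\<And>u::complex. 1/4 - R / 2 \<le> Re u \<Longrightarrow> Re u \<le> 1/4 \<Longrightarrow> \<bar>Im u\<bar> \<ge> 1/2 \<Longrightarrow> norm (Gamma u) * \<bar>Im u\<bar> ^ (M + 1) \<le> C1"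
    using Gamma_strip_decay[of "1/4 - R / 2" "1/4" "M + 1"] by blast
  define C where "C = pi powr ((R + 1/2) / 2) * (2 ^ (M + 1) * C1) * (K * (R + 2) * (R + 1))"
  have C: "C > 0" unfolding C_def using C1(1) K_pos R by (intro mult_pos_pos) auto
  have right: "xi w \<noteq> 0 \<and> norm (inverse (xi w)) * \<bar>Im w\<bar> ^ M \<le> C / (Re w - 1/2)"
    if w: "Re w > 1/2" "Re w - 1/2 \<le> R" "\<bar>Im w\<bar> \<ge> 1" for w
  proof -
    define d where "d = Re w - 1/2"
    define y where "y = \<bar>Im w\<bar>"
    have d: "0 < d" "d \<le> R" and y: "y \<ge> 1" using w by (auto simp: d_def y_def)
    define u where "u = (1 - w) / 2"
    have u: "1/4 - R / 2 \<le> Re u" "Re u \<le> 1/4" "\<bar>Im u\<bar> = y / 2"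
      using w by (auto simp: u_def y_def field_simps)
    have nu: "u \<notin> \<int>\<^sub>\<le>\<^sub>0" using u(3) y by (auto elim!: nonpos_Ints_cases)
    have "norm (Gamma u) * (y / 2) ^ (M + 1) \<le> C1" using C1(2)[of u] u y by simp
    then have G: "norm (Gamma u) * y ^ (M + 1) \<le> 2 ^ (M + 1) * C1" by (simp add: power_divide field_simps)
    have p: "norm (of_real pi powr (w / 2) :: complex) \<le> pi powr ((R + 1/2) / 2)"
      using w pi_gt3 by (subst norm_powr_real_powr) (auto intro!: powr_mono)
    have "norm w \<le> Re w + y" using cmod_le[of w] w by (simp add: y_def)
    also have "\<dots> \<le> (R + 2) * y"
    proof -
      have "Re w \<le> (R + 1) * 1" using w by simp
      also have "\<dots> \<le> (R + 1) * y" using y R by (intro mult_left_mono) auto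
      finally show ?thesis by (simp add: algebra_simps)
    qed
    finally have nw: "norm w \<le> (R + 2) * y" .
    have "1 + 1 / d \<le> (R + 1) / d" using d by (simp add: field_simps)
    then have "K * norm w * (1 + 1 / d) \<le> K * ((R + 2) * y) * ((R + 1) / d)"
      using nw K_pos d R y by (intro mult_mono mult_nonneg_nonneg) auto
    then have g: "norm (mertens_series w) \<le> K * ((R + 2) * y) * ((R + 1) / d)"
      using norm_mertens_series_le[OF w(1)] by (simp add: d_def)
    have "norm (inverse (xi w)) * y ^ M = (1/2) * (norm (of_real pi powr (w / 2) :: complex) * (norm (Gamma u) * norm (mertens_series w) * y ^ M))"
      using inverse_xi_eq(2)[OF w(1)] nu unfolding u_def by (simp add: norm_mult)
    also have "\<dots> \<le> 1 * (pi powr ((R + 1/2) / 2) * (norm (Gamma u) * (K * ((R + 2) * y) * ((R + 1) / d)) * y ^ M))"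
      using p g y d R K_pos by (intro mult_mono) auto
    also have "\<dots> = pi powr ((R + 1/2) / 2) * (norm (Gamma u) * y ^ (M + 1)) * (K * (R + 2) * (R + 1)) / d"
      by simp
    also have "\<dots> \<le> pi powr ((R + 1/2) / 2) * (2 ^ (M + 1) * C1) * (K * (R + 2) * (R + 1)) / d"
      using d R K_pos by (intro divide_right_mono mult_right_mono mult_left_mono G) auto
    finally show ?thesis using inverse_xi_eq(1)[OF w(1)] nu unfolding u_def C_def y_def d_def by simp
  qed
  have "xi w \<noteq> 0 \<and> norm (inverse (xi w)) * \<bar>Im w\<bar> ^ M \<le> C / \<bar>Re w - 1/2\<bar>"
    if "\<bar>Re w - 1/2\<bar> \<le> R" "Re w \<noteq> 1/2" "\<bar>Im w\<bar> \<ge> 1" for w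
  proof (cases "Re w > 1/2")
    case True
    then show ?thesis using right[of w] that by auto
  next
    case False
    then show ?thesis using right[of "1 - w"] that by (auto simp: xi_symmetric abs_if)
  qed
  then show ?thesis using C by blast
qed

text \<open>Expand \<open>zeta_reg\<close> at one zero and evaluate at another at distance h: the
  linear term has norm at least h / K, and it must be matched by the second-order error, which is at
  most h^2 times a polynomial in the height. So h cannot be small.\<close>

lemma zero_separation:
  "\<exists>c>0. c \<le> 1/8 \<and> (\<forall>\<gamma> \<gamma>'. critical_zero \<gamma> \<longrightarrow> critical_zero \<gamma>' \<longrightarrow> \<gamma> \<noteq> \<gamma>' \<longrightarrow>
     \<bar>\<gamma> - \<gamma>'\<bar> \<ge> c / (1 + \<bar>\<gamma>\<bar>)\<^sup>2)"
proof -
  \<comment> \<open>896 is 2! * 7 * 8^2: Cauchy's estimate on discs of radius 1/8 for the second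
    derivative, where \<open>zeta_reg\<close> is below 7 (1 + |\<gamma>|)^2. The 1/8 keeps the
    second zero inside the disc of the expansion.\<close>
  define c where "c = min (1/8) (1 / (896 * K))"
  have c: "c > 0" "c \<le> 1/8" "c \<le> 1 / (896 * K)" using K_pos by (auto simp: c_def)
  have "\<bar>\<gamma> - \<gamma>'\<bar> \<ge> c / (1 + \<bar>\<gamma>\<bar>)\<^sup>2"
    if z: "critical_zero \<gamma>" "critical_zero \<gamma>'" "\<gamma> \<noteq> \<gamma>'" for \<gamma> \<gamma>' :: real
  proof (rule ccontr)
    assume neg: "\<not> \<bar>\<gamma> - \<gamma>'\<bar> \<ge> c / (1 + \<bar>\<gamma>\<bar>)\<^sup>2"
    define \<rho> \<rho>' where "\<rho> = 1/2 + \<i> * complex_of_real \<gamma>" and "\<rho>' = 1/2 + \<i> * complex_of_real \<gamma>'"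
    define g1 where "g1 = 1 + \<bar>\<gamma>\<bar>"
    have g1: "g1 \<ge> 1" by (simp add: g1_def)
    define h where "h = norm (\<rho>' - \<rho>)"
    have "\<rho>' - \<rho> = \<i> * of_real (\<gamma>' - \<gamma>)" by (simp add: \<rho>_def \<rho>'_def algebra_simps)
    then have h_eq: "h = \<bar>\<gamma> - \<gamma>'\<bar>" by (simp add: h_def norm_mult abs_minus_commute flip: of_real_diff)
    have h: "h > 0" "h < c / g1\<^sup>2" using z(3) neg by (auto simp: h_eq g1_def)
    have "c / g1\<^sup>2 \<le> c" using c g1 by (simp add: divide_le_eq)
    then have h8: "h \<le> 1/8" using h c by simp
    have bound: "norm (zeta_reg z) < 7 * g1\<^sup>2" if "norm (z - \<rho>) \<le> 1/4" for z
    proof -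
      have n\<rho>: "norm \<rho> \<le> 1/2 + \<bar>\<gamma>\<bar>" "norm (1 - \<rho>) \<le> 1/2 + \<bar>\<gamma>\<bar>"
        using cmod_le[of \<rho>] cmod_le[of "1 - \<rho>"] by (auto simp: \<rho>_def)
      have re: "Re z \<ge> 1/4" using that abs_Re_le_cmod[of "z - \<rho>"] by (auto simp: \<rho>_def)
      have nz: "norm z \<le> g1" "norm (1 - z) \<le> g1"
        using that n\<rho> norm_triangle_ineq[of \<rho> "z - \<rho>"] norm_triangle_ineq4[of "1 - \<rho>" "z - \<rho>"] by (auto simp: g1_def)
      have "norm (zeta_reg z) \<le> 1 + norm (1 - z) * norm z * (1 + 1 / Re z)"
        using re by (intro norm_zeta_reg_le) auto
      also have "\<dots> \<le> 1 + g1 * g1 * (1 + 4)"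
        using re nz g1 by (intro add_left_mono mult_mono mult_nonneg_nonneg) (auto simp: divide_le_eq)
      also have "\<dots> < 7 * g1\<^sup>2" using g1 mult_mono[of 1 g1 1 g1] by (simp add: power2_eq_square)
      finally show ?thesis .
    qed
    have sub: "cball \<rho> (1/8) \<subseteq> {s. Re s > 0}"
    proof
      fix z assume "z \<in> cball \<rho> (1/8)"
      then have "norm (z - \<rho>) \<le> 1/8" by (simp add: dist_norm norm_minus_commute)
      then show "z \<in> {s. Re s > 0}" using abs_Re_le_cmod[of "z - \<rho>"] by (auto simp: \<rho>_def)
    qed
    have "norm ((deriv ^^ 0) zeta_reg \<rho>' - (\<Sum>i\<le>1. (deriv ^^ i) zeta_reg \<rho> * (\<rho>' - \<rho>) ^ i / fact i)) \<le> 896 * g1\<^sup>2 * norm (\<rho>' - \<rho>) ^ Suc 1 / fact 1"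
    proof (rule complex_Taylor[where S = "cball \<rho> (1/8)"])
      show "((deriv ^^ i) zeta_reg has_field_derivative (deriv ^^ Suc i) zeta_reg x) (at x within cball \<rho> (1/8))" if "x \<in> cball \<rho> (1/8)" for i x
      proof -
        have "(deriv ^^ i) zeta_reg holomorphic_on {s. Re s > 0}"
          by (intro holomorphic_higher_deriv zeta_reg_holomorphic open_halfspace_Re_gt)
        from holomorphic_derivI[OF this open_halfspace_Re_gt] show ?thesis using that sub by auto
      qed
      show "cmod ((deriv ^^ Suc 1) zeta_reg x) \<le> 896 * g1\<^sup>2" if x: "x \<in> cball \<rho> (1/8)" for x
      proof -
        have xr: "norm (w - \<rho>) \<le> 1/4" if "w \<in> cball x (1/8)" for w
        proof -
          have "dist \<rho> w \<le> dist \<rho> x + dist x w" by (rule dist_triangle)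
          then show ?thesis using x that by (simp add: dist_norm norm_minus_commute)
        qed
        have sub2: "cball x (1/8) \<subseteq> {s. Re s > 0}"
        proof
          fix w assume "w \<in> cball x (1/8)"
          then show "w \<in> {s. Re s > 0}" using xr[of w] abs_Re_le_cmod[of "w - \<rho>"] by (auto simp: \<rho>_def)
        qed
        have "cmod ((deriv ^^ 2) zeta_reg x) \<le> fact 2 * (7 * g1\<^sup>2) / (1/8) ^ 2"
        proof (rule Cauchy_higher_deriv_bound[where y = 0])
          show "zeta_reg holomorphic_on ball x (1/8)"
            by (rule holomorphic_on_subset[OF zeta_reg_holomorphic order_trans[OF ball_subset_cball sub2]])
          show "continuous_on (cball x (1/8)) zeta_reg"
            by (rule holomorphic_on_imp_continuous_on, rule holomorphic_on_subset[OF zeta_reg_holomorphic]) (use sub2 in auto)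
          show "zeta_reg w \<in> ball 0 (7 * g1\<^sup>2)" if "w \<in> ball x (1/8)" for w
            using bound[OF xr[of w]] that by simp
        qed auto
        then show ?thesis by (simp add: numeral_2_eq_2 power2_eq_square)
      qed
    qed (use h8 in \<open>auto simp: h_def dist_norm norm_minus_commute\<close>)
    then have "norm (deriv zeta_reg \<rho> * (\<rho>' - \<rho>)) \<le> 896 * g1\<^sup>2 * (h * h)"
      using z(1,2) by (simp add: h_def \<rho>_def[symmetric] \<rho>'_def[symmetric] norm_minus_commute)
    then have "norm (deriv zeta_reg \<rho>) * h \<le> (896 * g1\<^sup>2 * h) * h"
      by (simp add: norm_mult h_def)
    then have "norm (deriv zeta_reg \<rho>) \<le> 896 * g1\<^sup>2 * h" using h(1) by (rule mult_right_le_imp_le)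
    moreover have "1 / K \<le> norm (deriv zeta_reg \<rho>)"
      using z(1) by (intro norm_deriv_zeta_reg_ge) (auto simp: \<rho>_def)
    moreover have "896 * g1\<^sup>2 * h < 896 * c" using h(2) g1 by (simp add: pos_less_divide_eq mult.commute)
    moreover have "896 * c \<le> 1 / K" using c(3) K_pos by (simp add: field_simps)
    ultimately show False by linarith
  qed
  then show ?thesis using c by blast
qed

text \<open>Near n the zeros are at least d apart, where d is a multiple of 1/n^2, since 1 +
  |\<gamma>| \<le> 4 n there. Either n itself is at distance d/4 from all zeros, or some zero lies
  within d/4 of n, and the point d/2 above that zero is far from it and from all others.\<close>

lemma good_heights:
  "\<exists>c>0. \<forall>n::nat. n \<ge> 2 \<longrightarrow> (\<exists>T. real n \<le> T \<and> T \<le> real n + 1 \<and>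
     (\<forall>\<gamma>. critical_zero \<gamma> \<longrightarrow> \<bar>\<bar>\<gamma>\<bar> - T\<bar> \<ge> c / real n ^ 2))"
proof -
  obtain c where c: "c > 0" "c \<le> 1/8" "\<And>\<gamma> \<gamma>'. critical_zero \<gamma> \<Longrightarrow> critical_zero \<gamma>' \<Longrightarrow> \<gamma> \<noteq> \<gamma>' \<Longrightarrow>
     \<bar>\<gamma> - \<gamma>'\<bar> \<ge> c / (1 + \<bar>\<gamma>\<bar>)\<^sup>2"
    using zero_separation by blast
  have "\<exists>T. real n \<le> T \<and> T \<le> real n + 1 \<and>
     (\<forall>\<gamma>. critical_zero \<gamma> \<longrightarrow> \<bar>\<bar>\<gamma>\<bar> - T\<bar> \<ge> (c / 64) / real n ^ 2)" if n: "n \<ge> 2" for n :: nat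
  proof -
    define d where "d = c / (16 * real n ^ 2)"
    have n2: "real n \<ge> 2" using n by simp
    have "1 \<le> 16 * real n ^ 2" using n2 one_le_power[of "real n" 2] by linarith
    then have d: "d > 0" "d \<le> c" unfolding d_def using c(1) n2 by (auto simp: divide_le_eq mult_le_cancel_left1)
    have d4: "d / 4 = (c / 64) / real n ^ 2" by (simp add: d_def)
    have sep: "\<bar>\<gamma> - \<gamma>'\<bar> \<ge> d"
      if "critical_zero \<gamma>" "critical_zero \<gamma>'" "\<gamma> \<noteq> \<gamma>'" "\<bar>\<gamma> - real n\<bar> < 1" for \<gamma> \<gamma>'
    proof -
      have "(1 + \<bar>\<gamma>\<bar>)\<^sup>2 \<le> (4 * real n)\<^sup>2" using that(4) n2 by (intro power_mono) auto
      also have "\<dots> = 16 * real n ^ 2" by (simp add: power_mult_distrib)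
      finally have "d \<le> c / (1 + \<bar>\<gamma>\<bar>)\<^sup>2" unfolding d_def using c(1) n by (intro divide_left_mono mult_pos_pos) auto
      then show ?thesis using c(3)[OF that(1,2,3)] by linarith
    qed
    have sym: "critical_zero \<bar>\<gamma>\<bar>" if "critical_zero \<gamma>" for \<gamma>
      using that conj_zeta_reg_critical[of \<gamma>] by (simp add: abs_if)
    show ?thesis
    proof (cases "\<exists>\<gamma>. critical_zero \<gamma> \<and> \<bar>\<gamma> - real n\<bar> < d / 4")
      case True
      then obtain \<gamma>0 where g0: "critical_zero \<gamma>0" "\<bar>\<gamma>0 - real n\<bar> < d / 4" by blast
      show ?thesis
      proof (intro exI[of _ "\<gamma>0 + d / 2"] conjI allI impI)
        fix \<gamma> assume g: "critical_zero \<gamma>"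
        show "c / 64 / real n ^ 2 \<le> \<bar>\<bar>\<gamma>\<bar> - (\<gamma>0 + d / 2)\<bar>"
        proof (rule ccontr)
          assume "\<not> ?thesis"
          then have lt: "\<bar>\<bar>\<gamma>\<bar> - (\<gamma>0 + d / 2)\<bar> < d / 4" by (simp add: d4)
          define x where "x = \<bar>\<gamma>\<bar>"
          have "x \<noteq> \<gamma>0" "\<bar>\<gamma>0 - x\<bar> < d" using lt d(1) unfolding x_def[symmetric] by linarith+
          then have "\<bar>\<gamma>\<bar> \<noteq> \<gamma>0" "\<bar>\<gamma>0 - \<bar>\<gamma>\<bar>\<bar> < d" by (simp_all add: x_def)
          moreover have "\<bar>\<gamma>0 - real n\<bar> < 1" using g0(2) d c by linarith
          ultimately show False using sep[OF g0(1) sym[OF g]] by auto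
        qed
      next
        show "real n \<le> \<gamma>0 + d / 2" "\<gamma>0 + d / 2 \<le> real n + 1" using g0(2) d c(2) by linarith+
      qed
    next
      case False
      then show ?thesis using sym by (intro exI[of _ "real n"]) (auto simp: d4 not_less)
    qed
  qed
  then show ?thesis using c(1) by (intro exI[of _ "c / 64"]) auto
qed

text \<open>The factor \<open>1 + ((z - z0) / r)\<^sup>2\<close> vanishes where the circle meets the critical line, which
  compensates the blow-up of the bound for \<open>inverse xi\<close> there.\<close>

lemma inverse_xi_disc_bound:
  assumes r: "0 < r" "r \<le> 1/2" and B: "B \<ge> 0" and z0: "Re z0 = 1/2"
    and nz: "\<And>z. z \<in> cball z0 r \<Longrightarrow> xi z \<noteq> 0"
    and bd: "\<And>z. norm (z - z0) = r \<Longrightarrow> Re z \<noteq> 1/2 \<Longrightarrow> norm (inverse (xi z)) \<le> B / \<bar>Re z - 1/2\<bar>"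
    and w: "Im w = Im z0" "\<bar>Re w - 1/2\<bar> \<le> r"
  shows "norm (inverse (xi w)) \<le> 2 * B / r"
proof -
  define g where "g = (\<lambda>z. inverse (xi z) * (1 + ((z - z0) / of_real r)\<^sup>2))"
  have hol: "g holomorphic_on cball z0 r"
    unfolding g_def using nz r by (intro holomorphic_intros xi_holomorphic) auto
  have wz: "w - z0 = of_real (Re w - 1/2)" using w z0 by (simp add: complex_eq_iff)
  have "norm (g w) \<le> 2 * B / r"
  proof (rule maximum_modulus_frontier[where S = "cball z0 r" and f = g])
    show "g holomorphic_on interior (cball z0 r)" by (rule holomorphic_on_subset[OF hol]) (rule interior_subset)
    show "continuous_on (closure (cball z0 r)) g" using holomorphic_on_imp_continuous_on[OF hol] by simp
    show "w \<in> cball z0 r" using w unfolding mem_cball dist_norm by (subst norm_minus_commute) (simp add: wz del: of_real_diff)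
    fix z assume "z \<in> frontier (cball z0 r)"
    then have z: "norm (z - z0) = r" using r by (simp add: dist_norm norm_minus_commute)
    define x y where "x = Re (z - z0)" and "y = Im (z - z0)"
    have zxy: "z - z0 = Complex x y" by (simp add: complex_eq_iff x_def y_def)
    have xr: "Re z - 1/2 = x" using z0 by (simp add: x_def)
    have "x\<^sup>2 + y\<^sup>2 = r\<^sup>2" using z unfolding zxy by (metis cmod_power2 complex.sel)
    \<comment> \<open>On the circle r^2 is the product of z - z0 with its conjugate; adding the
      square of z - z0 leaves z - z0 times twice its real part.\<close>
    then have e: "(of_real r)\<^sup>2 + (z - z0)\<^sup>2 = of_real (2 * x) * (z - z0)"
      unfolding zxy by (simp add: complex_eq_iff power2_eq_square algebra_simps)
    have "1 + ((z - z0) / of_real r)\<^sup>2 = ((of_real r)\<^sup>2 + (z - z0)\<^sup>2) / (of_real r)\<^sup>2"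
      using r by (simp add: power_divide add_divide_distrib)
    then have "norm (1 + ((z - z0) / of_real r)\<^sup>2) = 2 * \<bar>x\<bar> * r / r\<^sup>2"
      unfolding e by (simp add: norm_mult norm_divide norm_power z)
    then have n1: "norm (1 + ((z - z0) / of_real r)\<^sup>2) = 2 * \<bar>x\<bar> / r" using r by (simp add: power2_eq_square)
    show "norm (g z) \<le> 2 * B / r"
    proof (cases "x = 0")
      case True
      then show ?thesis using n1 B r by (simp add: g_def norm_mult)
    next
      case False
      have "norm (g z) \<le> (B / \<bar>x\<bar>) * (2 * \<bar>x\<bar> / r)"
        unfolding g_def norm_mult n1 using bd[OF z] False xr r by (intro mult_right_mono) auto
      then show ?thesis using False by (simp add: mult.commute)
    qed
  qed auto
  moreover have "norm (g w) = norm (inverse (xi w)) * (1 + ((Re w - 1/2) / r)\<^sup>2)"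
  proof -
    have "1 + ((w - z0) / of_real r)\<^sup>2 = of_real (1 + ((Re w - 1/2) / r)\<^sup>2)" unfolding wz by simp
    then show ?thesis unfolding g_def norm_mult by (simp only: norm_of_real) simp
  qed
  moreover have "norm (inverse (xi w)) * 1 \<le> norm (inverse (xi w)) * (1 + ((Re w - 1/2) / r)\<^sup>2)"
    by (intro mult_left_mono) auto
  ultimately show ?thesis by linarith
qed

abbreviation good_height :: "real \<Rightarrow> real \<Rightarrow> nat \<Rightarrow> real \<Rightarrow> real \<Rightarrow> bool" where
  "good_height R D n T r \<equiv> real n \<le> T \<and> T \<le> real n + 1 \<and> r > 0 \<and>
     (\<forall>\<gamma>. critical_zero \<gamma> \<longrightarrow> \<bar>\<bar>\<gamma>\<bar> - T\<bar> \<ge> r) \<and>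
     (\<forall>w. \<bar>Re w - 1/2\<bar> \<le> R \<longrightarrow> \<bar>Im w\<bar> = T \<longrightarrow> norm (inverse (xi w)) \<le> D / real n)"

text \<open>The zero-free discs have radius of order 1/n^2, so the disc bound loses a factor n^2.
  The strip bound is used with exponent 3, which leaves 1/n. Points further than r from the critical
  line need no disc.\<close>

lemma inverse_xi_horizontal_bound:
  fixes R :: real
  assumes R: "R \<ge> 1"
  shows "\<exists>D>0. \<forall>n::nat. n \<ge> 2 \<longrightarrow> (\<exists>T r. good_height R D n T r)"
proof -
  obtain c where c: "c > 0" "\<And>n::nat. n \<ge> 2 \<Longrightarrow> (\<exists>T. real n \<le> T \<and> T \<le> real n + 1 \<and>
     (\<forall>\<gamma>. critical_zero \<gamma> \<longrightarrow> \<bar>\<bar>\<gamma>\<bar> - T\<bar> \<ge> c / real n ^ 2))"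
    using good_heights by blast
  obtain C where C: "C > 0" "\<And>w. \<bar>Re w - 1/2\<bar> \<le> R \<Longrightarrow> Re w \<noteq> 1/2 \<Longrightarrow> \<bar>Im w\<bar> \<ge> 1 \<Longrightarrow>
    xi w \<noteq> 0 \<and> norm (inverse (xi w)) * \<bar>Im w\<bar> ^ 3 \<le> C / \<bar>Re w - 1/2\<bar>"
    using inverse_xi_strip_bound[OF R, of 3] by blast
  \<comment> \<open>Strictly below c, so that the closed disc contains no zero, and at most 1/2, as
    the disc bound requires.\<close>
  define c' where "c' = min c 1 / 2"
  have c': "c' > 0" "c' < c" "c' \<le> 1/2" using c(1) by (auto simp: c'_def min_def)
  \<comment> \<open>The disc bound contributes 2; the points of the disc have height at least n/2,
    whose cube contributes 8.\<close>
  define D where "D = 16 * C / c'"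
  have D: "D > 0" using C(1) c' by (simp add: D_def)
  have "\<exists>T r. good_height R D n T r" if n: "n \<ge> 2" for n :: nat
  proof -
    obtain T where T: "real n \<le> T" "T \<le> real n + 1" "\<And>\<gamma>. critical_zero \<gamma> \<Longrightarrow> \<bar>\<bar>\<gamma>\<bar> - T\<bar> \<ge> c / real n ^ 2"
      using c(2)[OF n] by blast
    define r where "r = c' / real n ^ 2"
    have n2: "real n \<ge> 2" using n by simp
    have npow: "real n ^ 2 \<ge> 1" using n2 by (intro one_le_power) auto
    have r: "r > 0" "r \<le> 1/2" "r < c / real n ^ 2" "r \<le> R"
    proof -
      show "r > 0" using c' n by (simp add: r_def)
      have "r \<le> c' / 1" unfolding r_def using c' npow n by (intro divide_left_mono) auto
      then show "r \<le> 1/2" "r \<le> R" using c' R by auto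
      show "r < c / real n ^ 2" unfolding r_def using c' n by (intro divide_strict_right_mono) auto
    qed
    define B where "B = 8 * C / real n ^ 3"
    have B: "B \<ge> 0" using C(1) by (simp add: B_def)
    have bd: "norm (inverse (xi z)) \<le> B / \<bar>Re z - 1/2\<bar>" if z: "\<bar>Re z - 1/2\<bar> \<le> R" "Re z \<noteq> 1/2" "\<bar>Im z\<bar> \<ge> real n / 2" for z
    proof -
      have "(real n / 2) ^ 3 \<le> \<bar>Im z\<bar> ^ 3" using z(3) by (intro power_mono) auto
      then have "norm (inverse (xi z)) * (real n / 2) ^ 3 \<le> norm (inverse (xi z)) * \<bar>Im z\<bar> ^ 3"
        by (intro mult_left_mono) auto
      also have "\<dots> \<le> C / \<bar>Re z - 1/2\<bar>" using C(2)[of z] z n2 by auto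
      finally have "norm (inverse (xi z)) \<le> C / \<bar>Re z - 1/2\<bar> / (real n / 2) ^ 3"
        using n2 by (subst pos_le_divide_eq) auto
      then show ?thesis by (simp add: B_def power_divide mult.commute)
    qed
    have hor: "norm (inverse (xi w)) \<le> D / real n" if w: "\<bar>Re w - 1/2\<bar> \<le> R" "\<bar>Im w\<bar> = T" for w
    proof -
      have "norm (inverse (xi w)) \<le> 2 * B / r"
      proof (cases "\<bar>Re w - 1/2\<bar> \<le> r")
        case True
        define z0 where "z0 = Complex (1/2) (Im w)"
        have imz: "\<bar>Im z\<bar> \<ge> real n / 2" if "norm (z - z0) \<le> r" for z
        proof -
          have "\<bar>Im z - Im w\<bar> \<le> r" using that abs_Im_le_cmod[of "z - z0"] by (simp add: z0_def)
          then show ?thesis using r(2) w(2) T(1) n2 by linarith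
        qed
        have rez: "\<bar>Re z - 1/2\<bar> \<le> r" if "norm (z - z0) \<le> r" for z
          using that abs_Re_le_cmod[of "z - z0"] by (simp add: z0_def)
        show ?thesis
        proof (rule inverse_xi_disc_bound[where ?z0.0 = z0, OF r(1,2) B])
          show "xi z \<noteq> 0" if "z \<in> cball z0 r" for z
          proof
            assume xz: "xi z = 0"
            have zr: "norm (z - z0) \<le> r" using that by (simp add: dist_norm norm_minus_commute)
            have "Re z = 1/2" using C(2)[of z] xz rez[OF zr] r(4) imz[OF zr] n2 by force
            then have ze: "z = 1/2 + \<i> * of_real (Im z)" by (simp add: complex_eq_iff)
            have "zeta_reg z = 0" using xz \<open>Re z = 1/2\<close> by (subst (asm) xi_zero_iff) auto
            then have "\<bar>\<bar>Im z\<bar> - T\<bar> \<ge> c / real n ^ 2" using T(3)[of "Im z"] ze by simp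
            moreover have "\<bar>Im z - Im w\<bar> \<le> r" using zr abs_Im_le_cmod[of "z - z0"] by (simp add: z0_def)
            ultimately show False using w(2) r(3) by linarith
          qed
          show "norm (inverse (xi z)) \<le> B / \<bar>Re z - 1/2\<bar>" if "norm (z - z0) = r" "Re z \<noteq> 1/2" for z
            using that rez[of z] imz[of z] r(4) by (intro bd) auto
        qed (use True in \<open>auto simp: z0_def\<close>)
      next
        case False
        then have "norm (inverse (xi w)) \<le> B / \<bar>Re w - 1/2\<bar>" using w T(1) n2 r(1) by (intro bd) auto
        also have "\<dots> \<le> B / r" using False B r(1) by (intro divide_left_mono mult_pos_pos) auto
        also have "\<dots> \<le> 2 * B / r" using B r(1) by (intro divide_right_mono) auto
        finally show ?thesis .
      qed
      also have "2 * B / r = D / real n"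
        using n2 c' by (simp add: B_def r_def D_def power2_eq_square power3_eq_cube)
      finally show ?thesis .
    qed
    show ?thesis
    proof (rule exI[of _ T], rule exI[of _ r], intro conjI allI impI)
      fix \<gamma> assume "critical_zero \<gamma>"
      then show "r \<le> \<bar>\<bar>\<gamma>\<bar> - T\<bar>" using T(3)[of \<gamma>] r(3) by linarith
    qed (use T r hor in auto)
  qed
  then show ?thesis using D by blast
qed

end

subsection \<open>Zeros and the coefficients\<close>

lemma has_field_derivative_xi: "(xi has_field_derivative deriv xi w) (at w)"
  using holomorphic_derivI[OF xi_holomorphic[of UNIV] open_UNIV] by simp

lemma deriv_xi_cnj: "deriv xi (cnj w) = cnj (deriv xi w)"
proof -
  have "((cnj \<circ> xi \<circ> cnj) has_field_derivative cnj (deriv xi w)) (at (cnj w))"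
    using has_field_derivative_cnj_cnj[of xi "deriv xi w" "cnj w"] has_field_derivative_xi[of w] by simp
  also have "cnj \<circ> xi \<circ> cnj = xi" by (auto simp: xi_cnj)
  finally show ?thesis by (rule DERIV_imp_deriv)
qed

lemma deriv_xi_reflect: "deriv xi (1 - w) = - deriv xi w"
proof -
  have "((\<lambda>w. xi (1 - w)) has_field_derivative deriv xi (1 - w) * (-1)) (at w)"
    by (rule DERIV_chain2[where f = xi and g = "\<lambda>w. 1 - w", OF has_field_derivative_xi])
      (auto intro!: derivative_eq_intros)
  then have "(xi has_field_derivative - deriv xi (1 - w)) (at w)" by (simp add: xi_symmetric)
  from DERIV_unique[OF this has_field_derivative_xi] show ?thesis by (metis minus_minus)
qed

text \<open>At a zero of either factor the derivative of the power of pi drops out of the product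
  rule. The derivative r of the reciprocal Gamma function is a parameter because it takes different
  forms at the poles of Gamma and elsewhere.\<close>

lemma deriv_xi_right:
  assumes w: "Re w > 0" and r: "(rGamma has_field_derivative r) (at ((3 - w) / 2))"
    and z: "zeta_reg w = 0 \<or> rGamma ((3 - w) / 2) = 0"
  shows "deriv xi w = of_real pi powr (- w / 2) * (deriv zeta_reg w * rGamma ((3 - w) / 2) - zeta_reg w * r / 2)"
proof -
  have dz: "(zeta_reg has_field_derivative deriv zeta_reg w) (at w)"
    by (rule holomorphic_derivI[OF zeta_reg_holomorphic open_halfspace_Re_gt]) (use w in auto)
  have dr: "((\<lambda>w. rGamma ((3 - w) / 2)) has_field_derivative r * (-1/2)) (at w)"
    by (rule DERIV_chain2[where f = rGamma and g = "\<lambda>w. (3 - w) / 2", OF r]) (auto intro!: derivative_eq_intros)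
  define p where "p = (\<lambda>w. complex_of_real pi powr (- w / 2))"
  have "p holomorphic_on UNIV" unfolding p_def by (intro holomorphic_intros) auto
  then have dp: "(p has_field_derivative deriv p w) (at w)"
    by (rule holomorphic_derivI) auto
  have "((\<lambda>w. p w * zeta_reg w * rGamma ((3 - w) / 2)) has_field_derivative
     p w * (deriv zeta_reg w * rGamma ((3 - w) / 2) - zeta_reg w * r / 2)) (at w)"
    by (rule DERIV_cong[OF DERIV_mult[OF DERIV_mult[OF dp dz] dr]]) (use z in \<open>auto simp: algebra_simps\<close>)
  then have "((\<lambda>w. p w * zeta_reg w * rGamma ((3 - w) / 2)) has_field_derivative
     of_real pi powr (- w / 2) * (deriv zeta_reg w * rGamma ((3 - w) / 2) - zeta_reg w * r / 2)) (at w)"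
    by (simp only: p_def)
  then have "(xi has_field_derivative
     of_real pi powr (- w / 2) * (deriv zeta_reg w * rGamma ((3 - w) / 2) - zeta_reg w * r / 2)) (at w)"
    by (rule has_field_derivative_transform_within_open[OF _ open_halfspace_Re_gt[of 0]]) (use w in \<open>auto simp: xi_eq p_def\<close>)
  then show ?thesis by (rule DERIV_imp_deriv)
qed

lemma norm_of_real_powr: "x > 0 \<Longrightarrow> norm (complex_of_real x powr w) = x powr Re w"
  by (subst norm_powr_real_powr) auto

context mertens_bound
begin

lemma deriv_zeta_reg_nonzero:
  assumes "critical_zero \<gamma>" shows "deriv zeta_reg (1/2 + \<i> * of_real \<gamma>) \<noteq> 0"
proof -
  have "norm (deriv zeta_reg (1/2 + \<i> * of_real \<gamma>)) \<ge> 1 / K"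
    by (rule norm_deriv_zeta_reg_ge) (use assms in auto)
  moreover have "1 / K > 0" using K_pos by simp
  ultimately show ?thesis by auto
qed

lemma positive_ordinates_eq: "positive_ordinates = {\<gamma>. \<gamma> > 0 \<and> critical_zero \<gamma>}"
proof (intro equalityI subsetI)
  fix \<gamma> assume "\<gamma> \<in> positive_ordinates"
  then obtain \<rho> where \<rho>: "\<gamma> > 0" "0 < Re \<rho>" "Re \<rho> < 1" "zeta \<rho> = 0" "Im \<rho> = \<gamma>"
    by (auto simp: positive_ordinates_def nontrivial_zeros_def)
  then have "\<rho> \<noteq> 1" by auto
  then have z: "zeta_reg \<rho> = 0" using \<rho> zeta_eq[of \<rho>] by auto
  then have "Re \<rho> = 1/2" using \<rho> by (intro zeta_reg_zero_critical)
  then have "\<rho> = 1/2 + \<i> * of_real \<gamma>" using \<rho> by (simp add: complex_eq_iff)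
  then show "\<gamma> \<in> {\<gamma>. \<gamma> > 0 \<and> critical_zero \<gamma>}" using \<rho> z by simp
next
  fix \<gamma> assume g: "\<gamma> \<in> {\<gamma>. \<gamma> > 0 \<and> critical_zero \<gamma>}"
  define \<rho> where "\<rho> = 1/2 + \<i> * complex_of_real \<gamma>"
  have "\<rho> \<noteq> 1" "Re \<rho> = 1/2" "Im \<rho> = \<gamma>" by (auto simp: \<rho>_def complex_eq_iff)
  moreover have "zeta \<rho> = 0" using zeta_eq[of \<rho>] calculation g by (simp add: \<rho>_def)
  ultimately have "\<rho> \<in> nontrivial_zeros" by (simp add: nontrivial_zeros_def)
  then show "\<gamma> \<in> positive_ordinates" using g \<open>Im \<rho> = \<gamma>\<close> by (auto simp: positive_ordinates_def)
qed

text \<open>Gamma((1-\<rho>)/2) * (\<rho> - 1) is -2 Gamma((3-\<rho>)/2), so up to a constant and a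
  power of pi the coefficient is the reciprocal of the derivative of \<open>xi\<close>. This ties
  the sum C to residues of 1/xi.\<close>

lemma zero_coeff_eq:
  assumes z: "critical_zero \<gamma>"
  defines "\<rho> \<equiv> 1/2 + \<i> * of_real \<gamma>"
  shows "zero_coeff \<gamma> = Gamma ((1 - \<rho>) / 2) * (\<rho> - 1) / deriv zeta_reg \<rho>"
    "norm (zero_coeff \<gamma>) = 2 * pi powr (-1/4) / norm (deriv xi \<rho>)" "deriv xi \<rho> \<noteq> 0"
proof -
  have \<rho>: "Re \<rho> = 1/2" "\<rho> \<noteq> 1" by (auto simp: \<rho>_def complex_eq_iff)
  have z\<rho>: "zeta_reg \<rho> = 0" using z by (simp add: \<rho>_def)
  have d0: "deriv zeta_reg \<rho> \<noteq> 0" using deriv_zeta_reg_nonzero[OF z] by (simp add: \<rho>_def)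
  have dz: "(zeta_reg has_field_derivative deriv zeta_reg \<rho>) (at \<rho>)"
    by (rule holomorphic_derivI[OF zeta_reg_holomorphic open_halfspace_Re_gt]) (use \<rho> in auto)
  have "((\<lambda>s. zeta_reg s / (s - 1)) has_field_derivative deriv zeta_reg \<rho> / (\<rho> - 1)) (at \<rho>)"
    by (rule DERIV_cong[OF DERIV_divide[OF dz DERIV_diff[OF DERIV_ident DERIV_const]]]) (use \<rho> z\<rho> in auto)
  then have "(zeta has_field_derivative deriv zeta_reg \<rho> / (\<rho> - 1)) (at \<rho>)"
    by (rule has_field_derivative_transform_within_open[OF _ open_delete[OF open_halfspace_Re_gt[of 0], of 1]])
      (use \<rho> in \<open>auto simp: zeta_eq\<close>)
  then have dzeta: "deriv zeta \<rho> = deriv zeta_reg \<rho> / (\<rho> - 1)" by (rule DERIV_imp_deriv)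
  have g: "1 / 4 - \<i> * of_real \<gamma> / 2 = (1 - \<rho>) / 2" by (simp add: \<rho>_def field_simps)
  show eq: "zero_coeff \<gamma> = Gamma ((1 - \<rho>) / 2) * (\<rho> - 1) / deriv zeta_reg \<rho>"
    unfolding zero_coeff_def g \<rho>_def[symmetric] dzeta by simp
  define v where "v = (3 - \<rho>) / 2"
  have v: "v \<notin> \<int>\<^sub>\<le>\<^sub>0" "(1 - \<rho>) / 2 \<notin> \<int>\<^sub>\<le>\<^sub>0"
  proof -
    have "Re v > 0" "Re ((1 - \<rho>) / 2) > 0" using \<rho>(1) by (auto simp: v_def)
    from this[THEN Re_pos_not_nonpos_Ints] show "v \<notin> \<int>\<^sub>\<le>\<^sub>0" "(1 - \<rho>) / 2 \<notin> \<int>\<^sub>\<le>\<^sub>0" by simp_all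
  qed
  then have rv: "rGamma v \<noteq> 0" "rGamma ((1 - \<rho>) / 2) \<noteq> 0" by (auto simp: rGamma_eq_zero_iff)
  have dxi: "deriv xi \<rho> = of_real pi powr (- \<rho> / 2) * (deriv zeta_reg \<rho> * rGamma v)"
    using deriv_xi_right[OF _ has_field_derivative_rGamma_no_nonpos_int[OF v(1), unfolded v_def]] z\<rho> \<rho>(1) by (simp add: v_def)
  then show "deriv xi \<rho> \<noteq> 0" using d0 rv by simp
  have "Gamma ((1 - \<rho>) / 2) * (\<rho> - 1) = - 2 / rGamma v"
    unfolding Gamma_def v_def using rGamma_three_halves_minus[of \<rho>] rv unfolding v_def by (simp add: field_simps)
  then have "norm (zero_coeff \<gamma>) = 2 / (norm (rGamma v) * norm (deriv zeta_reg \<rho>))"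
    unfolding eq by (simp add: norm_divide norm_mult)
  moreover have "norm (deriv xi \<rho>) = pi powr (-1/4) * (norm (deriv zeta_reg \<rho>) * norm (rGamma v))"
  proof -
    have "Re (- \<rho> / 2) = -1/4" using \<rho>(1) by simp
    then show ?thesis by (simp only: dxi norm_mult norm_of_real_powr[OF pi_gt_zero])
  qed
  ultimately show "norm (zero_coeff \<gamma>) = 2 * pi powr (-1/4) / norm (deriv xi \<rho>)"
    by simp
qed

section \<open>Convergence of the sum of the coefficients\<close>

lemma conj_zero: "critical_zero (- \<gamma>) \<longleftrightarrow> critical_zero \<gamma>"
  unfolding conj_zeta_reg_critical by simp

lemma norm_zero_coeff_minus:
  assumes "critical_zero \<gamma>"
  shows "norm (zero_coeff (- \<gamma>)) = norm (zero_coeff \<gamma>)"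
proof -
  have "1/2 + \<i> * of_real (- \<gamma>) = cnj (1/2 + \<i> * of_real \<gamma>)" by simp
  then have "norm (deriv xi (1/2 + \<i> * of_real (- \<gamma>))) = norm (deriv xi (1/2 + \<i> * of_real \<gamma>))"
    by (simp only: deriv_xi_cnj complex_mod_cnj)
  then show ?thesis using zero_coeff_eq(2)[OF assms] zero_coeff_eq(2)[of "-\<gamma>"] assms conj_zero by simp
qed

text \<open>The lower bound 1/K for the derivative of \<open>zeta_reg\<close> costs only the linear
  factor |\<rho> - 1|, and Gamma pays for it. The exponent 6 is chosen because the zeros will be
  indexed by integers growing at most like the cube of the ordinate, so the terms become inverse
  squares.\<close>

lemma norm_zero_coeff_decay:
  "\<exists>D>0. \<forall>\<gamma>>0. critical_zero \<gamma> \<longrightarrow> norm (zero_coeff \<gamma>) \<le> D / (1 + \<gamma>) ^ 6"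
proof -
  obtain C where C: "C > 0" "\<And>u::complex. 1/4 \<le> Re u \<Longrightarrow> Re u \<le> 1/4 \<Longrightarrow> \<bar>Im u\<bar> \<ge> 1/2 \<Longrightarrow> norm (Gamma u) * \<bar>Im u\<bar> ^ 7 \<le> C"
    using Gamma_strip_decay[of "1/4" "1/4" 7] by blast
  define G where "G = Gamma (1/4 :: real)"
  have G: "G > 0" by (simp add: G_def)
  define D where "D = K * (G * 2 ^ 7 + C * 4 ^ 7)"
  have D: "D > 0" using K_pos C(1) G by (simp add: D_def add_pos_pos)
  have "norm (zero_coeff \<gamma>) \<le> D / (1 + \<gamma>) ^ 6" if g: "\<gamma> > 0" "critical_zero \<gamma>" for \<gamma>
  proof -
    define \<rho> where "\<rho> = 1/2 + \<i> * complex_of_real \<gamma>"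
    define u where "u = (1 - \<rho>) / 2"
    have u: "Re u = 1/4" "\<bar>Im u\<bar> = \<gamma> / 2" using g by (auto simp: u_def \<rho>_def)
    have n\<rho>: "norm (\<rho> - 1) \<le> 1 + \<gamma>" using cmod_le[of "\<rho> - 1"] g by (simp add: \<rho>_def)
    have "1 / K \<le> norm (deriv zeta_reg \<rho>)"
      by (rule norm_deriv_zeta_reg_ge) (use g in \<open>auto simp: \<rho>_def\<close>)
    then have "inverse (norm (deriv zeta_reg \<rho>)) \<le> inverse (1 / K)"
      using K_pos by (intro le_imp_inverse_le) auto
    then have "norm (inverse (deriv zeta_reg \<rho>)) \<le> K" by (simp add: norm_inverse)
    moreover have "zero_coeff \<gamma> = Gamma u * (\<rho> - 1) / deriv zeta_reg \<rho>"
      using zero_coeff_eq(1)[OF g(2)] by (simp only: u_def \<rho>_def)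
    ultimately have 1: "norm (zero_coeff \<gamma>) \<le> norm (Gamma u) * (1 + \<gamma>) * K"
      unfolding divide_inverse norm_mult
      using n\<rho> g K_pos by (simp only: norm_mult) (intro mult_mono mult_nonneg_nonneg; simp)
    have 2: "norm (Gamma u) * (1 + \<gamma>) ^ 7 \<le> G * 2 ^ 7 + C * 4 ^ 7"
    proof (cases "\<gamma> \<ge> 1")
      case True
      have "(1 + \<gamma>) ^ 7 \<le> (4 * (\<gamma> / 2)) ^ 7" using True by (intro power_mono) auto
      then have "norm (Gamma u) * (1 + \<gamma>) ^ 7 \<le> norm (Gamma u) * (4 * (\<gamma> / 2)) ^ 7" by (intro mult_left_mono) auto
      also have "\<dots> = 4 ^ 7 * (norm (Gamma u) * \<bar>Im u\<bar> ^ 7)" unfolding u(2) power_mult_distrib by (simp only: mult_ac)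
      also have "\<dots> \<le> 4 ^ 7 * C" using C(2)[of u] u True by (intro mult_left_mono) auto
      finally show ?thesis using G by (simp add: mult.commute)
    next
      case False
      have "norm (Gamma u) \<le> G" using norm_Gamma_le[of u] u by (simp add: G_def)
      moreover have "(1 + \<gamma>) ^ 7 \<le> 2 ^ 7" using False g by (intro power_mono) auto
      ultimately have "norm (Gamma u) * (1 + \<gamma>) ^ 7 \<le> G * 2 ^ 7" using G g by (intro mult_mono) auto
      then show ?thesis using C(1) by simp
    qed
    have "norm (zero_coeff \<gamma>) * (1 + \<gamma>) ^ 6 \<le> norm (Gamma u) * (1 + \<gamma>) * K * (1 + \<gamma>) ^ 6"
      using g by (intro mult_right_mono 1) auto
    also have "\<dots> = K * (norm (Gamma u) * (1 + \<gamma>) ^ 7)" by (simp add: power_Suc[of _ 6, simplified] mult_ac eval_nat_numeral)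
    also have "\<dots> \<le> D" unfolding D_def using K_pos by (intro mult_left_mono 2) auto
    finally show ?thesis using g by (simp add: pos_le_divide_eq)
  qed
  then show ?thesis using D by blast
qed

text \<open>The zeros are so well separated that their ordinates inject into the natural numbers with
  polynomial growth.\<close>

lemma zero_coeff_summable: "(\<lambda>\<gamma>. norm (zero_coeff \<gamma>)) summable_on positive_ordinates"
proof -
  obtain c where c: "c > 0" "c \<le> 1/8" "\<And>\<gamma> \<gamma>'. critical_zero \<gamma> \<Longrightarrow> critical_zero \<gamma>' \<Longrightarrow> \<gamma> \<noteq> \<gamma>' \<Longrightarrow>
     \<bar>\<gamma> - \<gamma>'\<bar> \<ge> c / (1 + \<bar>\<gamma>\<bar>)\<^sup>2"
    using zero_separation by blast
  obtain D where D: "D > 0" "\<And>\<gamma>. \<gamma> > 0 \<Longrightarrow> critical_zero \<gamma> \<Longrightarrow> norm (zero_coeff \<gamma>) \<le> D / (1 + \<gamma>) ^ 6"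
    using norm_zero_coeff_decay by blast
  \<comment> \<open>A gap of at least c / (1 + \<gamma>)^2 raises (1 + \<gamma>)^3 by at least c, so
    the integer parts after division by c are distinct.\<close>
  define \<phi> where "\<phi> = (\<lambda>\<gamma>. nat \<lfloor>(1 + \<gamma>) ^ 3 / c\<rfloor>)"
  define P where "P = positive_ordinates"
  have P: "\<gamma> > 0" "critical_zero \<gamma>" if "\<gamma> \<in> P" for \<gamma>
    using that by (auto simp: P_def positive_ordinates_eq)
  have lt: "\<phi> \<gamma> < \<phi> \<gamma>'" if g: "\<gamma> \<in> P" "\<gamma>' \<in> P" "\<gamma> < \<gamma>'" for \<gamma> \<gamma>'
  proof -
    define x h where "x = 1 + \<gamma>" and "h = \<gamma>' - \<gamma>"
    have x: "x > 1" "h > 0" using P(1)[OF g(1)] g(3) by (auto simp: x_def h_def)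
    have "h \<ge> c / x\<^sup>2" using c(3)[OF P(2)[OF g(1)] P(2)[OF g(2)]] g P(1)[OF g(1)] by (simp add: x_def h_def)
    then have "h * x\<^sup>2 \<ge> c" using x by (simp add: pos_divide_le_eq)
    moreover have "(x + h) ^ 3 = x ^ 3 + 3 * (h * x\<^sup>2) + 3 * x * h\<^sup>2 + h ^ 3"
      by (simp add: power2_eq_square power3_eq_cube algebra_simps)
    moreover have "3 * x * h\<^sup>2 + h ^ 3 \<ge> 0" using x by simp
    ultimately have "(x + h) ^ 3 \<ge> x ^ 3 + c" using c(1) by linarith
    then have "(x + h) ^ 3 / c \<ge> (x ^ 3 + c) / c" using c(1) by (intro divide_right_mono) auto
    then have "(x + h) ^ 3 / c \<ge> x ^ 3 / c + 1" using c(1) by (simp add: add_divide_distrib)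
    moreover have "x ^ 3 / c \<ge> 0" using x c by simp
    ultimately have "nat \<lfloor>x ^ 3 / c\<rfloor> < nat \<lfloor>(x + h) ^ 3 / c\<rfloor>" by linarith
    moreover have "x + h = 1 + \<gamma>'" by (simp add: x_def h_def)
    ultimately show ?thesis unfolding \<phi>_def x_def by simp
  qed
  have inj: "inj_on \<phi> P"
  proof (rule inj_onI)
    fix a b assume "a \<in> P" "b \<in> P" "\<phi> a = \<phi> b"
    then show "a = b" using lt[of a b] lt[of b a] by (cases a b rule: linorder_cases) auto
  qed
  define D' where "D' = D * (1 / c + 1)\<^sup>2"
  have "summable (\<lambda>n. D' * real (Suc n) powr (-1 - 1))"
    by (intro summable_mult powr_Suc_sums_bound) simp
  then have "(\<lambda>n. D' * real (Suc n) powr (-1 - 1)) summable_on UNIV"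
    by (rule summable_nonneg_imp_summable_on) (use D c in \<open>auto simp: D'_def\<close>)
  then have "(\<lambda>n. D' * real (Suc n) powr (-1 - 1)) summable_on (\<phi> ` P)"
    by (rule summable_on_subset_banach) auto
  then have s: "((\<lambda>n. D' * real (Suc n) powr (-1 - 1)) \<circ> \<phi>) summable_on P"
    by (subst (asm) summable_on_reindex[OF inj])
  have "(\<lambda>\<gamma>. norm (zero_coeff \<gamma>)) summable_on P"
  proof (rule summable_on_comparison_test[OF s])
    fix \<gamma> assume g: "\<gamma> \<in> P"
    have g0: "\<gamma> > 0" using P(1)[OF g] .
    have "real (\<phi> \<gamma>) \<le> (1 + \<gamma>) ^ 3 / c" unfolding \<phi>_def using c g0 by (intro of_nat_floor) auto
    moreover have "1 \<le> (1 + \<gamma>) ^ 3" using g0 by (intro one_le_power) auto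
    ultimately have le: "real (Suc (\<phi> \<gamma>)) \<le> (1 / c + 1) * (1 + \<gamma>) ^ 3" by (simp add: algebra_simps)
    have "norm (zero_coeff \<gamma>) \<le> D / (1 + \<gamma>) ^ 6" by (intro D(2) P g)
    also have "\<dots> = D' / ((1 / c + 1) * (1 + \<gamma>) ^ 3)\<^sup>2"
    proof -
      have "1 / c + 1 > 0" using c by (simp add: add_pos_pos)
      then show ?thesis using g0 by (simp add: D'_def power_mult_distrib flip: power_mult)
    qed
    also have "\<dots> \<le> D' / (real (Suc (\<phi> \<gamma>)))\<^sup>2"
      using D c le g0 by (intro divide_left_mono power_mono mult_pos_pos zero_less_power) (auto simp: D'_def add_pos_pos)
    also have "\<dots> = ((\<lambda>n. D' * real (Suc n) powr (-1 - 1)) \<circ> \<phi>) \<gamma>"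
      by (simp add: powr_minus divide_inverse del: of_nat_Suc)
    finally show "norm (zero_coeff \<gamma>) \<le> ((\<lambda>n. D' * real (Suc n) powr (-1 - 1)) \<circ> \<phi>) \<gamma>" .
  qed auto
  then show ?thesis by (simp add: P_def)
qed

text \<open>At w = 2 j + 3 the argument (3 - w) / 2 is -j, where the reciprocal Gamma function has a
  simple zero with derivative (-1)^j j!. The chain rule adds the factor -1/2.\<close>

lemma xi_odd:
  shows "xi (of_nat (2 * j + 3)) = 0"
    "deriv xi (of_nat (2 * j + 3)) =
      of_real pi powr (- of_nat (2 * j + 3) / 2) * zeta_reg (of_nat (2 * j + 3)) * ((-1) ^ Suc j * fact j / 2)"
    "deriv xi (of_nat (2 * j + 3)) \<noteq> 0"
proof -
  define w where "w = (of_nat (2 * j + 3) :: complex)"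
  have w: "Re w > 0" "Re w > 1/2" "w \<noteq> 1" by (auto simp: w_def complex_eq_iff)
  have v: "(3 - w) / 2 = - of_nat j" by (simp add: w_def)
  have r0: "rGamma ((3 - w) / 2) = 0" unfolding v by (simp add: rGamma_eq_zero_iff)
  show "xi (of_nat (2 * j + 3)) = 0" using xi_eq[OF w(1)] r0 by (simp add: w_def)
  have "(rGamma has_field_derivative (-1) ^ j * fact j) (at ((3 - w) / 2))"
    unfolding v by (rule has_field_derivative_rGamma_nonpos_int)
  from deriv_xi_right[OF w(1) this] r0
  have d: "deriv xi w = of_real pi powr (- w / 2) * zeta_reg w * ((-1) ^ Suc j * fact j / 2)" by simp
  then show "deriv xi (of_nat (2 * j + 3)) =
      of_real pi powr (- of_nat (2 * j + 3) / 2) * zeta_reg (of_nat (2 * j + 3)) * ((-1) ^ Suc j * fact j / 2)"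
    by (simp only: w_def)
  show "deriv xi (of_nat (2 * j + 3)) \<noteq> 0"
    unfolding w_def[symmetric] d using zeta_reg_nonzero[OF w(2)] by simp
qed

text \<open>Right of the critical line the zeros can only be odd integers; 1 is excluded because
  \<open>zeta_reg 1\<close> is 1. Reflection turns 3, 5, ... into -2, -4, ....\<close>

lemma xi_zero_cases:
  assumes "xi w = 0"
  obtains j where "w = of_nat (2 * j + 3)" | j where "w = - of_nat (2 * j + 2)"
    | \<gamma> where "w = 1/2 + \<i> * of_real \<gamma>" "critical_zero \<gamma>"
proof -
  have right: "\<exists>j. w = of_nat (2 * j + 3)" if w: "xi w = 0" "Re w > 1/2" for w
  proof -
    have "(1 - w) / 2 \<in> \<int>\<^sub>\<le>\<^sub>0" using inverse_xi_eq(1)[OF w(2)] w(1) by blast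
    then obtain m where m: "(1 - w) / 2 = - of_nat m" by (elim nonpos_Ints_cases')
    then have w_eq: "w = of_nat (2 * m + 1)" by (simp add: field_simps)
    have "m \<noteq> 0"
    proof
      assume "m = 0"
      then have "w = 1" using w_eq by simp
      then show False using w xi_eq[of 1] by simp
    qed
    then obtain j where "m = Suc j" by (cases m) auto
    then show ?thesis using w_eq by (intro exI[of _ j]) simp
  qed
  consider "Re w > 1/2" | "Re (1 - w) > 1/2" | "Re w = 1/2" by force
  then show ?thesis
  proof cases
    case 1
    then show ?thesis using right[OF assms] that(1) by blast
  next
    case 2
    then obtain j where "1 - w = of_nat (2 * j + 3)" using right[of "1 - w"] assms by (auto simp: xi_symmetric)
    then have "1 - (1 - w) = - of_nat (2 * j + 2)" by (simp only:) simp
    then show ?thesis using that(2) by simp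
  next
    case 3
    have e: "w = 1/2 + \<i> * of_real (Im w)" using 3 by (simp add: complex_eq_iff)
    have "zeta_reg w = 0" using assms 3 by (subst (asm) xi_zero_iff) auto
    then show ?thesis using that(3)[OF e] e by metis
  qed
qed

text \<open>The gaps in the real series are nonnegative, and the one at n = 0 equals 1. Consequently
  0 is not an ordinate, and \<open>xi\<close>, which vanishes at 3, is not constant.\<close>

lemma zeta_reg_half_nonzero: "zeta_reg (1/2) \<noteq> 0"
proof -
  let ?d = "zeta_gap (1/2)"
  have s: "?d sums (Re (zeta_reg (of_real (1/2))) / (1 - 1/2))"
    by (rule zeta_reg_real_sums) auto
  have nn: "?d n \<ge> 0" for n
    by (rule zeta_gap_nonneg) auto
  have "?d 0 \<le> Re (zeta_reg (of_real (1/2))) / (1 - 1/2)"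
    using sum_le_suminf[OF sums_summable[OF s], of "{0}"] nn s by (simp add: sums_iff)
  then have "Re (zeta_reg (of_real (1/2))) > 0" by simp
  then show ?thesis by auto
qed

end

subsection \<open>Residues\<close>

text \<open>The majorant integrates to a difference of arctangents, so the bound does not depend on
  the height T.\<close>

lemma contour_integral_vertical_bound:
  fixes c T V :: real
  assumes T: "T > 0" and V: "V \<ge> 0"
    and cont: "continuous_on (closed_segment (Complex c (-T)) (Complex c T)) f"
    and bd: "\<And>t. norm (f (Complex c t)) \<le> V / (1 + t\<^sup>2)"
  shows "norm (contour_integral (linepath (Complex c (-T)) (Complex c T)) f) \<le> V * pi"
proof -
  let ?a = "Complex c (-T)" and ?b = "Complex c T"
  define t where "t = (\<lambda>x. - T + 2 * T * x)"
  have lp: "linepath ?a ?b x = Complex c (t x)" for x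
    by (simp add: linepath_def complex_eq_iff t_def algebra_simps)
  have ba: "norm (?b - ?a) = 2 * T"
  proof -
    have "?b - ?a = \<i> * of_real (2 * T)" by (simp add: complex_eq_iff)
    then show ?thesis using T by (simp add: norm_mult)
  qed
  have "f contour_integrable_on linepath ?a ?b" by (rule contour_integrable_continuous_linepath[OF cont])
  then have hi: "((\<lambda>x. f (linepath ?a ?b x) * (?b - ?a)) has_integral contour_integral (linepath ?a ?b) f) {0..1}"
    using has_contour_integral_integral has_contour_integral_linepath by blast
  have hg: "((\<lambda>x. V / (1 + (t x)\<^sup>2) * (2 * T)) has_integral (V * arctan (t 1) - V * arctan (t 0))) {0..1}"
    by (rule fundamental_theorem_of_calculus)
      (auto intro!: derivative_eq_intros simp: t_def divide_inverse simp flip: has_real_derivative_iff_has_vector_derivative)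
  have "norm (integral {0..1} (\<lambda>x. f (linepath ?a ?b x) * (?b - ?a))) \<le> integral {0..1} (\<lambda>x. V / (1 + (t x)\<^sup>2) * (2 * T))"
  proof (rule integral_norm_bound_integral)
    show "norm (f (linepath ?a ?b x) * (?b - ?a)) \<le> V / (1 + (t x)\<^sup>2) * (2 * T)" if "x \<in> {0..1}" for x
      unfolding norm_mult ba lp using bd T by (intro mult_right_mono) auto
  qed (use hi hg in \<open>auto simp: integrable_on_def\<close>)
  then have "norm (contour_integral (linepath ?a ?b) f) \<le> V * (arctan (t 1) - arctan (t 0))"
    using hi hg by (simp add: integral_unique right_diff_distrib)
  also have "\<dots> \<le> V * pi"
    using arctan_bounded[of "t 1"] arctan_bounded[of "t 0"] by (intro mult_left_mono V) linarith
  finally show ?thesis .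
qed

definition contour_numerator :: "real \<Rightarrow> complex \<Rightarrow> complex" where
  "contour_numerator b w = of_real b powr (w - 1) * of_real pi powr (- w / 2)"

lemma contour_numerator_holomorphic: "b > 0 \<Longrightarrow> contour_numerator b holomorphic_on A"
  unfolding contour_numerator_def by (intro holomorphic_intros) auto

lemma norm_contour_numerator:
  "b > 0 \<Longrightarrow> norm (contour_numerator b w) = b powr (Re w - 1) * pi powr (- Re w / 2)"
  by (simp add: contour_numerator_def norm_mult norm_of_real_powr)

abbreviation contour_integrand :: "real \<Rightarrow> complex \<Rightarrow> complex" where
  "contour_integrand b \<equiv> \<lambda>w. contour_numerator b w / xi w"

lemma residue_contour_integrand:
  assumes "b > 0" "xi z = 0" "deriv xi z \<noteq> 0"
  shows "residue (contour_integrand b) z = contour_numerator b z / deriv xi z"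
  using assms
  by (intro residue_simple_pole_deriv[where s = UNIV] contour_numerator_holomorphic xi_holomorphic has_field_derivative_xi)
    (auto simp: contour_numerator_def)

context mertens_bound
begin

text \<open>The term k = j + 1 of the expansion of F(b), with \<open>mertens_series\<close> standing
  for 1/zeta.\<close>

definition expansion_term :: "real \<Rightarrow> nat \<Rightarrow> complex" where
  "expansion_term b j = (-1) ^ Suc j * of_real b ^ (2 * j + 2) / fact (Suc j) * mertens_series (of_nat (2 * j + 3))"

text \<open>The derivative of \<open>xi\<close> supplies j!/2 up to sign, and
  \<open>zeta_reg w\<close> is (w - 1) / \<open>mertens_series w\<close> with w - 1 = 2 (j + 1);
  together they produce (j + 1)!.\<close>

lemma residue_odd:
  assumes "b > 0"
  shows "residue (contour_integrand b) (of_nat (2 * j + 3)) = expansion_term b j"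
proof -
  define w where "w = (of_nat (2 * j + 3) :: complex)"
  define Z g where "Z = zeta_reg w" and "g = mertens_series w"
  have re: "Re w > 1/2" by (simp add: w_def)
  have gZ: "g * Z = w - 1" unfolding g_def Z_def by (rule mertens_series_mult_zeta_reg[OF re])
  have Z: "Z \<noteq> 0" unfolding Z_def by (rule zeta_reg_nonzero[OF re])
  have w1: "w - 1 = 2 * of_nat (Suc j)" by (simp add: w_def)
  have "of_real b powr (w - 1) = complex_of_real b powr of_nat (2 * j + 2)" by (simp add: w_def)
  also have "\<dots> = of_real b ^ (2 * j + 2)" using assms by (subst powr_nat') auto
  finally have p: "of_real b powr (w - 1) = complex_of_real b ^ (2 * j + 2)" .
  define P where "P = (of_real pi powr (- w / 2) :: complex)"
  have P: "P \<noteq> 0" by (simp add: P_def)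
  define e where "e = ((-1) ^ Suc j :: complex)"
  have e: "e * e = 1" "e \<noteq> 0" by (auto simp: e_def simp flip: power_add)
  have "residue (contour_integrand b) w = contour_numerator b w / deriv xi w"
    unfolding w_def by (rule residue_contour_integrand[OF assms xi_odd(1,3)])
  also have "\<dots> = of_real b ^ (2 * j + 2) * P / (P * Z * (e * fact j / 2))"
    using xi_odd(2)[of j] unfolding contour_numerator_def p P_def[symmetric] w_def[symmetric] Z_def e_def by simp
  also have "\<dots> = of_real b ^ (2 * j + 2) * 2 / (Z * e * fact j)" using P by (simp add: mult_ac)
  also have "\<dots> = of_real b ^ (2 * j + 2) * e * (2 / (Z * fact j))"
  proof -
    have e1: "1 / e = e" using e by (simp add: divide_eq_eq)
    have gen: "y * 2 / (Z * u * v) = y * (1 / u) * (2 / (Z * v))" for y u v by simp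
    show ?thesis unfolding gen e1 ..
  qed
  also have "2 / (Z * fact j) = g / fact (Suc j)"
  proof -
    have "g = 2 * of_nat (Suc j) / Z" using gZ w1 Z by (simp add: eq_divide_eq)
    moreover have "of_nat (Suc j) \<noteq> (0 :: complex)" by (simp del: of_nat_Suc)
    ultimately show ?thesis by (simp add: fact_Suc del: of_nat_Suc)
  qed
  finally show ?thesis by (simp add: expansion_term_def w_def g_def e_def mult_ac)
qed

text \<open>The line Re w = 2 M + 2 runs midway between two poles of the Gamma factor. There (1 - w)
  / 2 has real part -1/2 - M and imaginary part -t/2.\<close>

lemma inverse_xi_vertical_bound:
  "norm (inverse (xi (Complex (real (2 * Suc M)) t))) \<le> pi ^ Suc M * 4 / (fact M * (1 + t\<^sup>2))"
proof -
  define w where "w = Complex (real (2 * Suc M)) t"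
  have re: "Re w > 1/2" "Re w \<ge> 2" by (simp_all add: w_def)
  have u: "(1 - w) / 2 = 1/2 - of_nat (Suc M) + \<i> * of_real (- t / 2)"
    by (simp add: w_def complex_eq_iff)
  have nu: "(1 - w) / 2 \<notin> \<int>\<^sub>\<le>\<^sub>0"
    by (rule half_integer_not_nonpos_Ints[where n = "Suc M"]) (simp add: w_def field_simps)
  have G: "norm (Gamma ((1 - w) / 2)) \<le> 1 / (fact M * (1/4 + (- t / 2)\<^sup>2))"
    unfolding u by (rule norm_Gamma_vertical_le)
  have P: "norm (of_real pi powr (w / 2) :: complex) = pi ^ Suc M"
  proof -
    have "norm (of_real pi powr (w / 2) :: complex) = pi powr (Re w / 2)" by (simp add: norm_of_real_powr)
    also have "Re w / 2 = real (Suc M)" by (simp add: w_def)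
    also have "pi powr real (Suc M) = pi ^ Suc M" by (rule powr_realpow) simp
    finally show ?thesis .
  qed
  have "norm (inverse (xi w)) = 1/2 * pi ^ Suc M * norm (Gamma ((1 - w) / 2)) * norm (mertens_series w)"
    unfolding inverse_xi_eq(2)[OF re(1) nu] norm_mult P by (simp add: norm_divide)
  also have "\<dots> \<le> 1/2 * pi ^ Suc M * (1 / (fact M * (1/4 + (- t / 2)\<^sup>2))) * 2"
    using norm_mertens_series_le_2[OF re(2)] by (intro mult_mono mult_left_mono G) auto
  also have "\<dots> = pi ^ Suc M * (4 / (fact M * (1 + t\<^sup>2)))"
  proof -
    have q: "1/4 + (- t / 2)\<^sup>2 = (1 + t\<^sup>2) / 4" by (simp add: power_divide add_divide_distrib)
    show ?thesis unfolding q by simp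
  qed
  finally show ?thesis by (simp add: w_def)
qed

lemma finite_ordinates: "finite {\<gamma>. critical_zero \<gamma> \<and> \<bar>\<gamma>\<bar> < T}"
proof -
  have "finite {z \<in> cball 0 (\<bar>T\<bar> + 1). xi z = 0}"
  proof (rule holomorphic_compact_finite_zeros[OF xi_holomorphic[of UNIV]])
    show "\<not> xi constant_on UNIV"
    proof
      assume "xi constant_on UNIV"
      then have "xi (1/2) = xi (of_nat (2 * 0 + 3))" unfolding constant_on_def by auto
      then have "xi (1/2) = 0" unfolding xi_odd(1) .
      then show False using zeta_reg_half_nonzero xi_zero_iff[of "1/2"] by simp
    qed
  qed auto
  then have "finite (Im ` {z \<in> cball 0 (\<bar>T\<bar> + 1). xi z = 0})" by (rule finite_imageI)
  moreover have "{\<gamma>. critical_zero \<gamma> \<and> \<bar>\<gamma>\<bar> < T} \<subseteq> Im ` {z \<in> cball 0 (\<bar>T\<bar> + 1). xi z = 0}"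
  proof
    fix \<gamma> assume g: "\<gamma> \<in> {\<gamma>. critical_zero \<gamma> \<and> \<bar>\<gamma>\<bar> < T}"
    define z where "z = 1/2 + \<i> * complex_of_real \<gamma>"
    have "norm z \<le> 1/2 + \<bar>\<gamma>\<bar>" using cmod_le[of z] by (simp add: z_def)
    moreover have "xi z = 0" using g by (subst xi_zero_iff) (auto simp: z_def)
    ultimately have "z \<in> {z \<in> cball 0 (\<bar>T\<bar> + 1). xi z = 0}" using g by auto
    moreover have "Im z = \<gamma>" by (simp add: z_def)
    ultimately show "\<gamma> \<in> Im ` {z \<in> cball 0 (\<bar>T\<bar> + 1). xi z = 0}" by blast
  qed
  ultimately show ?thesis by (rule finite_subset[rotated])
qed

text \<open>Ordinates come in pairs of opposite sign with coefficients of equal norm, and 0 is not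
  among them, so the sum is twice a finite partial sum of C.\<close>

lemma sum_zero_coeff_le:
  assumes C: "((\<lambda>\<gamma>. norm (zero_coeff \<gamma>)) has_sum C) positive_ordinates"
  shows "(\<Sum>\<gamma> | critical_zero \<gamma> \<and> \<bar>\<gamma>\<bar> < T. norm (zero_coeff \<gamma>)) \<le> 2 * C"
proof -
  define G where "G = {\<gamma>. critical_zero \<gamma> \<and> \<bar>\<gamma>\<bar> < T}"
  define Gp where "Gp = {\<gamma> \<in> G. \<gamma> > 0}"
  have "finite G" unfolding G_def by (rule finite_ordinates)
  then have fin: "finite G" "finite Gp" by (simp_all add: Gp_def)
  have n0: "0 \<notin> G" using zeta_reg_half_nonzero by (simp add: G_def)
  have sym: "- \<gamma> \<in> G \<longleftrightarrow> \<gamma> \<in> G" for \<gamma> using conj_zero[of \<gamma>] by (simp add: G_def)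
  have un: "G = Gp \<union> uminus ` Gp"
  proof (intro equalityI subsetI)
    fix \<gamma> assume g: "\<gamma> \<in> G"
    then have "\<gamma> \<noteq> 0" using n0 by auto
    then consider "\<gamma> > 0" | "- \<gamma> > 0" by linarith
    then show "\<gamma> \<in> Gp \<union> uminus ` Gp"
    proof cases
      case 2
      then have "- \<gamma> \<in> Gp" using g sym by (simp add: Gp_def)
      then have "- (- \<gamma>) \<in> uminus ` Gp" by (rule imageI)
      then show ?thesis by simp
    qed (use g in \<open>auto simp: Gp_def\<close>)
  qed (auto simp: Gp_def sym)
  have "(\<Sum>\<gamma>\<in>G. norm (zero_coeff \<gamma>)) = (\<Sum>\<gamma>\<in>Gp. norm (zero_coeff \<gamma>)) + (\<Sum>\<gamma>\<in>uminus ` Gp. norm (zero_coeff \<gamma>))"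
    unfolding un by (rule sum.union_disjoint) (use fin in \<open>auto simp: Gp_def\<close>)
  also have "(\<Sum>\<gamma>\<in>uminus ` Gp. norm (zero_coeff \<gamma>)) = (\<Sum>\<gamma>\<in>Gp. norm (zero_coeff (- \<gamma>)))"
    by (subst sum.reindex) auto
  also have "\<dots> = (\<Sum>\<gamma>\<in>Gp. norm (zero_coeff \<gamma>))"
    by (intro sum.cong refl norm_zero_coeff_minus) (auto simp: Gp_def G_def)
  also have "(\<Sum>\<gamma>\<in>Gp. norm (zero_coeff \<gamma>)) \<le> C"
    by (rule finite_sum_le_has_sum[OF C fin(2)]) (auto simp: Gp_def G_def positive_ordinates_eq)
  finally show ?thesis by (simp add: G_def)
qed

lemma norm_residue_zero:
  assumes "b > 0" "critical_zero \<gamma>"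
  shows "norm (residue (contour_integrand b) (1/2 + \<i> * of_real \<gamma>)) = norm (zero_coeff \<gamma>) / (2 * sqrt b)"
proof -
  define \<rho> where "\<rho> = 1/2 + \<i> * complex_of_real \<gamma>"
  have "xi \<rho> = 0" using assms by (subst xi_zero_iff) (auto simp: \<rho>_def)
  then have "residue (contour_integrand b) \<rho> = contour_numerator b \<rho> / deriv xi \<rho>"
    using zero_coeff_eq(3)[OF assms(2)] assms(1) by (intro residue_contour_integrand) (auto simp: \<rho>_def)
  then have "norm (residue (contour_integrand b) \<rho>) = b powr (-1/2) * pi powr (-1/4) / norm (deriv xi \<rho>)"
    by (simp add: norm_divide norm_contour_numerator[OF assms(1)] \<rho>_def)
  also have "b powr (-1/2) = 1 / sqrt b"
    using assms(1) by (simp add: powr_minus powr_half_sqrt inverse_eq_divide)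
  also have "1 / sqrt b * pi powr (-1/4) / norm (deriv xi \<rho>) = norm (zero_coeff \<gamma>) / (2 * sqrt b)"
    unfolding zero_coeff_eq(2)[OF assms(2)] \<rho>_def by simp
  finally show ?thesis by (simp add: \<rho>_def)
qed

lemma norm_residue_minus_2:
  assumes "b > 0"
  shows "norm (residue (contour_integrand b) (-2)) = pi / norm (deriv xi 3) / b ^ 3"
proof -
  have x3: "xi 3 = 0" "deriv xi 3 \<noteq> 0" using xi_odd(1,3)[of 0] by simp_all
  have "xi (-2) = 0" "deriv xi (-2) = - deriv xi 3"
    using xi_symmetric[of 3] deriv_xi_reflect[of 3] x3(1) by simp_all
  then have "norm (residue (contour_integrand b) (-2)) = b powr (-3) * pi / norm (deriv xi 3)"
    using x3(2) assms by (subst residue_contour_integrand) (simp_all add: norm_divide norm_contour_numerator)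
  then show ?thesis using assms by (simp add: powr_minus divide_inverse)
qed

end

subsection \<open>The contour integral and the theorem\<close>

context mertens_bound
begin

text \<open>The first summand comes from the residue at -2. The second is the bound 4 pi^(3/2) pi^2
  * pi for the left side divided by 2 pi; that side carries b^(-4), which is at most b^(-3).\<close>

definition remainder_const :: real where
  "remainder_const = pi / norm (deriv xi 3) + 2 * (pi powr (3/2) * pi ^ 2)"

lemma contour_bound:
  fixes b D :: real and M n :: nat
  assumes b: "b \<ge> 1" and M: "M \<ge> 1" and n: "n \<ge> 2" and D: "D > 0"
    and C: "((\<lambda>\<gamma>. norm (zero_coeff \<gamma>)) has_sum C) positive_ordinates"
    and T: "real n \<le> T" "r > 0" "\<And>\<gamma>. critical_zero \<gamma> \<Longrightarrow> \<bar>\<bar>\<gamma>\<bar> - T\<bar> \<ge> r"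
    and hor: "\<And>w. \<bar>Re w - 1/2\<bar> \<le> real (2 * M + 4) \<Longrightarrow> \<bar>Im w\<bar> = T \<Longrightarrow> norm (inverse (xi w)) \<le> D / real n"
  shows "norm (\<Sum>j<M. expansion_term b j) \<le> C / sqrt b + remainder_const / b ^ 3 + 2 * b ^ (2 * M + 1) / fact M
    + real (2 * M + 5) * (b ^ (2 * M + 1) * pi powr (3/2) * D) / real n"
proof -
  have T0: "T > 0" using T(1) n by linarith
  define f where "f = (contour_integrand b)"
  \<comment> \<open>An open box slightly larger than the contour, without new poles: -4 and 2 M + 3
    lie on its boundary lines, and no ordinate is within r of the height T.\<close>
  define S where "S = box (Complex (-4) (-T - r)) (Complex (real (2 * M + 3)) (T + r))"
  define a1 a3 where "a1 = Complex (-3) (-T)" and "a3 = Complex (real (2 * Suc M)) T"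
  define G where "G = {\<gamma>. critical_zero \<gamma> \<and> \<bar>\<gamma>\<bar> < T}"
  define h where "h = (\<lambda>\<gamma>. 1/2 + \<i> * complex_of_real \<gamma>)"
  define od where "od = (\<lambda>j. of_nat (2 * j + 3) :: complex)"
  define pts where "pts = insert (-2) (od ` {..<M} \<union> h ` G)"
  have finG: "finite G" unfolding G_def by (rule finite_ordinates)
  have fin: "finite pts" unfolding pts_def using finG by simp
  have zeros: "z \<in> pts" if z: "z \<in> S" "xi z = 0" for z
    using z(2)
  proof (cases z rule: xi_zero_cases)
    case (1 j)
    then have "j < M" using z(1) by (simp add: S_def in_box_complex_iff)
    then show ?thesis using 1 by (auto simp: pts_def od_def)
  next
    case (2 j)
    then have "j = 0" using z(1) by (simp add: S_def in_box_complex_iff)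
    then show ?thesis using 2 by (simp add: pts_def)
  next
    case (3 \<gamma>)
    then have "\<bar>\<gamma>\<bar> < T + r" using z(1) by (auto simp: S_def in_box_complex_iff)
    then have "\<bar>\<gamma>\<bar> < T" using T(3)[OF 3(2)] by linarith
    then show ?thesis using 3 by (auto simp: pts_def G_def h_def)
  qed
  have inside: "pts \<subseteq> box a1 a3"
    using T0 by (auto simp: pts_def od_def h_def G_def in_box_complex_iff a1_def a3_def)
  have le: "Re a1 \<le> Re a3" "Im a1 \<le> Im a3" using T0 by (auto simp: a1_def a3_def)
  have path: "path_image (rectpath a1 a3) \<subseteq> S - pts"
  proof -
    have "path_image (rectpath a1 a3) = cbox a1 a3 - box a1 a3"
      by (rule path_image_rectpath_cbox_minus_box[OF le])
    moreover have "cbox a1 a3 \<subseteq> S"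
      using T0 T(2) by (auto simp: S_def a1_def a3_def in_box_complex_iff in_cbox_complex_iff)
    ultimately show ?thesis using inside by blast
  qed
  have hol: "f holomorphic_on S - pts"
    unfolding f_def using zeros b
    by (intro holomorphic_on_divide contour_numerator_holomorphic xi_holomorphic) auto
  have "contour_integral (rectpath a1 a3) f = 2 * pi * \<i> * (\<Sum>p\<in>pts. winding_number (rectpath a1 a3) p * residue f p)"
  proof (rule Residue_theorem[where S = S])
    show "open S" "connected S" by (auto simp: S_def open_box intro: convex_connected convex_box)
    show "\<forall>z. z \<notin> S \<longrightarrow> winding_number (rectpath a1 a3) z = 0"
    proof (intro allI impI)
      fix z assume "z \<notin> S"
      then show "winding_number (rectpath a1 a3) z = 0"
        by (intro winding_number_zero_outside[where s = S]) (use path in \<open>auto simp: S_def convex_box\<close>)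
    qed
  qed (use fin hol path in auto)
  also have "(\<Sum>p\<in>pts. winding_number (rectpath a1 a3) p * residue f p) = (\<Sum>p\<in>pts. residue f p)"
    using inside by (intro sum.cong refl) (auto simp: winding_number_rectpath)
  also have "\<dots> = residue f (-2) + ((\<Sum>j<M. expansion_term b j) + (\<Sum>\<gamma>\<in>G. residue f (h \<gamma>)))"
  proof -
    have "(\<Sum>p\<in>pts. residue f p) = residue f (-2) + (\<Sum>p\<in>od ` {..<M} \<union> h ` G. residue f p)"
      unfolding pts_def using finG by (subst sum.insert) (auto simp: od_def h_def complex_eq_iff)
    also have "(\<Sum>p\<in>od ` {..<M} \<union> h ` G. residue f p) = (\<Sum>p\<in>od ` {..<M}. residue f p) + (\<Sum>p\<in>h ` G. residue f p)"
      using finG by (intro sum.union_disjoint) (auto simp: od_def h_def complex_eq_iff)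
    also have "(\<Sum>p\<in>od ` {..<M}. residue f p) = (\<Sum>j<M. residue f (od j))"
      by (subst sum.reindex) (auto simp: inj_on_def od_def simp flip: of_nat_mult of_nat_add)
    also have "\<dots> = (\<Sum>j<M. expansion_term b j)"
      unfolding f_def od_def using b by (intro sum.cong refl residue_odd) auto
    also have "(\<Sum>p\<in>h ` G. residue f p) = (\<Sum>\<gamma>\<in>G. residue f (h \<gamma>))"
      by (subst sum.reindex) (auto simp: inj_on_def h_def)
    finally show ?thesis .
  qed
  finally have res: "contour_integral (rectpath a1 a3) f = 2 * pi * \<i> * (residue f (-2) + ((\<Sum>j<M. expansion_term b j) + (\<Sum>\<gamma>\<in>G. residue f (h \<gamma>))))" .
  define I where "I = contour_integral (rectpath a1 a3) f"
  have "(\<Sum>j<M. expansion_term b j) = I / (2 * pi * \<i>) - residue f (-2) - (\<Sum>\<gamma>\<in>G. residue f (h \<gamma>))"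
    unfolding I_def res by simp
  then have "norm (\<Sum>j<M. expansion_term b j) \<le> norm (I / (2 * pi * \<i>)) + norm (residue f (-2)) + norm (\<Sum>\<gamma>\<in>G. residue f (h \<gamma>))"
    by (smt (verit) norm_triangle_ineq4)
  moreover have "norm (I / (2 * pi * \<i>)) = norm I / (2 * pi)" by (simp add: norm_divide norm_mult)
  moreover have "norm (residue f (-2)) = pi / norm (deriv xi 3) / b ^ 3"
    unfolding f_def using b by (intro norm_residue_minus_2) auto
  moreover have "norm (\<Sum>\<gamma>\<in>G. residue f (h \<gamma>)) \<le> C / sqrt b"
  proof -
    have "norm (\<Sum>\<gamma>\<in>G. residue f (h \<gamma>)) \<le> (\<Sum>\<gamma>\<in>G. norm (residue f (h \<gamma>)))" by (rule norm_sum)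
    also have "\<dots> = (\<Sum>\<gamma>\<in>G. norm (zero_coeff \<gamma>) / (2 * sqrt b))"
      unfolding f_def h_def using b by (intro sum.cong refl norm_residue_zero) (auto simp: G_def)
    also have "\<dots> = (\<Sum>\<gamma>\<in>G. norm (zero_coeff \<gamma>)) / (2 * sqrt b)" by (simp add: sum_divide_distrib)
    also have "\<dots> \<le> 2 * C / (2 * sqrt b)"
      using sum_zero_coeff_le[OF C, of T] b by (intro divide_right_mono) (auto simp: G_def)
    finally show ?thesis by simp
  qed
  moreover have "norm I \<le> 2 * (real (2 * M + 5) * (b ^ (2 * M + 1) * pi powr (3/2) * D / real n))
     + (b ^ (2 * M + 1) * 4 / fact M + pi powr (3/2) * pi ^ 2 * 4 / b ^ 4) * pi"
  proof -
    define a2 a4 where "a2 = Complex (Re a3) (Im a1)" and "a4 = Complex (Re a1) (Im a3)"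
    have segs: "closed_segment a1 a2 \<subseteq> S - pts" "closed_segment a2 a3 \<subseteq> S - pts" "closed_segment a3 a4 \<subseteq> S - pts" "closed_segment a4 a1 \<subseteq> S - pts"
      using path by (simp_all add: rectpath_def Let_def path_image_join a2_def a4_def)
    have conts: "continuous_on A f" if "A \<subseteq> S - pts" for A
      using holomorphic_on_imp_continuous_on[OF hol] that by (rule continuous_on_subset)
    note ci = segs[THEN conts, THEN contour_integrable_continuous_linepath]
    have split: "I = contour_integral (linepath a1 a2) f + (contour_integral (linepath a2 a3) f + (contour_integral (linepath a3 a4) f + contour_integral (linepath a4 a1) f))"
      using ci unfolding I_def rectpath_def Let_def a2_def[symmetric] a4_def[symmetric]
      by (simp add: contour_integrable_join)
    define B where "B = b ^ (2 * M + 1) * pi powr (3/2) * D / real n"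
    have B: "B \<ge> 0" using b D by (simp add: B_def)
    have num: "norm (contour_numerator b w) \<le> b ^ (2 * M + 1) * pi powr (3/2)" if "Re w \<ge> -3" "Re w \<le> real (2 * Suc M)" for w
    proof -
      have "b powr (Re w - 1) \<le> b powr real (2 * M + 1)" using b that by (intro powr_mono) auto
      also have "\<dots> = b ^ (2 * M + 1)" using b by (intro powr_realpow) auto
      finally have 1: "b powr (Re w - 1) \<le> b ^ (2 * M + 1)" .
      have "pi powr (- Re w / 2) \<le> pi powr (3/2)" using that pi_gt3 by (intro powr_mono) auto
      with 1 show ?thesis using b by (subst norm_contour_numerator) (auto intro!: mult_mono)
    qed
    have hb: "norm (f w) \<le> B" if "Re w \<in> {-3..real (2 * Suc M)}" "\<bar>Im w\<bar> = T" for w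
    proof -
      have "\<bar>Re w - 1/2\<bar> \<le> real (2 * M + 4)" using that(1) by auto
      from hor[OF this that(2)] num[of w] that(1) show ?thesis
        unfolding f_def divide_inverse norm_mult B_def times_divide_eq_right[symmetric] mult.assoc[of _ D]
        using b D by (intro mult_mono) auto
    qed
    have seg12: "Re w \<in> {-3..real (2 * Suc M)} \<and> \<bar>Im w\<bar> = T" if "w \<in> closed_segment a1 a2" for w
      using that T0 by (auto simp: a1_def a2_def a3_def closed_segment_same_Im closed_segment_eq_real_ivl split: if_splits)
    have seg34: "Re w \<in> {-3..real (2 * Suc M)} \<and> \<bar>Im w\<bar> = T" if "w \<in> closed_segment a3 a4" for w
      using that T0 by (auto simp: a1_def a4_def a3_def closed_segment_same_Im closed_segment_eq_real_ivl split: if_splits)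
    have "a2 - a1 = of_real (real (2 * M + 5))" "a4 - a3 = - of_real (real (2 * M + 5))"
      by (simp_all add: a1_def a2_def a3_def a4_def complex_eq_iff)
    then have len: "norm (a2 - a1) = real (2 * M + 5)" "norm (a4 - a3) = real (2 * M + 5)"
      by (simp_all only: norm_minus_cancel norm_of_real)
    have b12: "norm (contour_integral (linepath a1 a2) f) \<le> B * real (2 * M + 5)"
      unfolding len(1)[symmetric] using seg12 hb by (intro contour_integral_bound_linepath ci B) blast
    have b34: "norm (contour_integral (linepath a3 a4) f) \<le> B * real (2 * M + 5)"
      unfolding len(2)[symmetric] using seg34 hb by (intro contour_integral_bound_linepath ci B) blast
    have b23: "norm (contour_integral (linepath a2 a3) f) \<le> b ^ (2 * M + 1) * 4 / fact M * pi"
    proof -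
      have a23: "a2 = Complex (real (2 * Suc M)) (-T)" "a3 = Complex (real (2 * Suc M)) T"
        by (simp_all add: a2_def a3_def a1_def)
      show ?thesis unfolding a23
      proof (rule contour_integral_vertical_bound[OF T0])
        show "continuous_on (closed_segment (Complex (real (2 * Suc M)) (-T)) (Complex (real (2 * Suc M)) T)) f"
          using conts[OF segs(2)] unfolding a23 .
        fix t
        have nn: "norm (contour_numerator b (Complex (real (2 * Suc M)) t)) = b ^ (2 * M + 1) * inverse (pi ^ Suc M)"
        proof -
          have "b powr (real (2 * Suc M) - 1) = b powr real (2 * M + 1)" by simp
          also have "\<dots> = b ^ (2 * M + 1)" using b by (intro powr_realpow) auto
          finally have 1: "b powr (real (2 * Suc M) - 1) = b ^ (2 * M + 1)" .
          have "- real (2 * Suc M) / 2 = - real (Suc M)" by simp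
          then have "pi powr (- real (2 * Suc M) / 2) = pi powr (- real (Suc M))" by (simp only:)
          also have "\<dots> = inverse (pi ^ Suc M)" by (simp only: powr_minus powr_realpow[OF pi_gt_zero])
          finally show ?thesis using b 1 by (simp add: norm_contour_numerator)
        qed
        have "norm (f (Complex (real (2 * Suc M)) t)) \<le> b ^ (2 * M + 1) * inverse (pi ^ Suc M) * (pi ^ Suc M * 4 / (fact M * (1 + t\<^sup>2)))"
          unfolding f_def divide_inverse norm_mult nn
          using inverse_xi_vertical_bound[of M t] b by (intro mult_left_mono) (auto simp: divide_inverse)
        also have "b ^ (2 * M + 1) * inverse (pi ^ Suc M) * (pi ^ Suc M * 4 / (fact M * (1 + t\<^sup>2))) = b ^ (2 * M + 1) * 4 / (fact M * (1 + t\<^sup>2))"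
        proof -
          have *: "y * inverse p * (p * 4 / z) = y * 4 / z" if "p \<noteq> 0" for y p z :: real
            using that by simp
          show ?thesis by (rule *) simp
        qed
        finally show "norm (f (Complex (real (2 * Suc M)) t)) \<le> b ^ (2 * M + 1) * 4 / fact M / (1 + t\<^sup>2)"
          by simp
      qed (use b in auto)
    qed
    have b41: "norm (contour_integral (linepath a4 a1) f) \<le> pi powr (3/2) * pi ^ 2 * 4 / b ^ 4 * pi"
    proof -
      have a14: "a1 = Complex (-3) (-T)" "a4 = Complex (-3) T"
        by (simp_all add: a4_def a3_def a1_def)
      have "contour_integral (linepath a4 a1) f = - contour_integral (linepath a1 a4) f"
        using contour_integral_reversepath[of "linepath a1 a4" f] by simp
      moreover have "norm (contour_integral (linepath a1 a4) f) \<le> pi powr (3/2) * pi ^ 2 * 4 / b ^ 4 * pi"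
        unfolding a14
      proof (rule contour_integral_vertical_bound[OF T0])
        show "continuous_on (closed_segment (Complex (-3) (-T)) (Complex (-3) T)) f"
          using conts[OF segs(4)] unfolding a14 by (subst closed_segment_commute)
        fix t
        have nn: "norm (contour_numerator b (Complex (-3) t)) = pi powr (3/2) / b ^ 4"
        proof -
          have "b powr (Re (Complex (-3) t) - 1) = b powr (- real 4)" by simp
          also have "\<dots> = inverse (b powr real 4)" by (rule powr_minus)
          also have "b powr real 4 = b ^ 4" using b by (intro powr_realpow) auto
          finally have 1: "b powr (Re (Complex (-3) t) - 1) = inverse (b ^ 4)" .
          have 2: "pi powr (- Re (Complex (-3) t) / 2) = pi powr (3/2)" by simp
          have "norm (contour_numerator b (Complex (-3) t)) = inverse (b ^ 4) * pi powr (3/2)"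
            unfolding 1[symmetric] 2[symmetric] using b by (intro norm_contour_numerator) auto
          also have "\<dots> = pi powr (3/2) / b ^ 4" unfolding divide_inverse[of _ "b ^ 4"] by (rule mult.commute)
          finally show ?thesis .
        qed
        \<comment> \<open>Reflection maps the left side to the line Re w = 4, where the bound for
          the right side with M = 1 applies.\<close>
        have "1 - Complex (-3) t = Complex (real (2 * Suc 1)) (- t)" by (simp add: complex_eq_iff)
        then have "xi (Complex (-3) t) = xi (Complex (real (2 * Suc 1)) (- t))"
          using xi_symmetric[of "Complex (-3) t"] by simp
        then have "norm (inverse (xi (Complex (-3) t))) \<le> pi ^ 2 * 4 / (1 + t\<^sup>2)"
          using inverse_xi_vertical_bound[of 1 "-t"] by (simp add: numeral_2_eq_2)
        then have "norm (f (Complex (-3) t)) \<le> pi powr (3/2) / b ^ 4 * (pi ^ 2 * 4 / (1 + t\<^sup>2))"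
          unfolding f_def divide_inverse[of "contour_numerator b _"] norm_mult nn using b by (intro mult_left_mono) auto
        then show "norm (f (Complex (-3) t)) \<le> pi powr (3/2) * pi ^ 2 * 4 / b ^ 4 / (1 + t\<^sup>2)" by simp
      qed (use b in auto)
      ultimately show ?thesis by simp
    qed
    have "norm I \<le> norm (contour_integral (linepath a1 a2) f) + (norm (contour_integral (linepath a2 a3) f) + (norm (contour_integral (linepath a3 a4) f) + norm (contour_integral (linepath a4 a1) f)))"
      unfolding split by (meson norm_triangle_le add_left_mono norm_triangle_ineq order_trans)
    also have "\<dots> \<le> B * real (2 * M + 5) + (b ^ (2 * M + 1) * 4 / fact M * pi + (B * real (2 * M + 5) + pi powr (3/2) * pi ^ 2 * 4 / b ^ 4 * pi))"
      by (intro add_mono b12 b23 b34 b41)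
    also have "\<dots> = 2 * (real (2 * M + 5) * B) + (b ^ (2 * M + 1) * 4 / fact M + pi powr (3/2) * pi ^ 2 * 4 / b ^ 4) * pi"
      by (simp add: algebra_simps)
    finally show ?thesis unfolding B_def .
  qed
  ultimately have main: "norm (\<Sum>j<M. expansion_term b j) \<le> norm I / (2 * pi) + pi / norm (deriv xi 3) / b ^ 3 + C / sqrt b"
    and nI: "norm I \<le> 2 * (real (2 * M + 5) * (b ^ (2 * M + 1) * pi powr (3/2) * D / real n))
     + (b ^ (2 * M + 1) * 4 / fact M + pi powr (3/2) * pi ^ 2 * 4 / b ^ 4) * pi"
    by linarith+
  define Y where "Y = real (2 * M + 5) * (b ^ (2 * M + 1) * pi powr (3/2) * D / real n)"
  have Y0: "Y \<ge> 0" using b D by (simp add: Y_def)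
  have "norm I / (2 * pi) \<le> (2 * Y + (b ^ (2 * M + 1) * 4 / fact M + pi powr (3/2) * pi ^ 2 * 4 / b ^ 4) * pi) / (2 * pi)"
    using nI unfolding Y_def by (intro divide_right_mono) auto
  also have "\<dots> = Y / pi + (2 * b ^ (2 * M + 1) / fact M + 2 * (pi powr (3/2) * pi ^ 2) / b ^ 4)"
    by (simp add: add_divide_distrib distrib_right)
  also have "Y / pi \<le> Y / 1" using Y0 pi_gt3 by (intro divide_left_mono) auto
  also have "2 * (pi powr (3/2) * pi ^ 2) / b ^ 4 \<le> 2 * (pi powr (3/2) * pi ^ 2) / b ^ 3"
    using b by (intro divide_left_mono power_increasing mult_pos_pos) auto
  finally have "norm I / (2 * pi) \<le> Y + (2 * b ^ (2 * M + 1) / fact M + 2 * (pi powr (3/2) * pi ^ 2) / b ^ 3)" by simp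
  with main have "norm (\<Sum>j<M. expansion_term b j) \<le> Y + 2 * b ^ (2 * M + 1) / fact M + 2 * (pi powr (3/2) * pi ^ 2) / b ^ 3 + pi / norm (deriv xi 3) / b ^ 3 + C / sqrt b"
    by linarith
  also have "\<dots> = C / sqrt b + remainder_const / b ^ 3 + 2 * b ^ (2 * M + 1) / fact M + Y"
    by (simp add: remainder_const_def add_divide_distrib)
  finally show ?thesis by (simp add: Y_def mult.assoc)
qed

text \<open>D depends on M, so M stays fixed while n grows. The horizontal sides contribute O(1/n),
  and the other terms do not depend on n because C already bounds the sum over zeros of any
  height.\<close>

lemma expansion_partial_sum_bound:
  fixes b :: real
  assumes b: "b \<ge> 1" and M: "M \<ge> 1"
    and C: "((\<lambda>\<gamma>. norm (zero_coeff \<gamma>)) has_sum C) positive_ordinates"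
  shows "norm (\<Sum>j<M. expansion_term b j) \<le> C / sqrt b + remainder_const / b ^ 3 + 2 * b ^ (2 * M + 1) / fact M"
proof -
  obtain D where D: "D > 0" "\<And>n::nat. n \<ge> 2 \<Longrightarrow> (\<exists>T r. good_height (real (2 * M + 4)) D n T r)"
    using inverse_xi_horizontal_bound[of "real (2 * M + 4)"] by auto
  define X where "X = C / sqrt b + remainder_const / b ^ 3 + 2 * b ^ (2 * M + 1) / fact M"
  define Y where "Y = real (2 * M + 5) * (b ^ (2 * M + 1) * pi powr (3/2) * D)"
  have "(\<lambda>n. X + Y / real n) \<longlonglongrightarrow> X + 0"
    by (intro tendsto_add tendsto_const lim_const_over_n)
  moreover have "\<exists>N. \<forall>n\<ge>N. norm (\<Sum>j<M. expansion_term b j) \<le> X + Y / real n"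
  proof (intro exI[of _ 2] allI impI)
    fix n :: nat assume n: "n \<ge> 2"
    obtain T r where T: "real n \<le> T" "T \<le> real n + 1" "r > 0"
      "\<And>\<gamma>. critical_zero \<gamma> \<Longrightarrow> \<bar>\<bar>\<gamma>\<bar> - T\<bar> \<ge> r"
      "\<And>w. \<bar>Re w - 1/2\<bar> \<le> real (2 * M + 4) \<Longrightarrow> \<bar>Im w\<bar> = T \<Longrightarrow> norm (inverse (xi w)) \<le> D / real n"
      using D(2)[OF n] by blast
    show "norm (\<Sum>j<M. expansion_term b j) \<le> X + Y / real n"
      unfolding X_def Y_def by (rule contour_bound[OF b M n D(1) C T(1,3,4,5)])
  qed
  ultimately have "norm (\<Sum>j<M. expansion_term b j) \<le> X + 0" by (rule LIMSEQ_le_const)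
  then show ?thesis by (simp add: X_def)
qed

section \<open>From the partial sums of the expansion to F(b)\<close>

lemma exp_minus_Taylor_bound:
  fixes q :: real
  assumes "q \<ge> 0" shows "\<bar>exp (- q) - (\<Sum>m<n. (- q) ^ m / fact m)\<bar> \<le> exp q * q ^ n / fact n"
proof -
  obtain t where t: "\<bar>t\<bar> \<le> \<bar>- q\<bar>" "exp (- q) = (\<Sum>m<n. (- q) ^ m / fact m) + exp t / fact n * (- q) ^ n"
    using Maclaurin_exp_le[of "- q" n] by blast
  then have "\<bar>exp (- q) - (\<Sum>m<n. (- q) ^ m / fact m)\<bar> = exp t * (q ^ n / fact n)"
    using assms by (simp add: abs_mult power_abs)
  also have "\<dots> \<le> exp q * (q ^ n / fact n)" using t assms by (intro mult_right_mono) auto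
  finally show ?thesis by simp
qed

text \<open>The exponential is replaced by its Taylor polynomial of degree M in (b/n)^2. Summed over
  n, the power m gives the Moebius series at 2 m + 1; for m = 0 this is the conditionally convergent
  sum of mu(n)/n, which is 0. The remainder gains at least a factor 1/n, hence converges absolutely,
  and 2 bounds the sum of 1/n^2.\<close>

lemma moebius_gauss_sum_expansion:
  fixes b :: real
  assumes b: "b > 0"
  shows "norm (of_real (moebius_gauss_sum b) - (\<Sum>j<M. expansion_term b j)) \<le> 2 * exp (b\<^sup>2) * b ^ (2 * M + 2) / fact (Suc M)"
proof -
  define mu where "mu = (\<lambda>n. real_of_int (moebius (Suc n)))"
  define x where "x = (\<lambda>n. real (Suc n))"
  define q where "q = (\<lambda>n. (b / x n)\<^sup>2)"
  define R where "R = (\<lambda>n. exp (- q n) - (\<Sum>m<Suc M. (- q n) ^ m / fact m))"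
  define r where "r = (\<lambda>n. complex_of_real (mu n / x n * R n))"
  have x: "x n \<ge> 1" for n by (simp add: x_def)
  have mu1: "\<bar>mu n\<bar> \<le> 1" for n using abs_moebius_le[of "Suc n"] unfolding mu_def by linarith
  have q0: "q n \<ge> 0" for n by (simp add: q_def)
  define B where "B = exp (b\<^sup>2) * b ^ (2 * M + 2) / fact (Suc M)"
  have B: "B \<ge> 0" using b by (simp add: B_def)
  have rb: "norm (r n) \<le> B * x n powr (-1 - 1)" for n
  proof -
    have qb: "q n \<le> b\<^sup>2"
      unfolding q_def using x[of n] b by (intro power_mono) (auto simp: divide_le_eq mult_le_cancel_left1)
    have "\<bar>R n\<bar> \<le> exp (q n) * q n ^ Suc M / fact (Suc M)" unfolding R_def by (rule exp_minus_Taylor_bound[OF q0])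
    also have "\<dots> \<le> exp (b\<^sup>2) * q n ^ Suc M / fact (Suc M)"
      using qb q0 by (intro divide_right_mono mult_right_mono) auto
    also have "q n ^ Suc M = b ^ (2 * M + 2) / x n ^ (2 * M + 2)"
      unfolding q_def power_divide power_mult[symmetric] by simp
    also have "exp (b\<^sup>2) * (b ^ (2 * M + 2) / x n ^ (2 * M + 2)) / fact (Suc M) = B / x n ^ (2 * M + 2)"
      by (simp add: B_def)
    also have "\<dots> \<le> B / x n ^ 1" using x[of n] B by (intro divide_left_mono power_increasing mult_pos_pos) auto
    finally have Rb: "\<bar>R n\<bar> \<le> B / x n" by simp
    have "norm (r n) = \<bar>mu n\<bar> / x n * \<bar>R n\<bar>" using x[of n] by (simp add: r_def norm_mult norm_divide)
    also have "\<dots> \<le> 1 / x n * (B / x n)"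
      using mu1[of n] x[of n] Rb by (intro mult_mono divide_right_mono) auto
    also have "\<dots> = B * x n powr (-1 - 1)" using x[of n] by (simp add: powr_minus powr_numeral power2_eq_square divide_inverse)
    finally show ?thesis .
  qed
  have sp: "summable (\<lambda>n. x n powr (-1 - 1))" "(\<Sum>n. x n powr (-1 - 1)) \<le> 2"
    using powr_Suc_sums_bound[of 1] by (simp_all add: x_def)
  have sr: "summable r"
    by (rule summable_norm_cancel, rule summable_comparison_test'[OF summable_mult[OF sp(1), of B]]) (use rb in auto)
  have nr: "norm (suminf r) \<le> 2 * B"
  proof -
    have "norm (suminf r) \<le> (\<Sum>n. B * x n powr (-1 - 1))" by (rule norm_suminf_le[OF rb summable_mult[OF sp(1)]])
    also have "\<dots> = B * (\<Sum>n. x n powr (-1 - 1))" by (rule suminf_mult[OF sp(1)])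
    also have "\<dots> \<le> B * 2" by (intro mult_left_mono sp B)
    finally show ?thesis by simp
  qed
  have pieces: "(\<lambda>n. complex_of_real (mu n / x n * ((- q n) ^ m / fact m))) sums (case m of 0 \<Rightarrow> 0 | Suc j \<Rightarrow> expansion_term b j)" for m
  proof -
    have "(\<lambda>n. (-1) ^ m * of_real b ^ (2 * m) / fact m * (of_int (moebius (Suc n)) * of_nat (Suc n) powr (- of_nat (2 * m + 1)))) sums
      ((-1) ^ m * of_real b ^ (2 * m) / fact m * mertens_series (of_nat (2 * m + 1)))"
      by (intro sums_mult moebius_sums_mertens_series) simp
    moreover have "(-1) ^ m * of_real b ^ (2 * m) / fact m * (of_int (moebius (Suc n)) * of_nat (Suc n) powr (- of_nat (2 * m + 1))) = complex_of_real (mu n / x n * ((- q n) ^ m / fact m))" for n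
    proof -
      have p: "of_nat (Suc n) powr (- of_nat (2 * m + 1)) = complex_of_real (1 / x n ^ (2 * m + 1))"
      proof -
        have "of_nat (Suc n) powr (- of_nat (2 * m + 1)) = inverse (complex_of_nat (Suc n) powr of_nat (2 * m + 1))"
          by (rule powr_minus)
        also have "complex_of_nat (Suc n) powr of_nat (2 * m + 1) = of_nat (Suc n) ^ (2 * m + 1)"
          by (rule powr_nat') simp
        finally show ?thesis by (simp add: x_def divide_inverse)
      qed
      have qp: "(- q n) ^ m = (-1) ^ m * b ^ (2 * m) / x n ^ (2 * m)"
      proof -
        have "(- q n) ^ m = (-1) ^ m * q n ^ m" by (rule power_minus)
        also have "q n ^ m = b ^ (2 * m) / x n ^ (2 * m)" unfolding q_def by (simp add: power_divide flip: power_mult)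
        finally show ?thesis by simp
      qed
      show ?thesis unfolding p qp by (simp add: mu_def mult_ac)
    qed
    ultimately have s: "(\<lambda>n. complex_of_real (mu n / x n * ((- q n) ^ m / fact m))) sums
      ((-1) ^ m * of_real b ^ (2 * m) / fact m * mertens_series (of_nat (2 * m + 1)))" by simp
    show ?thesis
    proof (cases m)
      case 0
      then show ?thesis using s mertens_series_1 by simp
    next
      case (Suc j)
      have "2 * Suc j + 1 = 2 * j + 3" "2 * Suc j = 2 * j + 2" by simp_all
      then show ?thesis using s unfolding Suc expansion_term_def by (simp only: nat.case)
    qed
  qed
  have "(\<lambda>n. (\<Sum>m<Suc M. complex_of_real (mu n / x n * ((- q n) ^ m / fact m))) + r n) sums
    ((\<Sum>m<Suc M. (case m of 0 \<Rightarrow> 0 | Suc j \<Rightarrow> expansion_term b j)) + suminf r)"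
    by (intro sums_add sums_sum pieces summable_sums sr)
  also have "(\<Sum>m<Suc M. (case m of 0 \<Rightarrow> 0 | Suc j \<Rightarrow> expansion_term b j)) = (\<Sum>j<M. expansion_term b j)"
    by (subst sum.lessThan_Suc_shift) simp
  also have "(\<lambda>n. (\<Sum>m<Suc M. complex_of_real (mu n / x n * ((- q n) ^ m / fact m))) + r n) = (\<lambda>n. complex_of_real (mu n / x n * exp (- q n)))"
  proof
    fix n
    have "(\<Sum>m<Suc M. mu n / x n * ((- q n) ^ m / fact m)) + mu n / x n * R n = mu n / x n * exp (- q n)"
      unfolding R_def sum_distrib_left[symmetric] by (simp only: distrib_left[symmetric]) simp
    then show "(\<Sum>m<Suc M. complex_of_real (mu n / x n * ((- q n) ^ m / fact m))) + r n = complex_of_real (mu n / x n * exp (- q n))"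
      unfolding r_def by (simp only: of_real_add[symmetric] of_real_sum[symmetric])
  qed
  finally have cs: "(\<lambda>n. complex_of_real (mu n / x n * exp (- q n))) sums ((\<Sum>j<M. expansion_term b j) + suminf r)" .
  then have "(\<lambda>n. mu n / x n * exp (- q n)) sums Re ((\<Sum>j<M. expansion_term b j) + suminf r)"
    using sums_Re by fastforce
  then have "moebius_gauss_sum b = Re ((\<Sum>j<M. expansion_term b j) + suminf r)"
    and "(\<lambda>n. mu n / x n * exp (- q n)) sums moebius_gauss_sum b"
    by (simp_all add: moebius_gauss_sum_def mu_def x_def q_def sums_iff)
  then have "(\<lambda>n. complex_of_real (mu n / x n * exp (- q n))) sums of_real (moebius_gauss_sum b)"
    by (simp only: sums_of_real_iff)
  then have "of_real (moebius_gauss_sum b) = (\<Sum>j<M. expansion_term b j) + suminf r"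
    using cs sums_unique2 by blast
  then show ?thesis using nr by (simp add: B_def)
qed

text \<open>Both error terms are terms of the exponential series at b^2, up to factors that do not
  depend on M, so they vanish as M grows.\<close>

lemma moebius_gauss_sum_bound:
  fixes b :: real
  assumes b: "b \<ge> 1"
    and C: "((\<lambda>\<gamma>. norm (zero_coeff \<gamma>)) has_sum C) positive_ordinates"
  shows "\<bar>moebius_gauss_sum b\<bar> \<le> C / sqrt b + remainder_const / b ^ 3"
proof -
  define X where "X = C / sqrt b + remainder_const / b ^ 3"
  define E where "E = (\<lambda>M. 2 * b ^ (2 * M + 1) / fact M + 2 * exp (b\<^sup>2) * b ^ (2 * M + 2) / fact (Suc M))"
  have lim: "(\<lambda>n. (b\<^sup>2) ^ n / fact n) \<longlonglongrightarrow> 0"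
    using summable_LIMSEQ_zero[OF summable_exp[of "b\<^sup>2"]] by (simp add: divide_inverse mult.commute)
  have "(\<lambda>M. 2 * b * ((b\<^sup>2) ^ M / fact M) + 2 * exp (b\<^sup>2) * ((b\<^sup>2) ^ Suc M / fact (Suc M))) \<longlonglongrightarrow> 2 * b * 0 + 2 * exp (b\<^sup>2) * 0"
    by (intro tendsto_add tendsto_mult_left lim LIMSEQ_Suc[OF lim])
  moreover have "E = (\<lambda>M. 2 * b * ((b\<^sup>2) ^ M / fact M) + 2 * exp (b\<^sup>2) * ((b\<^sup>2) ^ Suc M / fact (Suc M)))"
  proof
    fix M
    have "b ^ (2 * M + 1) = b * (b\<^sup>2) ^ M" "b ^ (2 * M + 2) = (b\<^sup>2) ^ Suc M"
      by (simp_all add: power_mult power2_eq_square)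
    then show "E M = 2 * b * ((b\<^sup>2) ^ M / fact M) + 2 * exp (b\<^sup>2) * ((b\<^sup>2) ^ Suc M / fact (Suc M))"
      unfolding E_def by (simp only: times_divide_eq_right mult.assoc)
  qed
  ultimately have "E \<longlonglongrightarrow> 0" by simp
  then have "(\<lambda>M. X + E M) \<longlonglongrightarrow> X + 0" by (intro tendsto_add tendsto_const)
  moreover have "\<exists>N. \<forall>M\<ge>N. \<bar>moebius_gauss_sum b\<bar> \<le> X + E M"
  proof (intro exI[of _ 1] allI impI)
    fix M :: nat assume M: "M \<ge> 1"
    have "\<bar>moebius_gauss_sum b\<bar> = norm (complex_of_real (moebius_gauss_sum b))" by simp
    also have "\<dots> \<le> norm (of_real (moebius_gauss_sum b) - (\<Sum>j<M. expansion_term b j)) + norm (\<Sum>j<M. expansion_term b j)"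
      by (metis norm_triangle_sub add.commute)
    also have "\<dots> \<le> 2 * exp (b\<^sup>2) * b ^ (2 * M + 2) / fact (Suc M) + (X + 2 * b ^ (2 * M + 1) / fact M)"
      unfolding X_def by (intro add_mono moebius_gauss_sum_expansion expansion_partial_sum_bound b M C) (use b in auto)
    finally show "\<bar>moebius_gauss_sum b\<bar> \<le> X + E M" by (simp add: E_def)
  qed
  ultimately have "\<bar>moebius_gauss_sum b\<bar> \<le> X + 0" by (rule LIMSEQ_le_const)
  then show ?thesis by (simp add: X_def)
qed

end

text \<open>\<open>has_sum\<close> asserts convergence and determines C uniquely, so of the two
  quantified constants only K is a free choice, and it is made before b.\<close>

theorem theorem1:
  assumes "weak_mertens_hypothesis"
  shows "\<exists>C K :: real.
           ((\<lambda>\<gamma>. norm (zero_coeff \<gamma>)) has_sum C) positive_ordinates \<and>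
           (\<forall>b\<ge>pi. \<bar>moebius_gauss_sum b\<bar> \<le> C / sqrt b + K / b ^ 3)"
proof -
  obtain A where "A > 0" "\<And>N. (\<Sum>n<N. (mertens_nat (Suc n) / real (Suc n))\<^sup>2) \<le> A * harm N"
    using weak_mertens_harm_bound[OF assms] by blast
  then interpret mertens_bound A by unfold_locales
  obtain C where C: "((\<lambda>\<gamma>. norm (zero_coeff \<gamma>)) has_sum C) positive_ordinates"
    using zero_coeff_summable unfolding summable_on_def by blast
  have "\<bar>moebius_gauss_sum b\<bar> \<le> C / sqrt b + remainder_const / b ^ 3" if "b \<ge> pi" for b
    using that pi_gt3 by (intro moebius_gauss_sum_bound C) auto
  with C show ?thesis by blast
qed

end
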